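(* Let $N\ge3$ be an integer, $(N+2)/(N-2)<p<p_{JL}$ and $\lambda>0$. Let $u_*$ be the unique radial singular solution of $u''+\frac{N-1}{r}u'+\lambda u+|u|^{p-1}u=0$ and $r_*>0$ its smallest positive zero. Then for each $k\in\mathbb{N}$ there exists $\rho_k\in(0,r_* )$ such that for every $b$ with $|b-r_*|<\rho_k$ there exists $a_0\in(0,b)$ such that for every $a\in(0,a_0)$ the problem \[ u''+\frac{N-1}{r}u'+\lambda u+u^p=0,\ r\in(a,b),\qquad u(a)=u(b)=0, \] has at least $k$ positive solutions.
   Context: It is known (Merle–Peletier) that the equation has a unique solution $u_*$ near $0$ with $u_*(r)=A r^{-2/(p-1)}(1+o(1))$ as $r\to0^+$, where $A=\left[\frac{2}{p-1}\left(N-2-\frac{2}{p-1}\right)\right]^{1/(p-1)}$ (the singular solution); it has a positive zero. The Joseph–Lundgren exponent is $p_{JL}=1+\frac{4}{N-4-2\sqrt{N-1}}$ for $N\ge11$ and $p_{JL}=\infty$ for $3\le N\le10$. A positive solution is one positive on $(a,b)$. *)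

theory Defs
  imports "HOL-Analysis.Analysis" "HOL-Library.Extended_Real"
begin

definition pJL :: "nat \<Rightarrow> ereal" where
  "pJL N = (if N \<ge> 11 then ereal (1 + 4 / (real N - 4 - 2 * sqrt (real N - 1))) else \<infinity>)"

definition sing_const :: "nat \<Rightarrow> real \<Rightarrow> real" where
  "sing_const N p = ((2 / (p - 1)) * (real N - 2 - 2 / (p - 1))) powr (1 / (p - 1))"

definition singular_solution :: "nat \<Rightarrow> real \<Rightarrow> real \<Rightarrow> (real \<Rightarrow> real) \<Rightarrow> bool" where
  "singular_solution N p lam u \<longleftrightarrow>
     (\<exists>u' u''. \<forall>r>0. (u has_real_derivative u' r) (at r) \<and>
                     (u' has_real_derivative u'' r) (at r) \<and>
                     u'' r + (real N - 1) / r * u' r + lam * u r + \<bar>u r\<bar> powr (p - 1) * u r = 0) \<and>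
     ((\<lambda>r. u r / (sing_const N p * r powr (- 2 / (p - 1)))) \<longlongrightarrow> 1) (at_right 0)"

definition positive_dirichlet_solution ::
  "nat \<Rightarrow> real \<Rightarrow> real \<Rightarrow> real \<Rightarrow> real \<Rightarrow> (real \<Rightarrow> real) \<Rightarrow> bool" where
  "positive_dirichlet_solution N p lam a b u \<longleftrightarrow>
     continuous_on {a..b} u \<and> u a = 0 \<and> u b = 0 \<and>
     (\<forall>r\<in>{a<..<b}. u r > 0) \<and>
     (\<exists>u' u''. \<forall>r\<in>{a<..<b}. (u has_real_derivative u' r) (at r) \<and>
                     (u' has_real_derivative u'' r) (at r) \<and>
                     u'' r + (real N - 1) / r * u' r + lam * u r + u r powr p = 0)"

end

(*
  For an annulus of inner radius a, write the solution with u(a) = 0 as a solution of a Volterra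
  equation whose inhomogeneity alpha (1 - (a/r)^(N-2)) tends, as a -> 0, to the constant alpha that
  produces the regular solution with u(0) = alpha.  The theorem then reduces to the fact that
  alpha |-> u(r_star; alpha), for regular solutions, changes sign infinitely often as alpha -> infinity:
  finitely many strict sign changes persist under small changes of b and a, and the intermediate value
  theorem in alpha gives a zero at b between any two of them; positivity on (a,b) is automatic.

  For the sign changes, follow the angle of (w, w') with w = u(.; alpha) - u_star on (0, r_star].  It is
  continuous in (r, alpha), starts in a fixed half plane near r = 0 and crosses the vertical axis only
  clockwise, so at r_star it tends to -infinity provided w has more and more sign changes.  By scaling,
  this follows from the case lambda = 0, where in the variables t = ln r, v = r^(2/(p-1)) u the regular
  orbit has negative energy, hence stays positive, and oscillates about the equilibrium A, which is a
  focus exactly when p is below the Joseph-Lundgren exponent.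
*)
theory Submission
  imports Defs
begin

section \<open>A Volterra equation for radial solutions\<close>

text \<open>Three obstacles shape the proof. The annular inhomogeneity does not tend to \<alpha>
  uniformly in r, since it vanishes on [0, a]; after multiplication by r the difference is at most
  \<alpha> * a. All stability estimates therefore bound r * |u r - v r|, and division by r takes
  place only at fixed positive radii. The power must be Lipschitz along solutions that may change
  sign. With the nonlinearity cut off at negative values the source is never negative, so u \<le>
  \<alpha> comes for free from the positive kernel, and the flux r ^ (m + 1) * u' is monotone. The
  singular solution obeys the cut-off equation only up to \<open>r_star\<close>, where it is
  nonnegative. The count of sign changes of w is available only for one suitable \<alpha> at a time
  and only near r = 0, whereas signs are wanted at the fixed radius \<open>r_star\<close> for an
  increasing sequence of \<alpha>. A single lift of the angle over all pairs (r, \<alpha>) bridges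
  this: in r it carries the rotation out to \<open>r_star\<close>, in \<alpha> it is continuous and,
  once unbounded below, meets every multiple of \<pi> far enough down.\<close>

definition vol :: "nat \<Rightarrow> (real \<Rightarrow> real) \<Rightarrow> real \<Rightarrow> real" where
  "vol m \<phi> r = (integral {0..r} (\<lambda>t. t * \<phi> t) - integral {0..r} (\<lambda>t. t ^ (m + 1) * \<phi> t) / r ^ m) / real m"

lemma has_derivative_integral_at:
  fixes g :: "real \<Rightarrow> real"
  assumes "continuous_on {0..} g" "r > 0"
  shows "((\<lambda>x. integral {0..x} g) has_real_derivative g r) (at r)"
proof -
  have c: "continuous_on {0..r+1} g"
    using assms by (auto intro: continuous_on_subset)
  have "((\<lambda>x. integral {0..x} g) has_real_derivative g r) (at r within {0..r+1})"
    by (rule integral_has_real_derivative[OF c]) (use assms in auto)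
  moreover have "at r within {0..r+1} = at r"
    by (rule at_within_interior) (use assms in auto)
  ultimately show ?thesis by simp
qed

lemma continuous_integrable_atMost:
  fixes g :: "real \<Rightarrow> real"
  assumes "continuous_on {0..} g"
  shows "g integrable_on {0..r}"
  by (rule integrable_continuous_real) (use assms in \<open>auto intro: continuous_on_subset\<close>)

text \<open>The two boundary terms \<open>r * \<phi> r\<close> cancel. As the flux r ^ (m + 1) * v'
  of v = \<open>vol m \<phi>\<close> is the integral of \<open>t ^ (m + 1) * \<phi> t\<close>, the
  operator \<open>vol m\<close> inverts the radial Laplacian in dimension m + 2 with zero value and
  slope at the origin.\<close>

lemma vol_has_derivative:
  assumes "continuous_on {0..} \<phi>" "r > 0" "m > 0"
  shows "(vol m \<phi> has_real_derivative integral {0..r} (\<lambda>t. t ^ (m + 1) * \<phi> t) / r ^ (m + 1)) (at r)"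
proof -
  have 1: "((\<lambda>x. integral {0..x} (\<lambda>t. t * \<phi> t)) has_real_derivative r * \<phi> r) (at r)"
    by (rule has_derivative_integral_at) (use assms in \<open>auto intro!: continuous_intros\<close>)
  have 2: "((\<lambda>x. integral {0..x} (\<lambda>t. t ^ (m + 1) * \<phi> t)) has_real_derivative r ^ (m + 1) * \<phi> r) (at r)"
    by (rule has_derivative_integral_at) (use assms in \<open>auto intro!: continuous_intros\<close>)
  let ?I = "integral {0..r} (\<lambda>t. t * \<phi> t)" and ?J = "integral {0..r} (\<lambda>t. t ^ (m + 1) * \<phi> t)"
  have 3: "((\<lambda>x. x ^ m) has_real_derivative real m * r ^ (m - 1)) (at r)"
    using DERIV_pow[of m r] by simp
  have "(vol m \<phi> has_real_derivative (r * \<phi> r - (r ^ (m + 1) * \<phi> r * r ^ m - ?J * (real m * r ^ (m - 1))) / (r ^ m * r ^ m)) / real m) (at r)"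
    unfolding vol_def[abs_def]
    by (rule DERIV_cdivide, rule DERIV_diff, rule 1, rule DERIV_divide, rule 2, rule 3) (use assms in simp)
  also have "(r * \<phi> r - (r ^ (m + 1) * \<phi> r * r ^ m - ?J * (real m * r ^ (m - 1))) / (r ^ m * r ^ m)) / real m = ?J / r ^ (m + 1)"
  proof -
    obtain k where k: "m = Suc k" using assms(3) by (cases m) auto
    show ?thesis using assms(2) unfolding k by (simp add: divide_simps)
  qed
  finally show ?thesis .
qed

text \<open>The definition is convenient for differentiation; sign and size are read off from this
  single integral, whose kernel is nonnegative on [0, r].\<close>

lemma vol_eq:
  assumes "continuous_on {0..} \<phi>" "r > 0"
  shows "vol m \<phi> r = integral {0..r} (\<lambda>t. t * (1 - (t / r) ^ m) / real m * \<phi> t)"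
proof -
  have i1: "(\<lambda>t. t * \<phi> t) integrable_on {0..r}"
    by (rule continuous_integrable_atMost) (use assms in \<open>auto intro!: continuous_intros\<close>)
  have i2: "(\<lambda>t. t ^ (m + 1) * \<phi> t) integrable_on {0..r}"
    by (rule continuous_integrable_atMost) (use assms in \<open>auto intro!: continuous_intros\<close>)
  have "vol m \<phi> r = integral {0..r} (\<lambda>t. (t * \<phi> t - t ^ (m + 1) * \<phi> t / r ^ m) / real m)"
    unfolding vol_def using i1 i2 by (simp add: integral_diff integrable_on_divide)
  also have "(\<lambda>t. (t * \<phi> t - t ^ (m + 1) * \<phi> t / r ^ m) / real m) = (\<lambda>t. t * (1 - (t / r) ^ m) / real m * \<phi> t)"
    by (rule ext) (simp add: power_divide field_simps)
  finally show ?thesis .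
qed

lemma vol_0 [simp]: "vol m \<phi> 0 = 0"
  by (simp add: vol_def)

lemma vol_diff:
  assumes "continuous_on {0..} \<phi>" "continuous_on {0..} \<psi>"
  shows "vol m \<phi> r - vol m \<psi> r = vol m (\<lambda>t. \<phi> t - \<psi> t) r"
proof -
  have *: "(\<lambda>t. t ^ k * g t) integrable_on {0..r}" if "continuous_on {0..} g" for g :: "real \<Rightarrow> real" and k
    by (rule continuous_integrable_atMost) (use that in \<open>auto intro!: continuous_intros\<close>)
  note i = *[OF assms(1), of 1] *[OF assms(2), of 1] *[OF assms(1), of "m+1"] *[OF assms(2), of "m+1"]
  show ?thesis
    unfolding vol_def using i by (simp add: right_diff_distrib integral_diff diff_divide_distrib)
qed

lemma kernel_bounds:
  fixes t r :: real
  assumes "m > 0" "0 \<le> t" "t \<le> r" "r > 0"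
  shows "0 \<le> t * (1 - (t / r) ^ m) / real m" "t * (1 - (t / r) ^ m) / real m \<le> t"
proof -
  have q: "0 \<le> t / r" "t / r \<le> 1" using assms by auto
  then have "0 \<le> (t / r) ^ m" "(t / r) ^ m \<le> 1" by (auto intro: power_le_one)
  then show "0 \<le> t * (1 - (t / r) ^ m) / real m" using assms by auto
  have "t * (1 - (t / r) ^ m) \<le> t * 1" using \<open>0 \<le> (t / r) ^ m\<close> assms by (intro mult_left_mono) auto
  also have "\<dots> \<le> t * real m" using assms by (intro mult_left_mono) auto
  finally show "t * (1 - (t / r) ^ m) / real m \<le> t" using assms by (simp add: divide_le_eq)
qed

lemma vol_nonneg:
  assumes "continuous_on {0..} \<phi>" "m > 0" "r \<ge> 0" "\<And>t. 0 \<le> t \<Longrightarrow> t \<le> r \<Longrightarrow> \<phi> t \<ge> 0"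
  shows "vol m \<phi> r \<ge> 0"
proof (cases "r = 0")
  case False
  then have r: "r > 0" using assms by auto
  show ?thesis
    unfolding vol_eq[OF assms(1) r]
  proof (rule integral_nonneg)
    show "(\<lambda>t. t * (1 - (t / r) ^ m) / real m * \<phi> t) integrable_on {0..r}"
      by (rule continuous_integrable_atMost) (use assms r in \<open>auto intro!: continuous_intros\<close>)
    show "0 \<le> t * (1 - (t / r) ^ m) / real m * \<phi> t" if "t \<in> {0..r}" for t
      using that assms(4) kernel_bounds(1)[OF assms(2) _ _ r] by (intro mult_nonneg_nonneg) auto
  qed
qed simp

text \<open>The kernel is at most t, uniformly in r and m, so a bound on \<open>t * \<phi> t\<close>
  is enough. This is what later allows differences of solutions to be measured after multiplication
  by the radius.\<close>

lemma abs_vol_le: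
  assumes "continuous_on {0..} \<phi>" "continuous_on {0..} \<psi>" "m > 0" "r \<ge> 0"
    "\<And>t. 0 \<le> t \<Longrightarrow> t \<le> r \<Longrightarrow> \<bar>t * \<phi> t\<bar> \<le> \<psi> t"
  shows "\<bar>vol m \<phi> r\<bar> \<le> integral {0..r} \<psi>"
proof (cases "r = 0")
  case False
  then have r: "r > 0" using assms by auto
  have "norm (integral {0..r} (\<lambda>t. t * (1 - (t / r) ^ m) / real m * \<phi> t)) \<le> integral {0..r} \<psi>"
  proof (rule integral_norm_bound_integral)
    fix t assume t: "t \<in> {0..r}"
    have "norm (t * (1 - (t / r) ^ m) / real m * \<phi> t) \<le> t * \<bar>\<phi> t\<bar>"
      unfolding real_norm_def abs_mult[of _ "\<phi> t"]
      using kernel_bounds[OF assms(3) _ _ r, of t] t by (intro mult_right_mono) auto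
    also have "\<dots> \<le> \<psi> t" using assms(5)[of t] t by (simp add: abs_mult)
    finally show "norm (t * (1 - (t / r) ^ m) / real m * \<phi> t) \<le> \<psi> t" .
  qed (use assms r in \<open>auto intro!: continuous_integrable_atMost continuous_intros\<close>)
  then show ?thesis unfolding vol_eq[OF assms(1) r] by simp
qed simp

lemma abs_vol_le_const:
  assumes "continuous_on {0..} \<phi>" "m > 0" "r \<ge> 0" "\<And>t. 0 \<le> t \<Longrightarrow> t \<le> r \<Longrightarrow> \<bar>\<phi> t\<bar> \<le> B"
  shows "\<bar>vol m \<phi> r\<bar> \<le> B * r\<^sup>2"
proof -
  have "\<bar>t * \<phi> t\<bar> \<le> r * B" if "0 \<le> t" "t \<le> r" for t
    using that assms(4)[OF that] by (auto simp: abs_mult intro!: mult_mono)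
  then have "\<bar>vol m \<phi> r\<bar> \<le> integral {0..r} (\<lambda>t. r * B)"
    by (intro abs_vol_le) (use assms in auto)
  also have "\<dots> = B * r\<^sup>2" using assms by (simp add: power2_eq_square)
  finally show ?thesis .
qed

text \<open>The derivative covers r > 0 only; continuity at the origin comes from the quadratic
  bound.\<close>

lemma continuous_on_vol:
  assumes "continuous_on {0..} \<phi>" "m > 0"
  shows "continuous_on {0..} (vol m \<phi>)"
  unfolding continuous_on_eq_continuous_within
proof
  fix r :: real assume "r \<in> {0..}"
  show "continuous (at r within {0..}) (vol m \<phi>)"
  proof (cases "r = 0")
    case False
    then have "(vol m \<phi> has_real_derivative integral {0..r} (\<lambda>t. t ^ (m + 1) * \<phi> t) / r ^ (m + 1)) (at r)"
      using \<open>r \<in> {0..}\<close> assms by (intro vol_has_derivative) auto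
    then show ?thesis
      using DERIV_isCont continuous_at_imp_continuous_within by blast
  next
    case True
    have "compact (\<phi> ` {0..1})"
      by (intro compact_continuous_image continuous_on_subset[OF assms(1)]) auto
    then obtain B where B: "\<And>t. t \<in> {0..1} \<Longrightarrow> \<bar>\<phi> t\<bar> \<le> B"
      by (metis (no_types, lifting) bounded_iff compact_imp_bounded imageI real_norm_def)
    have "((\<lambda>x. vol m \<phi> x) \<longlongrightarrow> 0) (at 0 within {0..})"
    proof (rule Lim_null_comparison)
      have "eventually (\<lambda>x::real. x < 1) (at 0 within {0..})"
        by (rule order_tendstoD[of _ 0]) (auto intro!: tendsto_eq_intros)
      moreover have "eventually (\<lambda>x::real. x \<ge> 0) (at 0 within {0..})"
        by (auto simp: eventually_at_filter)
      ultimately show "eventually (\<lambda>x. norm (vol m \<phi> x) \<le> B * x\<^sup>2) (at 0 within {0..})"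
        by eventually_elim (use assms B in \<open>auto intro!: abs_vol_le_const\<close>)
      show "((\<lambda>x::real. B * x\<^sup>2) \<longlongrightarrow> 0) (at 0 within {0..})"
        by (auto intro!: tendsto_eq_intros)
    qed
    then show ?thesis using True by (simp add: continuous_within)
  qed
qed

section \<open>Global existence and stability for the Volterra equation\<close>

lemma integral_weight_le:
  fixes M s :: real
  assumes "M > 0" "s \<ge> 0"
  shows "integral {0..s} (\<lambda>t. t * exp (M * t\<^sup>2 / 2)) \<le> exp (M * s\<^sup>2 / 2) / M"
proof -
  have "((\<lambda>t. t * exp (M * t\<^sup>2 / 2)) has_integral exp (M * s\<^sup>2 / 2) / M - exp (M * 0\<^sup>2 / 2) / M) {0..s}"
    by (rule fundamental_theorem_of_calculus)
      (use assms in \<open>auto intro!: derivative_eq_intros simp flip: has_real_derivative_iff_has_vector_derivative\<close>)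
  then show ?thesis using assms by (simp add: integral_unique)
qed

text \<open>Contraction for y = exp (- M * r^2 / 2) * u in the space of bounded continuous
  functions. The kernel bound t times the weight integrates to at most exp (M * s^2 / 2) / M, so the
  weighted operator has Lipschitz constant L / M on the whole half line at once and no continuation
  argument arises.\<close>

lemma volterra_exists:
  fixes f h :: "real \<Rightarrow> real"
  assumes m: "m > 0" and L: "L \<ge> 0" and lip: "\<And>x y. \<bar>f x - f y\<bar> \<le> L * \<bar>x - y\<bar>" and f0: "f 0 = 0"
    and h: "continuous_on {0..} h" and hB: "\<And>r. r \<ge> 0 \<Longrightarrow> \<bar>h r\<bar> \<le> B"
  obtains u where "continuous_on {0..} u" "\<And>r. r \<ge> 0 \<Longrightarrow> u r = h r - vol m (\<lambda>t. f (u t)) r"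
proof -
  \<comment> \<open>Makes \<open>L / M\<close> at most 1/2, and M positive even for L = 0.\<close>
  define M where "M = 2 * L + 1"
  have M: "M > 0" "L / M \<le> 1/2" using L by (auto simp: M_def field_simps)
  have fc: "continuous_on UNIV f"
  proof -
    have "L-lipschitz_on UNIV f" using lip L by (auto intro!: lipschitz_onI simp: dist_real_def)
    then show ?thesis by (rule lipschitz_on_continuous_on)
  qed
  define F where "F y s = exp (- M * s\<^sup>2 / 2) * (h s - vol m (\<lambda>t. f (exp (M * t\<^sup>2 / 2) * y t)) s)" for y s
  have cphi: "continuous_on {0..} (\<lambda>t. f (exp (M * t\<^sup>2 / 2) * y t))" if "continuous_on {0..} y" for y
    by (rule continuous_on_compose2[OF fc]) (use that in \<open>auto intro!: continuous_intros\<close>)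
  have contr: "\<bar>F y s - F z s\<bar> \<le> 1/2 * D"
    if y: "continuous_on {0..} y" "continuous_on {0..} z" and D: "\<And>t. t \<ge> 0 \<Longrightarrow> \<bar>y t - z t\<bar> \<le> D" and s: "s \<ge> 0"
    for y z s D
  proof -
    have D0: "D \<ge> 0" using D[of 0] by auto
    let ?e = "\<lambda>t. exp (M * t\<^sup>2 / 2)"
    have "\<bar>F y s - F z s\<bar> = exp (- M * s\<^sup>2 / 2) * \<bar>vol m (\<lambda>t. f (?e t * y t)) s - vol m (\<lambda>t. f (?e t * z t)) s\<bar>"
      unfolding F_def right_diff_distrib[symmetric] abs_mult by (simp add: abs_minus_commute)
    also have "\<dots> = exp (- M * s\<^sup>2 / 2) * \<bar>vol m (\<lambda>t. f (?e t * y t) - f (?e t * z t)) s\<bar>"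
      by (simp add: vol_diff cphi y)
    also have "\<bar>vol m (\<lambda>t. f (?e t * y t) - f (?e t * z t)) s\<bar> \<le> integral {0..s} (\<lambda>t. L * D * (t * ?e t))"
    proof (rule abs_vol_le)
      fix t :: real assume t: "0 \<le> t" "t \<le> s"
      have "\<bar>f (?e t * y t) - f (?e t * z t)\<bar> \<le> L * \<bar>?e t * y t - ?e t * z t\<bar>" by (rule lip)
      also have "\<dots> = L * (?e t * \<bar>y t - z t\<bar>)" by (simp add: abs_mult flip: right_diff_distrib)
      also have "\<dots> \<le> L * (?e t * D)" using D t L by (intro mult_left_mono) auto
      finally have "t * \<bar>f (?e t * y t) - f (?e t * z t)\<bar> \<le> t * (L * (?e t * D))"
        using t by (intro mult_left_mono) auto
      then show "\<bar>t * (f (?e t * y t) - f (?e t * z t))\<bar> \<le> L * D * (t * ?e t)"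
        using t unfolding abs_mult by (simp add: mult_ac)
    qed (use m s y in \<open>auto intro!: continuous_intros cphi\<close>)
    also have "\<dots> = L * D * integral {0..s} (\<lambda>t. t * ?e t)" by simp
    also have "\<dots> \<le> L * D * (?e s / M)"
      using integral_weight_le[OF M(1) s] L D0 by (intro mult_left_mono) auto
    finally have "\<bar>F y s - F z s\<bar> \<le> exp (- M * s\<^sup>2 / 2) * (L * D * (?e s / M))" by simp
    also have "\<dots> = L / M * D" by (simp add: exp_minus field_simps)
    also have "\<dots> \<le> 1/2 * D" using M D0 by (intro mult_right_mono) auto
    finally show ?thesis .
  qed
  have Fcont: "continuous_on {0..} (F y)" if "continuous_on {0..} y" for y
    unfolding F_def by (intro continuous_intros h continuous_on_vol m cphi that) auto
  \<comment> \<open>Elements of \<open>bcontfun\<close> live on the whole line, so the image is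
    continued to negative r by its value at 0.\<close>
  define T where "T y r = F (apply_bcontfun y) (max 0 r)" for y :: "real \<Rightarrow>\<^sub>C real" and r
  have yc: "continuous_on S (apply_bcontfun y)" for y :: "real \<Rightarrow>\<^sub>C real" and S
    using apply_bcontfun[of y] by (auto simp: bcontfun_def intro: continuous_on_subset)
  have Tb: "T y \<in> bcontfun" for y
  proof (rule bcontfun_normI)
    show "continuous_on UNIV (T y)"
      unfolding T_def by (rule continuous_on_compose2[OF Fcont[OF yc]]) (auto intro!: continuous_intros)
    fix r
    \<comment> \<open>Because \<open>f 0 = 0\<close>, the zero function goes to the weighted
      \<open>h\<close>, which is bounded by B; the contraction estimate then bounds
      \<open>T y\<close> by comparison with it.\<close>
    have z: "F (\<lambda>_. 0) s = exp (- M * s\<^sup>2 / 2) * h s" for s by (simp add: F_def f0 vol_def)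
    have "\<bar>T y r\<bar> \<le> \<bar>F y (max 0 r) - F (\<lambda>_. 0) (max 0 r)\<bar> + \<bar>F (\<lambda>_. 0) (max 0 r)\<bar>" unfolding T_def by linarith
    also have "\<dots> \<le> 1/2 * norm y + B"
    proof (rule add_mono)
      show "\<bar>F y (max 0 r) - F (\<lambda>_. 0) (max 0 r)\<bar> \<le> 1/2 * norm y"
        by (rule contr) (use norm_bounded[of y] in \<open>auto intro: yc\<close>)
      have "\<bar>F (\<lambda>_. 0) (max 0 r)\<bar> \<le> 1 * \<bar>h (max 0 r)\<bar>"
        unfolding z abs_mult using M by (intro mult_right_mono) auto
      then show "\<bar>F (\<lambda>_. 0) (max 0 r)\<bar> \<le> B" using hB[of "max 0 r"] by simp
    qed
    finally show "norm (T y r) \<le> 1/2 * norm y + B" by simp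
  qed
  have Ta: "apply_bcontfun (Bcontfun (T y)) = T y" for y by (rule Bcontfun_inverse[OF Tb])
  have "\<exists>!y. Bcontfun (T y) = y"
  proof (rule banach_fix_type)
    show "\<forall>y z. dist (Bcontfun (T y)) (Bcontfun (T z)) \<le> 1/2 * dist y z"
    proof (intro allI dist_bound)
      fix y z :: "real \<Rightarrow>\<^sub>C real" and x
      have "\<bar>F y (max 0 x) - F z (max 0 x)\<bar> \<le> 1/2 * dist y z"
        by (rule contr) (use dist_bounded[of y _ z] in \<open>auto intro: yc simp: dist_real_def\<close>)
      then show "dist (apply_bcontfun (Bcontfun (T y)) x) (apply_bcontfun (Bcontfun (T z)) x) \<le> 1/2 * dist y z"
        unfolding Ta by (simp add: dist_real_def T_def)
    qed
  qed auto
  then obtain y where y: "Bcontfun (T y) = y" by blast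
  have yT: "apply_bcontfun y r = F (apply_bcontfun y) r" if "r \<ge> 0" for r
    using arg_cong[OF y, of apply_bcontfun] that unfolding Ta by (metis T_def max.absorb2)
  define u where "u r = exp (M * r\<^sup>2 / 2) * apply_bcontfun y r" for r
  show ?thesis
  proof (rule that[of u])
    show "continuous_on {0..} u" unfolding u_def by (intro continuous_intros yc) auto
    fix r :: real assume "r \<ge> 0"
    have "u r = exp (M * r\<^sup>2 / 2) * F (apply_bcontfun y) r" using yT[OF \<open>r \<ge> 0\<close>] by (simp add: u_def)
    also have "\<dots> = h r - vol m (\<lambda>t. f (u t)) r"
      unfolding F_def u_def by (simp add: exp_minus field_simps)
    finally show "u r = h r - vol m (\<lambda>t. f (u t)) r" .
  qed
qed

text \<open>With I the integral of g, the function \<open>exp (- C * s) * (H + C * I s)\<close> has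
  nonpositive derivative, hence stays below its initial value H.\<close>

lemma gronwall:
  fixes g :: "real \<Rightarrow> real"
  assumes "continuous_on {0..} g" "C \<ge> 0" "r \<ge> 0"
    and le: "\<And>s. 0 \<le> s \<Longrightarrow> s \<le> r \<Longrightarrow> g s \<le> H + C * integral {0..s} g"
  shows "g r \<le> H * exp (C * r)"
proof -
  define I where "I = (\<lambda>s. integral {0..s} g)"
  define k where "k s = exp (- C * s) * (H + C * I s)" for s
  have cI: "continuous_on {0..r} I"
    unfolding I_def by (rule indefinite_integral_continuous_1) (rule continuous_integrable_atMost[OF assms(1)])
  have "k r \<le> k 0"
  proof (cases "r = 0")
    case False
    show ?thesis
    proof (rule DERIV_nonpos_imp_decreasing_open[of 0 r k])
      fix x assume x: "0 < x" "x < r"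
      have "(I has_real_derivative g x) (at x)"
        unfolding I_def by (rule has_derivative_integral_at) (use assms x in auto)
      then have "(k has_real_derivative C * exp (- C * x) * (g x - (H + C * I x))) (at x)"
        unfolding k_def by (auto intro!: derivative_eq_intros simp: algebra_simps)
      moreover have "C * exp (- C * x) * (g x - (H + C * I x)) \<le> 0"
        using le[of x] x assms(2) unfolding I_def by (intro mult_nonneg_nonpos) auto
      ultimately show "\<exists>y. (k has_real_derivative y) (at x) \<and> y \<le> 0" by blast
    qed (use assms cI in \<open>auto simp: k_def intro!: continuous_intros\<close>)
  qed simp
  then have "exp (- C * r) * (H + C * I r) \<le> H" by (simp add: k_def I_def)
  then have "H + C * I r \<le> H * exp (C * r)" by (simp add: exp_minus field_simps)
  then show ?thesis using le[of r] assms(3) by (simp add: I_def)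
qed

text \<open>Gronwall for g(s) = s * |u s - v s|: the factor t of the kernel turns the Lipschitz
  bound into L * g under the integral, and the outer factor s costs at most R. Only r * |h - k| has
  to be small, which tolerates inhomogeneities that differ by O(1) near the origin.\<close>

lemma volterra_stability:
  fixes u v h k \<phi> \<psi> :: "real \<Rightarrow> real"
  assumes m: "m > 0" and L: "L \<ge> 0"
    and c: "continuous_on {0..} u" "continuous_on {0..} v" "continuous_on {0..} \<phi>" "continuous_on {0..} \<psi>"
    and u: "\<And>r. r \<ge> 0 \<Longrightarrow> u r = h r - vol m \<phi> r" and v: "\<And>r. r \<ge> 0 \<Longrightarrow> v r = k r - vol m \<psi> r"
    and lip: "\<And>r. r \<ge> 0 \<Longrightarrow> \<bar>\<phi> r - \<psi> r\<bar> \<le> L * \<bar>u r - v r\<bar>"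
    and hk: "\<And>r. 0 \<le> r \<Longrightarrow> r \<le> R \<Longrightarrow> r * \<bar>h r - k r\<bar> \<le> H"
    and r: "0 \<le> r" "r \<le> R"
  shows "r * \<bar>u r - v r\<bar> \<le> H * exp (L * R * R)"
proof -
  have H: "H \<ge> 0" using hk[of 0] r by auto
  define g where "g s = s * \<bar>u s - v s\<bar>" for s
  have gc: "continuous_on {0..} g" unfolding g_def by (intro continuous_intros c)
  have "g r \<le> H * exp ((L * R) * r)"
  proof (rule gronwall[OF gc])
    fix s assume s: "0 \<le> s" "s \<le> r"
    have "\<bar>vol m (\<lambda>t. \<phi> t - \<psi> t) s\<bar> \<le> integral {0..s} (\<lambda>t. L * g t)"
    proof (rule abs_vol_le)
      fix t assume t: "0 \<le> t" "t \<le> s"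
      have "t * \<bar>\<phi> t - \<psi> t\<bar> \<le> t * (L * \<bar>u t - v t\<bar>)" using lip[of t] t by (intro mult_left_mono) auto
      then show "\<bar>t * (\<phi> t - \<psi> t)\<bar> \<le> L * g t" using t unfolding abs_mult g_def by (simp add: mult_ac)
    qed (use m s c gc in \<open>auto intro!: continuous_intros\<close>)
    then have V: "\<bar>vol m \<phi> s - vol m \<psi> s\<bar> \<le> L * integral {0..s} g"
      by (simp add: vol_diff c)
    have I: "integral {0..s} g \<ge> 0"
      by (rule integral_nonneg[OF continuous_integrable_atMost[OF gc]]) (auto simp: g_def)
    have "\<bar>u s - v s\<bar> \<le> \<bar>h s - k s\<bar> + \<bar>vol m \<phi> s - vol m \<psi> s\<bar>" using u[of s] v[of s] s by linarith
    then have "g s \<le> s * \<bar>h s - k s\<bar> + s * \<bar>vol m \<phi> s - vol m \<psi> s\<bar>"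
      unfolding g_def using s by (simp flip: distrib_left add: mult_left_mono)
    also have "s * \<bar>vol m \<phi> s - vol m \<psi> s\<bar> \<le> R * (L * integral {0..s} g)"
      using V s r by (intro mult_mono) auto
    also have "s * \<bar>h s - k s\<bar> \<le> H" using hk s r by auto
    finally show "g s \<le> H + L * R * integral {0..s} g" by (simp add: algebra_simps)
  qed (use L r in auto)
  also have "\<dots> \<le> H * exp (L * R * R)" using r L H by (intro mult_left_mono) (auto intro!: mult_left_mono)
  finally show ?thesis by (simp add: g_def)
qed

section \<open>Annular and regular solutions\<close>

text \<open>Cut off at 0 instead of extended oddly: positive solutions are the same, while the
  source is nonnegative whatever the sign of u.\<close>

definition nonlin :: "real \<Rightarrow> real \<Rightarrow> real \<Rightarrow> real" where
  "nonlin lam p u = lam * max u 0 + max u 0 powr p"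

lemma powr_lipschitz:
  fixes x y p M :: real
  assumes "p > 1" "0 \<le> x" "x \<le> y" "y \<le> M"
  shows "\<bar>x powr p - y powr p\<bar> \<le> p * M powr (p - 1) * (y - x)"
proof (cases "x = y")
  case False
  then have xy: "x < y" using assms by auto
  obtain l z where z: "x < z" "z < y" "((\<lambda>t. t powr p) has_real_derivative l) (at z)" "y powr p - x powr p = (y - x) * l"
  proof (rule MVT[OF xy, of "\<lambda>t. t powr p", THEN exE])
    show "continuous_on {x..y} (\<lambda>t. t powr p)"
      using assms by (intro continuous_on_powr' continuous_intros) auto
    show "(\<lambda>t. t powr p) differentiable (at t)" if "x < t" "t < y" for t
      using DERIV_powr[OF DERIV_ident _ DERIV_const, of t p] that assms
      by (auto simp: real_differentiable_def)
  qed blast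
  have "((\<lambda>t. t powr p) has_real_derivative p * z powr (p - 1)) (at z)"
    using z assms by (intro has_real_derivative_powr) auto
  then have l: "l = p * z powr (p - 1)" using z(3) DERIV_unique by blast
  have "l \<le> p * M powr (p - 1)" unfolding l using z assms by (intro mult_left_mono powr_mono2) auto
  moreover have "l \<ge> 0" unfolding l using assms by auto
  ultimately have "l * (y - x) \<le> p * M powr (p - 1) * (y - x)" "l * (y - x) \<ge> 0" using xy by (auto intro: mult_right_mono)
  then show ?thesis using z(4) by (simp add: mult.commute[of l])
qed simp

text \<open>All negative arguments go to 0, so an upper bound M alone controls the Lipschitz
  constant; for solutions it is provided by \<open>usol_le\<close>.\<close>

lemma nonlin_lipschitz:
  assumes "p > 1" "lam \<ge> 0" "x \<le> M" "y \<le> M"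
  shows "\<bar>nonlin lam p x - nonlin lam p y\<bar> \<le> (lam + p * M powr (p - 1)) * \<bar>x - y\<bar>"
proof (cases "M \<ge> 0")
  case True
  define a where "a = max x 0"
  define b where "b = max y 0"
  have ab: "0 \<le> a" "0 \<le> b" "a \<le> M" "b \<le> M" "\<bar>a - b\<bar> \<le> \<bar>x - y\<bar>" using assms True by (auto simp: a_def b_def)
  have "\<bar>a powr p - b powr p\<bar> \<le> p * M powr (p - 1) * \<bar>a - b\<bar>"
    using powr_lipschitz[of p a b M] powr_lipschitz[of p b a M] ab assms by (cases "a \<le> b") (auto simp: abs_minus_commute)
  moreover have "\<bar>lam * a - lam * b\<bar> = lam * \<bar>a - b\<bar>" using assms by (simp add: abs_mult flip: right_diff_distrib)
  ultimately have "\<bar>nonlin lam p x - nonlin lam p y\<bar> \<le> (lam + p * M powr (p - 1)) * \<bar>a - b\<bar>"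
    unfolding nonlin_def a_def[symmetric] b_def[symmetric] distrib_right by linarith
  also have "\<dots> \<le> (lam + p * M powr (p - 1)) * \<bar>x - y\<bar>" using ab assms by (intro mult_left_mono) auto
  finally show ?thesis .
qed (use assms in \<open>auto simp: nonlin_def\<close>)

lemma nonlin_nonneg: "lam \<ge> 0 \<Longrightarrow> nonlin lam p u \<ge> 0"
  by (simp add: nonlin_def)

lemma nonlin_nonpos [simp]: "u \<le> 0 \<Longrightarrow> nonlin lam p u = 0"
  by (simp add: nonlin_def)

lemma continuous_on_nonlin [continuous_intros]:
  "p > 1 \<Longrightarrow> continuous_on S g \<Longrightarrow> continuous_on S (\<lambda>x. nonlin lam p (g x))"
  unfolding nonlin_def by (intro continuous_intros continuous_on_powr') auto

text \<open>The function \<open>\<alpha> * profile m a\<close> is harmonic outside the ball of radius \<open>a\<close> and vanishes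
  inside it; for \<open>a = 0\<close> the conventions \<open>0 / x = 0\<close> and \<open>m > 0\<close> make it the constant \<open>\<alpha>\<close>, so that
  annular and regular solutions obey the same integral equation.\<close>

definition profile :: "nat \<Rightarrow> real \<Rightarrow> real \<Rightarrow> real" where
  "profile m a r = 1 - (a / max a r) ^ m"

definition volterra_solution :: "nat \<Rightarrow> real \<Rightarrow> real \<Rightarrow> real \<Rightarrow> real \<Rightarrow> (real \<Rightarrow> real) \<Rightarrow> bool" where
  "volterra_solution m lam p a \<alpha> u \<longleftrightarrow>
     continuous_on {0..} u \<and> (\<forall>r\<ge>0. u r = \<alpha> * profile m a r - vol m (\<lambda>t. nonlin lam p (u t)) r)"

definition usol :: "nat \<Rightarrow> real \<Rightarrow> real \<Rightarrow> real \<Rightarrow> real \<Rightarrow> real \<Rightarrow> real" where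
  "usol m lam p a \<alpha> = (SOME u. volterra_solution m lam p a \<alpha> u)"

definition mass :: "nat \<Rightarrow> real \<Rightarrow> real \<Rightarrow> real \<Rightarrow> real \<Rightarrow> real \<Rightarrow> real" where
  "mass m lam p a \<alpha> r = integral {0..r} (\<lambda>t. t ^ (m + 1) * nonlin lam p (usol m lam p a \<alpha> t))"

text \<open>The flux r ^ (m + 1) * u' is the constant flux \<open>\<alpha> * real m * a ^ m\<close>
  of the harmonic profile minus the mass of the source in the ball. The formula represents u' for r
  > a; inside the hole, where u vanishes, it does not.\<close>

definition dsol :: "nat \<Rightarrow> real \<Rightarrow> real \<Rightarrow> real \<Rightarrow> real \<Rightarrow> real \<Rightarrow> real" where
  "dsol m lam p a \<alpha> r = (\<alpha> * real m * a ^ m - mass m lam p a \<alpha> r) / r ^ (m + 1)"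

lemma profile_bounds:
  assumes "a \<ge> 0" "r \<ge> 0"
  shows "0 \<le> profile m a r" "profile m a r \<le> 1"
proof -
  have "0 \<le> a / max a r" "a / max a r \<le> 1" using assms by (auto simp: divide_le_eq_1)
  then have "0 \<le> (a / max a r) ^ m" "(a / max a r) ^ m \<le> 1" by (auto intro: power_le_one)
  then show "0 \<le> profile m a r" "profile m a r \<le> 1" by (auto simp: profile_def)
qed

lemma profile_0 [simp]: "m > 0 \<Longrightarrow> profile m 0 r = 1"
  by (simp add: profile_def)

lemma profile_inside: "0 < a \<Longrightarrow> r \<le> a \<Longrightarrow> profile m a r = 0"
  by (simp add: profile_def max_absorb1)

lemma continuous_on_profile: "a \<ge> 0 \<Longrightarrow> m > 0 \<Longrightarrow> continuous_on S (profile m a)"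
proof (cases "a = 0")
  case False
  assume "a \<ge> 0"
  with False show ?thesis unfolding profile_def[abs_def] by (intro continuous_intros) auto
qed (simp add: continuous_on_const cong: continuous_on_cong)

section \<open>The family of solutions with shooting parameter \<alpha>\<close>

locale emden =
  fixes m :: nat and lam p :: real
  assumes m: "m > 0" and lam: "lam \<ge> 0" and p: "p > 1"
begin

text \<open>Capping the argument at \<alpha> makes the nonlinearity globally Lipschitz. The solution
  of the capped equation is at most \<alpha> because kernel and source are nonnegative, so the cap
  is never active.\<close>

lemma volterra_solution_exists:
  assumes "a \<ge> 0" "\<alpha> \<ge> 0"
  shows "\<exists>u. volterra_solution m lam p a \<alpha> u"
proof -
  define f where "f u = nonlin lam p (min u \<alpha>)" for u
  have "\<bar>f x - f y\<bar> \<le> (lam + p * \<alpha> powr (p - 1)) * \<bar>x - y\<bar>" for x y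
  proof -
    have "\<bar>f x - f y\<bar> \<le> (lam + p * \<alpha> powr (p - 1)) * \<bar>min x \<alpha> - min y \<alpha>\<bar>"
      unfolding f_def by (rule nonlin_lipschitz) (use p lam in auto)
    also have "\<dots> \<le> (lam + p * \<alpha> powr (p - 1)) * \<bar>x - y\<bar>" using p lam by (intro mult_left_mono) auto
    finally show ?thesis .
  qed
  moreover have "f 0 = 0" using assms by (simp add: f_def nonlin_def)
  moreover have "\<bar>\<alpha> * profile m a r\<bar> \<le> \<alpha>" if "r \<ge> 0" for r
    using profile_bounds[of a r m] assms that by (auto simp: abs_mult mult_left_le)
  moreover have "continuous_on {0..} (\<lambda>r. \<alpha> * profile m a r)"
    using assms m by (intro continuous_intros continuous_on_profile)
  moreover have "lam + p * \<alpha> powr (p - 1) \<ge> 0" using p lam by auto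
  ultimately obtain u where u: "continuous_on {0..} u" "\<And>r. r \<ge> 0 \<Longrightarrow> u r = \<alpha> * profile m a r - vol m (\<lambda>t. f (u t)) r"
    using volterra_exists[OF m, of "lam + p * \<alpha> powr (p - 1)" f "\<lambda>r. \<alpha> * profile m a r" \<alpha>] by blast
  have "continuous_on {0..} (\<lambda>t. f (u t))" unfolding f_def by (intro continuous_intros p u)
  then have "vol m (\<lambda>t. f (u t)) r \<ge> 0" if "r \<ge> 0" for r
    using that m lam by (intro vol_nonneg) (auto simp: f_def nonlin_nonneg)
  moreover have "\<alpha> * profile m a r \<le> \<alpha>" if "r \<ge> 0" for r
    using profile_bounds[of a r m] assms that by (auto simp: mult_left_le)
  ultimately have le: "u r \<le> \<alpha>" if "r \<ge> 0" for r using u(2)[OF that] that by fastforce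
  have "vol m (\<lambda>t. f (u t)) r = vol m (\<lambda>t. nonlin lam p (u t)) r" if "r \<ge> 0" for r
    unfolding vol_def using le by (intro arg_cong2[where f = "(-)"] arg_cong2[where f = "(/)"] integral_cong) (auto simp: f_def min_absorb1)
  then show ?thesis using u unfolding volterra_solution_def by auto
qed

lemma
  assumes "a \<ge> 0" "\<alpha> \<ge> 0"
  shows continuous_on_usol: "continuous_on {0..} (usol m lam p a \<alpha>)"
    and usol_eq: "r \<ge> 0 \<Longrightarrow> usol m lam p a \<alpha> r = \<alpha> * profile m a r - vol m (\<lambda>t. nonlin lam p (usol m lam p a \<alpha> t)) r"
proof -
  have "volterra_solution m lam p a \<alpha> (usol m lam p a \<alpha>)"
    unfolding usol_def by (rule someI_ex[OF volterra_solution_exists[OF assms]])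
  then show "continuous_on {0..} (usol m lam p a \<alpha>)"
    "r \<ge> 0 \<Longrightarrow> usol m lam p a \<alpha> r = \<alpha> * profile m a r - vol m (\<lambda>t. nonlin lam p (usol m lam p a \<alpha> t)) r"
    by (auto simp: volterra_solution_def)
qed

lemma continuous_on_nonlin_usol:
  assumes "a \<ge> 0" "\<alpha> \<ge> 0"
  shows "continuous_on {0..} (\<lambda>t. nonlin lam p (usol m lam p a \<alpha> t))"
  by (intro continuous_intros p continuous_on_usol assms)

lemma usol_le_profile:
  assumes "a \<ge> 0" "\<alpha> \<ge> 0" "r \<ge> 0"
  shows "usol m lam p a \<alpha> r \<le> \<alpha> * profile m a r"
  using usol_eq[OF assms] vol_nonneg[OF continuous_on_nonlin_usol m] assms nonlin_nonneg[OF lam] by fastforce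

lemma usol_le:
  assumes "a \<ge> 0" "\<alpha> \<ge> 0" "r \<ge> 0"
  shows "usol m lam p a \<alpha> r \<le> \<alpha>"
  using usol_le_profile[OF assms] profile_bounds[of a r m] assms mult_left_le[of "profile m a r" \<alpha>] by auto

lemma usol_has_derivative:
  assumes "a \<ge> 0" "\<alpha> \<ge> 0" "r > a"
  shows "(usol m lam p a \<alpha> has_real_derivative dsol m lam p a \<alpha> r) (at r)"
proof -
  let ?u = "usol m lam p a \<alpha>"
  have r: "r > 0" using assms by auto
  have ev: "eventually (\<lambda>x. x \<in> {a<..}) (nhds r)" using assms by (intro eventually_nhds_in_open) auto
  have d: "((\<lambda>x. \<alpha> * (1 - a ^ m / x ^ m) - vol m (\<lambda>t. nonlin lam p (?u t)) x) has_real_derivative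
      \<alpha> * (real m * r ^ (m - 1) * a ^ m / (r ^ m * r ^ m)) - mass m lam p a \<alpha> r / r ^ (m + 1)) (at r)"
    unfolding mass_def
  proof (intro DERIV_diff DERIV_cmult vol_has_derivative continuous_on_nonlin_usol assms r m)
    have "((\<lambda>x. 1 - a ^ m / x ^ m) has_real_derivative 0 - (0 * r ^ m - a ^ m * (real m * r ^ (m - 1))) / (r ^ m * r ^ m)) (at r)"
      by (intro DERIV_diff DERIV_divide DERIV_const) (use r DERIV_pow[of m r] in auto)
    then show "((\<lambda>x. 1 - a ^ m / x ^ m) has_real_derivative real m * r ^ (m - 1) * a ^ m / (r ^ m * r ^ m)) (at r)"
      by (simp add: mult_ac)
  qed
  have e: "\<alpha> * (real m * r ^ (m - 1) * a ^ m / (r ^ m * r ^ m)) - mass m lam p a \<alpha> r / r ^ (m + 1) = dsol m lam p a \<alpha> r"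
  proof -
    obtain k where k: "m = Suc k" using m by (cases m) auto
    show ?thesis using r unfolding dsol_def diff_divide_distrib k by (simp add: field_simps)
  qed
  show ?thesis
    using d unfolding e
  proof (rule has_field_derivative_transform_within_open[where S = "{a<..}"])
    fix x assume "x \<in> {a<..}"
    then show "\<alpha> * (1 - a ^ m / x ^ m) - vol m (\<lambda>t. nonlin lam p (?u t)) x = ?u x"
      using usol_eq[OF assms(1,2), of x] assms by (simp add: profile_def max_absorb2 power_divide)
  qed (use assms in auto)
qed

lemma mass_has_derivative:
  assumes "a \<ge> 0" "\<alpha> \<ge> 0" "r > 0"
  shows "(mass m lam p a \<alpha> has_real_derivative r ^ (m + 1) * nonlin lam p (usol m lam p a \<alpha> r)) (at r)"
  unfolding mass_def
  by (rule has_derivative_integral_at) (intro continuous_intros continuous_on_nonlin_usol assms)+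

lemma dsol_has_derivative:
  assumes "a \<ge> 0" "\<alpha> \<ge> 0" "r > 0"
  shows "(dsol m lam p a \<alpha> has_real_derivative
    - (real m + 1) / r * dsol m lam p a \<alpha> r - nonlin lam p (usol m lam p a \<alpha> r)) (at r)"
proof -
  let ?c = "\<alpha> * real m * a ^ m - mass m lam p a \<alpha> r"
  have 3: "((\<lambda>x. x ^ (m + 1)) has_real_derivative (real m + 1) * r ^ m) (at r)"
    using DERIV_pow[of "m + 1" r] by (simp add: add.commute)
  have "(dsol m lam p a \<alpha> has_real_derivative
     ((0 - r ^ (m + 1) * nonlin lam p (usol m lam p a \<alpha> r)) * r ^ (m + 1) - ?c * ((real m + 1) * r ^ m)) / (r ^ (m + 1) * r ^ (m + 1))) (at r)"
    unfolding dsol_def[abs_def]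
    by (rule DERIV_divide, rule DERIV_diff, rule DERIV_const, rule mass_has_derivative[OF assms], rule 3) (use assms in simp)
  also have "((0 - r ^ (m + 1) * nonlin lam p (usol m lam p a \<alpha> r)) * r ^ (m + 1) - ?c * ((real m + 1) * r ^ m)) / (r ^ (m + 1) * r ^ (m + 1))
     = - (real m + 1) / r * dsol m lam p a \<alpha> r - nonlin lam p (usol m lam p a \<alpha> r)"
    unfolding dsol_def using assms(3) by (simp add: divide_simps) (simp add: algebra_simps)
  finally show ?thesis .
qed

text \<open>In the hole the profile vanishes, so u \<le> 0 there; the cut-off then kills the source,
  and the integral equation returns u = 0 exactly.\<close>

lemma usol_inside:
  assumes "0 < a" "\<alpha> \<ge> 0" "0 \<le> r" "r \<le> a"
  shows "usol m lam p a \<alpha> r = 0"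
proof -
  have "nonlin lam p (usol m lam p a \<alpha> t) = 0" if "0 \<le> t" "t \<le> r" for t
    using usol_le_profile[of a \<alpha> t] profile_inside[of a t m] that assms by (intro nonlin_nonpos) auto
  then have "\<bar>vol m (\<lambda>t. nonlin lam p (usol m lam p a \<alpha> t)) r\<bar> \<le> 0 * r\<^sup>2"
    by (intro abs_vol_le_const) (use assms m in \<open>auto intro!: continuous_on_nonlin_usol\<close>)
  then show ?thesis using usol_eq[of a \<alpha> r] profile_inside[of a r m] assms by simp
qed

lemma mass_inside:
  assumes "0 < a" "\<alpha> \<ge> 0"
  shows "mass m lam p a \<alpha> a = 0"
proof -
  have "mass m lam p a \<alpha> a = integral {0..a} (\<lambda>t. 0)"
    unfolding mass_def using usol_inside[OF assms] by (intro integral_cong) auto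
  then show ?thesis by simp
qed

lemma mass_mono:
  assumes "a \<ge> 0" "\<alpha> \<ge> 0" "0 \<le> r" "r \<le> s"
  shows "mass m lam p a \<alpha> r \<le> mass m lam p a \<alpha> s"
  unfolding mass_def
  using assms lam
  by (intro integral_subset_le continuous_integrable_atMost continuous_intros continuous_on_nonlin_usol)
     (auto intro!: mult_nonneg_nonneg nonlin_nonneg)

text \<open>The function \<open>r ^ (m + 1) * u' r\<close> is nonincreasing and positive near \<open>a\<close>, so \<open>u\<close> first
  increases and then decreases.\<close>

lemma usol_pos_between:
  assumes a: "a > 0" and al: "\<alpha> > 0" and b: "usol m lam p a \<alpha> b = 0" and c: "a < c" "c < b"
  shows "usol m lam p a \<alpha> c > 0"
proof (rule ccontr)
  let ?u = "usol m lam p a \<alpha>" and ?d = "dsol m lam p a \<alpha>"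
  assume "\<not> ?u c > 0"
  then have uc: "?u c \<le> 0" by simp
  have du: "(?u has_real_derivative ?d r) (at r)" if "r > a" for r
    using a al that by (intro usol_has_derivative) auto
  have cu: "continuous_on {x..y} ?u" if "x \<ge> 0" for x y
    using continuous_on_subset[OF continuous_on_usol[of a \<alpha>], of "{x..y}"] that a al by auto
  have "0 < \<alpha> * real m * a ^ m - mass m lam p a \<alpha> a"
    using mass_inside[of a \<alpha>] a al m by simp
  moreover have "isCont (mass m lam p a \<alpha>) a"
    using mass_has_derivative[of a \<alpha> a] a al DERIV_isCont by auto
  then have "((\<lambda>r. \<alpha> * real m * a ^ m - mass m lam p a \<alpha> r) \<longlongrightarrow> \<alpha> * real m * a ^ m - mass m lam p a \<alpha> a) (at_right a)"
    by (intro tendsto_intros) (auto simp: isCont_def intro: tendsto_mono[OF at_le])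
  ultimately have "eventually (\<lambda>r. \<alpha> * real m * a ^ m - mass m lam p a \<alpha> r > 0) (at_right a)"
    by (rule order_tendstoD(1)[rotated])
  then obtain e where e: "e > a" "\<And>r. a < r \<Longrightarrow> r < e \<Longrightarrow> \<alpha> * real m * a ^ m - mass m lam p a \<alpha> r > 0"
    unfolding eventually_at_right_field by auto
  define x where "x = (a + min e c) / 2"
  have x: "a < x" "x < e" "x < c" using e c by (auto simp: x_def min_def)
  have "?u a < ?u x"
  proof (rule DERIV_pos_imp_increasing_open[OF x(1)])
    fix r assume "a < r" "r < x"
    then show "\<exists>y. (?u has_real_derivative y) (at r) \<and> 0 < y"
      using du[of r] e(2)[of r] x a by (auto simp: dsol_def intro!: exI[of _ "?d r"] divide_pos_pos)
  qed (use a in \<open>auto intro!: cu\<close>)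
  then have ux: "?u x > 0" using usol_inside[of a \<alpha> a] a al by simp
  \<comment> \<open>Since u falls from a positive value at x to a nonpositive one at c, the flux is
    negative at some z between them. As \<open>mass\<close> grows with r it remains negative beyond
    z, so u decreases strictly from c to b and cannot be 0 at b.\<close>
  obtain z where z: "x < z" "z < c" "?u c - ?u x = (c - x) * ?d z"
    using MVT2[OF x(3), of ?u ?d] du x by force
  then have "(c - x) * ?d z < 0" using uc ux by linarith
  then have "?d z < 0" using x(3) by (simp add: mult_less_0_iff)
  moreover have "z ^ (m + 1) > 0" using z x a by (intro zero_less_power) auto
  ultimately have neg: "\<alpha> * real m * a ^ m - mass m lam p a \<alpha> z < 0"
    unfolding dsol_def divide_less_0_iff by linarith
  have "?u b < ?u c"
  proof (rule DERIV_neg_imp_decreasing_open[OF c(2)])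
    fix r assume r: "c < r" "r < b"
    have "mass m lam p a \<alpha> z \<le> mass m lam p a \<alpha> r"
      using r z x a al by (intro mass_mono) auto
    then show "\<exists>y. (?u has_real_derivative y) (at r) \<and> y < 0"
      using du[of r] neg r c a by (intro exI[of _ "?d r"]) (auto simp: dsol_def intro!: divide_neg_pos)
  qed (use a c in \<open>auto intro!: cu\<close>)
  then show False using uc b by simp
qed

lemma usol_dirichlet:
  assumes a: "a > 0" and al: "\<alpha> > 0" and b: "usol m lam p a \<alpha> b = 0" "a < b"
  shows "positive_dirichlet_solution (m + 2) p lam a b (usol m lam p a \<alpha>)"
  unfolding positive_dirichlet_solution_def
proof (intro conjI ballI exI)
  let ?u = "usol m lam p a \<alpha>"
  show "continuous_on {a..b} ?u"
    using continuous_on_subset[OF continuous_on_usol[of a \<alpha>], of "{a..b}"] a al by auto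
  show "?u a = 0" using usol_inside[of a \<alpha> a] a al by simp
  show "?u b = 0" by fact
  fix r assume r: "r \<in> {a<..<b}"
  then show pos: "?u r > 0" using usol_pos_between[OF a al b(1)] by auto
  show "(?u has_real_derivative dsol m lam p a \<alpha> r) (at r)"
    using a al r by (intro usol_has_derivative) auto
  show "(dsol m lam p a \<alpha> has_real_derivative
    - (real m + 1) / r * dsol m lam p a \<alpha> r - nonlin lam p (usol m lam p a \<alpha> r)) (at r)"
    using a al r by (intro dsol_has_derivative) auto
  show "(- (real m + 1) / r * dsol m lam p a \<alpha> r - nonlin lam p (usol m lam p a \<alpha> r)) +
     (real (m + 2) - 1) / r * dsol m lam p a \<alpha> r + lam * ?u r + ?u r powr p = 0"
    using pos unfolding nonlin_def minus_divide_left[symmetric] mult_minus_left by (simp add: add.commute)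
qed

section \<open>Dependence on \<alpha> and on the inner radius\<close>

lemma usol_lipschitz:
  assumes "a \<ge> 0" "0 \<le> \<alpha>" "\<alpha> \<le> M" "0 \<le> \<beta>" "\<beta> \<le> M" "0 \<le> r" "r \<le> R"
  shows "r * \<bar>usol m lam p a \<alpha> r - usol m lam p a \<beta> r\<bar> \<le>
    R * \<bar>\<alpha> - \<beta>\<bar> * exp ((lam + p * M powr (p - 1)) * R * R)"
proof (rule volterra_stability[OF m])
  show "r * \<bar>\<alpha> * profile m a r - \<beta> * profile m a r\<bar> \<le> R * \<bar>\<alpha> - \<beta>\<bar>" if "0 \<le> r" "r \<le> R" for r
    using that profile_bounds[of a r m] assms unfolding left_diff_distrib[symmetric] abs_mult
    by (intro mult_mono mult_left_le) auto
  show "\<bar>nonlin lam p (usol m lam p a \<alpha> r) - nonlin lam p (usol m lam p a \<beta> r)\<bar>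
     \<le> (lam + p * M powr (p - 1)) * \<bar>usol m lam p a \<alpha> r - usol m lam p a \<beta> r\<bar>" if "r \<ge> 0" for r
    using usol_le[of a \<alpha> r] usol_le[of a \<beta> r] assms that p lam by (intro nonlin_lipschitz) auto
qed (use assms p lam in \<open>auto intro!: continuous_on_usol continuous_on_nonlin_usol usol_eq\<close>)

text \<open>The profiles differ by (a / max a r) ^ m, which equals 1 on the hole for every a > 0.
  Its product with r is at most a, since m \<ge> 1, and this is the smallness that the weighted
  stability estimate asks for.\<close>

lemma usol_annulus_limit:
  assumes "a \<ge> 0" "0 \<le> \<alpha>" "0 \<le> r" "r \<le> R"
  shows "r * \<bar>usol m lam p a \<alpha> r - usol m lam p 0 \<alpha> r\<bar> \<le>
    \<alpha> * a * exp ((lam + p * \<alpha> powr (p - 1)) * R * R)"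
proof (rule volterra_stability[OF m])
  show "r * \<bar>\<alpha> * profile m a r - \<alpha> * profile m 0 r\<bar> \<le> \<alpha> * a" if "0 \<le> r" "r \<le> R" for r
  proof -
    have q: "0 \<le> a / max a r" "a / max a r \<le> 1" using assms that by (auto simp: divide_le_eq_1)
    then have "(a / max a r) ^ m \<le> (a / max a r) ^ 1" using m by (intro power_decreasing) auto
    then have "r * (a / max a r) ^ m \<le> r * (a / max a r)" using that by (intro mult_left_mono) auto
    also have "\<dots> \<le> a" using assms that by (auto simp: max_def field_simps intro: mult_right_mono)
    finally have "\<alpha> * (r * (a / max a r) ^ m) \<le> \<alpha> * a" using assms by (intro mult_left_mono) auto
    moreover have "\<bar>\<alpha> * profile m a r - \<alpha> * profile m 0 r\<bar> = \<alpha> * (a / max a r) ^ m"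
    proof -
      have "\<alpha> * profile m a r - \<alpha> * profile m 0 r = - (\<alpha> * (a / max a r) ^ m)"
        using m by (simp add: profile_def right_diff_distrib)
      then show ?thesis using q assms by (simp only: abs_minus_cancel) (simp add: abs_mult)
    qed
    ultimately show ?thesis by (simp add: mult_ac)
  qed
  show "\<bar>nonlin lam p (usol m lam p a \<alpha> r) - nonlin lam p (usol m lam p 0 \<alpha> r)\<bar>
     \<le> (lam + p * \<alpha> powr (p - 1)) * \<bar>usol m lam p a \<alpha> r - usol m lam p 0 \<alpha> r\<bar>" if "r \<ge> 0" for r
    using usol_le[of a \<alpha> r] usol_le[of 0 \<alpha> r] assms that p lam by (intro nonlin_lipschitz) auto
qed (use assms p lam in \<open>auto intro!: continuous_on_usol continuous_on_nonlin_usol usol_eq\<close>)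

text \<open>The integral equation at b can be solved for \<alpha>, because the profile is nonzero
  there and the integral only involves values on [0, b]. Hence different roots in \<alpha> give
  different solutions on the annulus.\<close>

lemma usol_inj:
  assumes "a > 0" "\<alpha> > 0" "\<beta> > 0" "a < b" "\<And>r. r \<in> {a..b} \<Longrightarrow> usol m lam p a \<alpha> r = usol m lam p a \<beta> r"
  shows "\<alpha> = \<beta>"
proof -
  have eq: "usol m lam p a \<alpha> r = usol m lam p a \<beta> r" if "0 \<le> r" "r \<le> b" for r
    using assms(5)[of r] usol_inside[of a \<alpha> r] usol_inside[of a \<beta> r] assms that by (cases "r \<le> a") auto
  have "vol m (\<lambda>t. nonlin lam p (usol m lam p a \<alpha> t)) b = vol m (\<lambda>t. nonlin lam p (usol m lam p a \<beta> t)) b"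
    unfolding vol_def using eq by (intro arg_cong2[where f = "(-)"] arg_cong2[where f = "(/)"] integral_cong) auto
  then have "\<alpha> * profile m a b = \<beta> * profile m a b"
    using usol_eq[of a \<alpha> b] usol_eq[of a \<beta> b] eq[of b] assms(1-4) by linarith
  moreover have "(a / b) ^ m < 1"
    using assms m power_Suc_less_one[of "a / b" "m - 1"] by simp
  then have "profile m a b \<noteq> 0" using assms by (simp add: profile_def max_absorb2)
  ultimately show ?thesis by simp
qed

lemma usol_continuous_param:
  assumes "a \<ge> 0" "r > 0"
  shows "continuous_on {0<..} (\<lambda>\<alpha>. usol m lam p a \<alpha> r)"
  unfolding continuous_on_eq_continuous_within
proof
  fix \<alpha> :: real assume al: "\<alpha> \<in> {0<..}"
  let ?C = "exp ((lam + p * (\<alpha> + 1) powr (p - 1)) * r * r)"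
  have "((\<lambda>\<beta>. usol m lam p a \<beta> r - usol m lam p a \<alpha> r) \<longlongrightarrow> 0) (at \<alpha> within {0<..})"
  proof (rule Lim_null_comparison)
    have "eventually (\<lambda>\<beta>. \<beta> < \<alpha> + 1) (at \<alpha> within {0<..})"
      by (rule order_tendstoD[of _ \<alpha>]) (auto intro!: tendsto_eq_intros)
    moreover have "eventually (\<lambda>\<beta>. \<beta> > 0) (at \<alpha> within {0<..})"
      by (auto simp: eventually_at_filter)
    ultimately show "eventually (\<lambda>\<beta>. norm (usol m lam p a \<beta> r - usol m lam p a \<alpha> r) \<le> \<bar>\<beta> - \<alpha>\<bar> * ?C) (at \<alpha> within {0<..})"
    proof eventually_elim
      case (elim \<beta>)
      then show ?case
        using usol_lipschitz[of a \<beta> "\<alpha> + 1" \<alpha> r r] al assms by (simp add: mult.assoc)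
    qed
    show "((\<lambda>\<beta>. \<bar>\<beta> - \<alpha>\<bar> * ?C) \<longlongrightarrow> 0) (at \<alpha> within {0<..})"
      by (rule tendsto_eq_intros tendsto_rabs refl | simp)+
  qed
  then show "continuous (at \<alpha> within {0<..}) (\<lambda>\<alpha>. usol m lam p a \<alpha> r)"
    unfolding continuous_within by (simp add: LIM_zero_iff)
qed

end

section \<open>Oscillation about the singular equilibrium\<close>

text \<open>The quantity \<phi> = w^2 + w'^2 satisfies |\<phi>'| \<le> C * \<phi> with C = 1 + 3 *
  K. Multiplying by an exponential transports \<phi> = 0 from \<open>t0\<close> forwards, and with
  the opposite sign backwards.\<close>

lemma second_order_unique:
  fixes w w1 w2 :: "real \<Rightarrow> real"
  assumes K: "K \<ge> 0"
    and d: "\<And>t. t \<in> {c..d} \<Longrightarrow> (w has_real_derivative w1 t) (at t)"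
           "\<And>t. t \<in> {c..d} \<Longrightarrow> (w1 has_real_derivative w2 t) (at t)"
    and b: "\<And>t. t \<in> {c..d} \<Longrightarrow> \<bar>w2 t\<bar> \<le> K * (\<bar>w t\<bar> + \<bar>w1 t\<bar>)"
    and t0: "t0 \<in> {c..d}" "w t0 = 0" "w1 t0 = 0" and t: "t \<in> {c..d}"
  shows "w t = 0"
proof -
  define C where "C = 1 + 3 * K"
  define \<phi> where "\<phi> s = (w s)\<^sup>2 + (w1 s)\<^sup>2" for s
  define \<phi>' where "\<phi>' s = 2 * w s * w1 s + 2 * w1 s * w2 s" for s
  have d\<phi>: "(\<phi> has_real_derivative \<phi>' s) (at s)" if "s \<in> {c..d}" for s
    unfolding \<phi>_def \<phi>'_def using d[OF that] by (auto intro!: derivative_eq_intros)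
  have le: "\<bar>\<phi>' s\<bar> \<le> C * \<phi> s" if "s \<in> {c..d}" for s
  proof -
    define x where "x = \<bar>w s\<bar>"
    define y where "y = \<bar>w1 s\<bar>"
    have xy: "2 * x * y \<le> x\<^sup>2 + y\<^sup>2" using zero_le_power2[of "x - y"] by (simp add: power2_diff)
    have "\<bar>\<phi>' s\<bar> \<le> 2 * x * y + 2 * y * \<bar>w2 s\<bar>"
      unfolding \<phi>'_def x_def y_def
      using abs_triangle_ineq[of "2 * w s * w1 s" "2 * w1 s * w2 s"] by (simp add: abs_mult)
    also have "\<dots> \<le> 2 * x * y + 2 * y * (K * (x + y))"
      using b[OF that] unfolding x_def y_def by (intro add_left_mono mult_left_mono) auto
    also have "\<dots> = (1 + K) * (2 * x * y) + 2 * K * y\<^sup>2" by (simp add: algebra_simps power2_eq_square)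
    also have "\<dots> \<le> (1 + K) * (x\<^sup>2 + y\<^sup>2) + 2 * K * (x\<^sup>2 + y\<^sup>2)"
      using K xy by (intro add_mono mult_left_mono) auto
    also have "\<dots> = C * \<phi> s" by (simp add: C_def \<phi>_def x_def y_def algebra_simps)
    finally show ?thesis .
  qed
  have "\<phi> t0 = 0" using t0 by (simp add: \<phi>_def)
  have "\<phi> t \<le> 0"
  proof (cases "t0 \<le> t")
    case True
    have "exp (- C * t) * \<phi> t \<le> exp (- C * t0) * \<phi> t0"
    proof (rule DERIV_nonpos_imp_nonincreasing[OF True])
      fix s assume s: "t0 \<le> s" "s \<le> t"
      then have s': "s \<in> {c..d}" using t t0 by auto
      have "((\<lambda>s. exp (- C * s) * \<phi> s) has_real_derivative exp (- C * s) * (\<phi>' s - C * \<phi> s)) (at s)"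
        using d\<phi>[OF s'] by (auto intro!: derivative_eq_intros simp: algebra_simps)
      moreover have "exp (- C * s) * (\<phi>' s - C * \<phi> s) \<le> 0" using le[OF s'] by (intro mult_nonneg_nonpos) auto
      ultimately show "\<exists>y. ((\<lambda>s. exp (- C * s) * \<phi> s) has_real_derivative y) (at s) \<and> y \<le> 0" by blast
    qed
    then show ?thesis using \<open>\<phi> t0 = 0\<close> by (simp add: mult_le_0_iff)
  next
    case False
    then have "t \<le> t0" by simp
    have "exp (C * t) * \<phi> t \<le> exp (C * t0) * \<phi> t0"
    proof (rule DERIV_nonneg_imp_nondecreasing[OF \<open>t \<le> t0\<close>])
      fix s assume s: "t \<le> s" "s \<le> t0"
      then have s': "s \<in> {c..d}" using t t0 by auto
      have "((\<lambda>s. exp (C * s) * \<phi> s) has_real_derivative exp (C * s) * (\<phi>' s + C * \<phi> s)) (at s)"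
        using d\<phi>[OF s'] by (auto intro!: derivative_eq_intros simp: algebra_simps)
      moreover have "exp (C * s) * (\<phi>' s + C * \<phi> s) \<ge> 0" using le[OF s'] by (intro mult_nonneg_nonneg) auto
      ultimately show "\<exists>y. ((\<lambda>s. exp (C * s) * \<phi> s) has_real_derivative y) (at s) \<and> 0 \<le> y" by blast
    qed
    then show ?thesis using \<open>\<phi> t0 = 0\<close> by (simp add: mult_le_0_iff)
  qed
  then show ?thesis by (simp add: \<phi>_def sum_power2_le_zero_iff)
qed

text \<open>A nonnegative solution of a damped oscillator must decay to \<open>0\<close>, where its linearisation is
  underdamped; Sturm comparison with a sine of frequency \<open>sqrt (\<kappa> - a\<^sup>2 / 4)\<close> then forces a zero.\<close>

lemma underdamped_zero:
  fixes z z1 \<gamma> :: "real \<Rightarrow> real"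
  assumes a: "a > 0" and \<kappa>: "\<kappa> > a\<^sup>2 / 4"
    and d: "\<And>t. t \<ge> T \<Longrightarrow> (z has_real_derivative z1 t) (at t)"
           "\<And>t. t \<ge> T \<Longrightarrow> (z1 has_real_derivative - a * z1 t - \<gamma> t) (at t)"
    and z: "\<And>t. t \<ge> T \<Longrightarrow> z t \<ge> 0" and \<gamma>: "\<And>t. t \<ge> T \<Longrightarrow> \<gamma> t \<ge> 0"
    and far: "\<And>\<eta>. \<eta> > 0 \<Longrightarrow> \<exists>g>0. \<forall>t\<ge>T. z t \<ge> \<eta> \<longrightarrow> \<gamma> t \<ge> g"
    and near: "\<exists>\<eta>>0. \<forall>t\<ge>T. z t \<le> \<eta> \<longrightarrow> \<gamma> t \<ge> \<kappa> * z t"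
  shows "\<exists>t>T. z t = 0"
proof -
  have small: "\<exists>t\<ge>S. z t < \<eta>" if \<eta>: "\<eta> > 0" and S: "S \<ge> T" for \<eta> S
  proof (rule ccontr)
    assume "\<not> ?thesis"
    then have big: "z t \<ge> \<eta>" if "t \<ge> S" for t using that by force
    obtain g where g: "g > 0" "\<And>t. t \<ge> T \<Longrightarrow> z t \<ge> \<eta> \<Longrightarrow> \<gamma> t \<ge> g" using far[OF \<eta>] by blast
    \<comment> \<open>The derivative of z' + a * z is -\<gamma>, at most -g as long as z \<ge>
      \<eta>; this combination therefore falls linearly, forces z' \<le> -1 and finally z <
      0.\<close>
    define q where "q t = z1 t + a * z t" for t
    have q: "q t \<le> q S - g * (t - S)" if "t \<ge> S" for t
    proof -
      have "q t + g * t \<le> q S + g * S"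
      proof (rule DERIV_nonpos_imp_nonincreasing[OF that])
        fix s assume s: "S \<le> s" "s \<le> t"
        then have "((\<lambda>t. q t + g * t) has_real_derivative - \<gamma> s + g) (at s)"
          unfolding q_def using S d[of s] by (auto intro!: derivative_eq_intros)
        moreover have "- \<gamma> s + g \<le> 0" using g(2)[of s] s S big by auto
        ultimately show "\<exists>y. ((\<lambda>t. q t + g * t) has_real_derivative y) (at s) \<and> y \<le> 0" by blast
      qed
      then show ?thesis by (simp add: algebra_simps)
    qed
    \<comment> \<open>Chosen so that the linear bound on q is at most -1 from \<open>t1\<close> on;
      then z' \<le> -1, and after a time \<open>z t1 + 1\<close> the function z is negative.\<close>
    define t1 where "t1 = S + (\<bar>q S\<bar> + 1) / g"
    have t1: "t1 \<ge> S" "g * (t1 - S) = \<bar>q S\<bar> + 1" using g by (auto simp: t1_def)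
    define t2 where "t2 = t1 + z t1 + 1"
    have zt1: "z t1 \<ge> 0" using z[of t1] t1 S by auto
    have "z t2 + t2 \<le> z t1 + t1"
    proof (rule DERIV_nonpos_imp_nonincreasing[where f = "\<lambda>t. z t + t"])
      show "t1 \<le> t2" using zt1 by (simp add: t2_def)
      fix s assume s: "t1 \<le> s" "s \<le> t2"
      then have "((\<lambda>t. z t + t) has_real_derivative z1 s + 1) (at s)"
        using S d[of s] t1 by (auto intro!: derivative_eq_intros)
      moreover have "z1 s + 1 \<le> 0"
      proof -
        have "g * (s - S) \<ge> g * (t1 - S)" using s g by (intro mult_left_mono) auto
        then have "q s \<le> -1" using q[of s] s t1 by linarith
        moreover have "a * z s \<ge> 0" using z[of s] s t1 S a by auto
        ultimately show ?thesis unfolding q_def by linarith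
      qed
      ultimately show "\<exists>y. ((\<lambda>t. z t + t) has_real_derivative y) (at s) \<and> y \<le> 0" by blast
    qed
    then have "z t2 < 0" using zt1 by (simp add: t2_def)
    then show False using z[of t2] t1 S zt1 by (auto simp: t2_def)
  qed
  \<comment> \<open>Otherwise z would increase strictly and stay above a positive value, against
    \<open>small\<close>. A nonpositive slope then persists because exp (a * t) * z' is
    nonincreasing, so z remains small once it is small.\<close>
  have "\<exists>t\<ge>T+1. z1 t \<le> 0"
  proof (rule ccontr)
    assume "\<not> ?thesis"
    then have pos: "z1 t > 0" if "t \<ge> T + 1" for t using that by force
    have inc: "z s < z t" if "T + 1 \<le> s" "s < t" for s t
      using DERIV_pos_imp_increasing[OF that(2), of z] d(1) pos that by (meson dual_order.trans less_add_one less_imp_le)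
    have "z (T + 2) > 0" using inc[of "T+1" "T+2"] z[of "T+1"] by auto
    then obtain t where "t \<ge> T + 2" "z t < z (T + 2)" using small[of "z (T + 2)" "T + 2"] by auto
    then show False using inc[of "T+2" t] by (cases "t = T + 2") auto
  qed
  then obtain t1 where t1: "t1 \<ge> T + 1" "z1 t1 \<le> 0" by blast
  have neg: "z1 t \<le> 0" if "t \<ge> t1" for t
  proof -
    have "exp (a * t) * z1 t \<le> exp (a * t1) * z1 t1"
    proof (rule DERIV_nonpos_imp_nonincreasing[OF that])
      fix s assume s: "t1 \<le> s" "s \<le> t"
      have "((\<lambda>t. exp (a * t) * z1 t) has_real_derivative - exp (a * s) * \<gamma> s) (at s)"
        using d(2)[of s] s t1 by (auto intro!: derivative_eq_intros simp: algebra_simps)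
      moreover have "- exp (a * s) * \<gamma> s \<le> 0" using \<gamma>[of s] s t1 by simp
      ultimately show "\<exists>y. ((\<lambda>t. exp (a * t) * z1 t) has_real_derivative y) (at s) \<and> y \<le> 0" by blast
    qed
    also have "\<dots> \<le> 0" using t1 by (simp add: mult_nonneg_nonpos)
    finally show ?thesis by (simp add: mult_le_0_iff)
  qed
  have dec: "z t \<le> z s" if "t1 \<le> s" "s \<le> t" for s t
    using DERIV_nonpos_imp_nonincreasing[OF that(2), of z] d(1) neg that t1 by (meson dual_order.trans less_add_one less_imp_le)
  obtain \<eta> where \<eta>: "\<eta> > 0" "\<And>t. t \<ge> T \<Longrightarrow> z t \<le> \<eta> \<Longrightarrow> \<gamma> t \<ge> \<kappa> * z t" using near by blast
  obtain t2 where t2: "t2 \<ge> t1" "z t2 < \<eta>" using small[OF \<eta>(1), of t1] t1 by auto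
  define \<omega> where "\<omega> = sqrt (\<kappa> - a\<^sup>2 / 4)"
  have \<omega>: "\<omega> > 0" "\<omega>\<^sup>2 = \<kappa> - a\<^sup>2 / 4" using \<kappa> by (auto simp: \<omega>_def)
  \<comment> \<open>The Wronskian of y = exp (a * t / 2) * z, from which the damping has been
    removed, with sin (\<omega> * (t - t2)). Over the half period up to \<open>t3\<close> it is
    nonincreasing, but it starts at -\<omega> * y(t2) \<le> 0 and ends at \<omega> * y(t3) \<ge> 0,
    so both vanish.\<close>
  define \<Phi> where "\<Phi> t = exp (a * t / 2) * ((z1 t + a / 2 * z t) * sin (\<omega> * (t - t2)) - \<omega> * z t * cos (\<omega> * (t - t2)))" for t
  define t3 where "t3 = t2 + pi / \<omega>"
  have t3: "t3 > t2" using \<omega> by (simp add: t3_def)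
  have "\<Phi> t3 \<le> \<Phi> t2"
  proof (rule DERIV_nonpos_imp_nonincreasing[where f = \<Phi>])
    fix s assume s: "t2 \<le> s" "s \<le> t3"
    have sT: "s \<ge> T" using s t2 t1 by auto
    have "(\<Phi> has_real_derivative exp (a * s / 2) * sin (\<omega> * (s - t2)) * (a\<^sup>2 / 4 * z s + \<omega>\<^sup>2 * z s - \<gamma> s)) (at s)"
      unfolding \<Phi>_def
      using d[OF sT] by (auto intro!: derivative_eq_intros simp: algebra_simps power2_eq_square)
    moreover have "exp (a * s / 2) * sin (\<omega> * (s - t2)) * (a\<^sup>2 / 4 * z s + \<omega>\<^sup>2 * z s - \<gamma> s) \<le> 0"
    proof (rule mult_nonneg_nonpos)
      have "\<omega> * (s - t2) \<le> pi" using s \<omega> by (simp add: t3_def field_simps)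
      then show "0 \<le> exp (a * s / 2) * sin (\<omega> * (s - t2))"
        using s \<omega> by (intro mult_nonneg_nonneg sin_ge_zero) auto
      have "z s \<le> \<eta>" using dec[of t2 s] t2 s by linarith
      then show "a\<^sup>2 / 4 * z s + \<omega>\<^sup>2 * z s - \<gamma> s \<le> 0"
        using \<eta>(2)[OF sT] unfolding \<omega>(2) by (simp add: algebra_simps)
    qed
    ultimately show "\<exists>y. (\<Phi> has_real_derivative y) (at s) \<and> y \<le> 0" by blast
  qed (use t3 in simp)
  moreover have "\<Phi> t2 = - (exp (a * t2 / 2) * (\<omega> * z t2))" by (simp add: \<Phi>_def)
  moreover have "\<Phi> t3 = exp (a * t3 / 2) * (\<omega> * z t3)" using \<omega> by (simp add: \<Phi>_def t3_def)
  moreover have "exp (a * t3 / 2) * (\<omega> * z t3) \<ge> 0" using z[of t3] t3 t2 t1 \<omega> by auto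
  moreover have "exp (a * t2 / 2) * (\<omega> * z t2) \<ge> 0" using z[of t2] t2 t1 \<omega> by auto
  ultimately have "exp (a * t2 / 2) * (\<omega> * z t2) = 0" by linarith
  then have "z t2 = 0" using \<omega> by simp
  then show ?thesis using t2 t1 by (intro exI[of _ t2]) auto
qed

text \<open>If v stayed on one side of A, the damped oscillator lemma applied to \<sigma> * (v - A)
  would make it touch A. A one-sided touch has zero slope, and uniqueness then forces v to be A
  throughout, against \<open>ne\<close>. The sign \<sigma> treats both sides together.\<close>

lemma equilibrium_oscillation:
  fixes v v1 :: "real \<Rightarrow> real"
  assumes a: "a > 0" and b: "b > 0" and p: "p > 1" and ab: "a\<^sup>2 / 4 < (p - 1) * b"
    and A: "A = b powr (1 / (p - 1))" and \<sigma>: "\<sigma> = 1 \<or> \<sigma> = -1"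
    and d: "\<And>t. (v has_real_derivative v1 t) (at t)"
           "\<And>t. (v1 has_real_derivative - a * v1 t + b * v t - v t powr p) (at t)"
    and v: "\<And>t. v t > 0" and c: "c > 0" "\<And>t. t \<ge> T \<Longrightarrow> v t \<ge> c"
    and ne: "v s \<noteq> A"
  shows "\<exists>t>T. \<sigma> * (v t - A) < 0"
proof (rule ccontr)
  assume "\<not> ?thesis"
  then have z: "\<sigma> * (v t - A) \<ge> 0" if "t > T" for t using that by force
  have Apos: "A > 0" using b by (simp add: A)
  have Ab: "A powr (p - 1) = b" using p b by (simp add: A powr_powr)
  have pw: "x powr p = x * x powr (p - 1)" if "x > 0" for x :: real
    using that by (simp add: powr_mult_base)
  define h where "h x = x powr p - b * x" for x
  have hA: "h A = 0" using pw[OF Apos] Ab by (simp add: h_def)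
  have heq: "h x = x * (x powr (p - 1) - A powr (p - 1))" if "x > 0" for x
    unfolding h_def pw[OF that] Ab by (simp add: algebra_simps)
  have "\<exists>t>T+1. \<sigma> * (v t - A) = 0"
  \<comment> \<open>The frequency is the midpoint between the damping threshold a^2 / 4 and h'(A) =
    (p - 1) * b. Starting at \<open>T + 1\<close> leaves room to the left of the touching time,
    which must be an interior minimum.\<close>
  proof (rule underdamped_zero[where \<gamma> = "\<lambda>t. \<sigma> * h (v t)" and a = a and ?z1.0 = "\<lambda>t. \<sigma> * v1 t" and \<kappa> = "(a\<^sup>2 / 4 + (p - 1) * b) / 2"])
    show "((\<lambda>t. \<sigma> * (v t - A)) has_real_derivative \<sigma> * v1 t) (at t)" for t
      using d(1)[of t] by (auto intro!: derivative_eq_intros)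
    show "((\<lambda>t. \<sigma> * v1 t) has_real_derivative - a * (\<sigma> * v1 t) - \<sigma> * h (v t)) (at t)" for t
      using d(2)[of t] unfolding h_def by (auto intro!: derivative_eq_intros simp: algebra_simps)
    show "0 \<le> \<sigma> * (v t - A)" if "t \<ge> T + 1" for t using z[of t] that by simp
    show "\<sigma> * h (v t) \<ge> 0" if "t \<ge> T + 1" for t
    proof -
      have "\<sigma> * (v t powr (p - 1) - A powr (p - 1)) \<ge> 0"
        using z[of t] that \<sigma> v[of t] Apos p powr_mono2[of "p - 1" A "v t"] powr_mono2[of "p - 1" "v t" A] by auto
      then have "v t * (\<sigma> * (v t powr (p - 1) - A powr (p - 1))) \<ge> 0" using v[of t] by simp
      then show ?thesis unfolding heq[OF v] by (simp add: mult_ac)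
    qed
    fix \<eta> :: real assume \<eta>: "\<eta> > 0"
    show "\<exists>g>0. \<forall>t\<ge>T + 1. \<eta> \<le> \<sigma> * (v t - A) \<longrightarrow> g \<le> \<sigma> * h (v t)"
      using \<sigma>
    proof
      assume s: "\<sigma> = 1"
      have "A powr (p - 1) < (A + \<eta>) powr (p - 1)" using Apos \<eta> p by (intro powr_less_mono2) auto
      moreover have "A * ((A + \<eta>) powr (p - 1) - A powr (p - 1)) \<le> h x" if "x - A \<ge> \<eta>" for x
      proof -
        have "(A + \<eta>) powr (p - 1) \<le> x powr (p - 1)" using that Apos \<eta> p by (intro powr_mono2) auto
        then show ?thesis using that Apos \<eta> calculation by (subst heq) (auto intro!: mult_mono)
      qed
      ultimately show ?thesis using Apos s
        by (intro exI[of _ "A * ((A + \<eta>) powr (p - 1) - A powr (p - 1))"]) auto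
    next
      assume s: "\<sigma> = -1"
      show ?thesis
      proof (cases "\<eta> < A")
        case True
        have "(A - \<eta>) powr (p - 1) < A powr (p - 1)" using True \<eta> p by (intro powr_less_mono2) auto
        \<comment> \<open>Below A the restoring force also vanishes at the other equilibrium 0; the
          lower bound c keeps v away from it and makes the force bounded below.\<close>
        moreover have "c * (A powr (p - 1) - (A - \<eta>) powr (p - 1)) \<le> - h x" if "A - x \<ge> \<eta>" "x \<ge> c" for x
        proof -
          have "x powr (p - 1) \<le> (A - \<eta>) powr (p - 1)" using that c \<eta> p by (intro powr_mono2) auto
          then have "c * (A powr (p - 1) - (A - \<eta>) powr (p - 1)) \<le> x * (A powr (p - 1) - x powr (p - 1))"
            using that c calculation by (intro mult_mono) auto
          then show ?thesis using that c by (subst heq) (auto simp: algebra_simps)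
        qed
        ultimately show ?thesis using c s
          by (intro exI[of _ "c * (A powr (p - 1) - (A - \<eta>) powr (p - 1))"]) auto
      next
        case False
        then show ?thesis using v s by (intro exI[of _ 1]) (auto, smt (verit) v)
      qed
    qed
  next
    let ?\<kappa> = "(a\<^sup>2 / 4 + (p - 1) * b) / 2"
    have "(h has_real_derivative p * A powr (p - 1) - b) (at A)"
      unfolding h_def using Apos by (auto intro!: derivative_eq_intros)
    then have "((\<lambda>x. (h x - h A) / (x - A)) \<longlongrightarrow> (p - 1) * b) (at A)"
      by (simp add: has_field_derivative_iff Ab algebra_simps)
    then have "eventually (\<lambda>x. (h x - h A) / (x - A) > ?\<kappa>) (at A)"
      by (rule order_tendstoD) (use ab in \<open>simp add: field_simps\<close>)
    then obtain e where e: "e > 0" "\<And>x. x \<noteq> A \<Longrightarrow> \<bar>x - A\<bar> < e \<Longrightarrow> h x / (x - A) > ?\<kappa>"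
      unfolding eventually_at by (auto simp: hA dist_real_def)
    have "?\<kappa> * (\<sigma> * (v t - A)) \<le> \<sigma> * h (v t)" if t: "T + 1 \<le> t" "\<sigma> * (v t - A) \<le> e / 2" for t
    proof (cases "v t = A")
      case False
      then have pos: "\<sigma> * (v t - A) > 0" using z[of t] t \<sigma> by (auto simp: less_le)
      have "\<bar>v t - A\<bar> < e" using t z[of t] \<sigma> e(1) by auto
      then have "h (v t) / (v t - A) > ?\<kappa>" using e(2) False by blast
      then have "?\<kappa> * (\<sigma> * (v t - A)) \<le> h (v t) / (v t - A) * (\<sigma> * (v t - A))"
        using pos by (intro mult_right_mono) auto
      then show ?thesis using False by (simp add: mult.commute)
    qed (simp add: hA)
    then show "\<exists>\<eta>>0. \<forall>t\<ge>T + 1. \<sigma> * (v t - A) \<le> \<eta> \<longrightarrow> ?\<kappa> * (\<sigma> * (v t - A)) \<le> \<sigma> * h (v t)"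
      using e(1) by (intro exI[of _ "e / 2"]) auto
  qed (use a ab in auto)
  then obtain t0 where t0: "t0 > T + 1" "v t0 = A" using \<sigma> by auto
  have "\<sigma> * v1 t0 = 0"
  proof (rule DERIV_local_min)
    show "((\<lambda>t. \<sigma> * (v t - A)) has_real_derivative \<sigma> * v1 t0) (at t0)"
      using d(1)[of t0] by (auto intro!: derivative_eq_intros)
    show "0 < t0 - T" using t0 by simp
    show "\<forall>y. \<bar>t0 - y\<bar> < t0 - T \<longrightarrow> \<sigma> * (v t0 - A) \<le> \<sigma> * (v y - A)"
      using z t0 by auto
  qed
  then have v10: "v1 t0 = 0" using \<sigma> by auto
  define l where "l = min s t0"
  define r where "r = max s t0"
  have "continuous_on {l..r} v" using d(1) by (meson DERIV_isCont continuous_at_imp_continuous_on)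
  then have "compact (v ` {l..r})" by (intro compact_continuous_image) auto
  then obtain B where B: "\<And>t. t \<in> {l..r} \<Longrightarrow> \<bar>v t\<bar> \<le> B"
    by (metis (no_types, lifting) bounded_iff compact_imp_bounded imageI real_norm_def)
  define M where "M = max A B"
  define K where "K = a + b + p * M powr (p - 1)"
  have "v s - A = 0"
  proof (rule second_order_unique[of K l r "\<lambda>t. v t - A" v1 "\<lambda>t. - a * v1 t + b * v t - v t powr p" t0 s])
    show "K \<ge> 0" using a b p by (simp add: K_def)
    show "((\<lambda>t. v t - A) has_real_derivative v1 t) (at t)" for t
      using d(1)[of t] by (auto intro!: derivative_eq_intros)
    show "(v1 has_real_derivative - a * v1 t + b * v t - v t powr p) (at t)" for t by (rule d)
    fix t assume t: "t \<in> {l..r}"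
    have "\<bar>v t powr p - A powr p\<bar> \<le> p * M powr (p - 1) * \<bar>v t - A\<bar>"
      using powr_lipschitz[of p "v t" A M] powr_lipschitz[of p A "v t" M] B[OF t] v[of t] Apos p
      by (cases "v t \<le> A") (auto simp: M_def abs_minus_commute)
    moreover have "- a * v1 t + b * v t - v t powr p = - (a * v1 t) + b * (v t - A) - (v t powr p - A powr p)"
      using hA by (simp add: h_def algebra_simps)
    ultimately have "\<bar>- a * v1 t + b * v t - v t powr p\<bar> \<le> a * \<bar>v1 t\<bar> + b * \<bar>v t - A\<bar> + p * M powr (p - 1) * \<bar>v t - A\<bar>"
      using abs_mult_pos'[of a "v1 t"] abs_mult_pos'[of b "v t - A"] a b by (smt (verit))
    also have "\<dots> \<le> K * (\<bar>v t - A\<bar> + \<bar>v1 t\<bar>)"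
    proof -
      have "b * \<bar>v1 t\<bar> \<ge> 0" "a * \<bar>v t - A\<bar> \<ge> 0" "p * M powr (p - 1) * \<bar>v1 t\<bar> \<ge> 0" using a b p by auto
      then show ?thesis unfolding K_def by (simp add: algebra_simps)
    qed
    finally show "\<bar>- a * v1 t + b * v t - v t powr p\<bar> \<le> K * (\<bar>v t - A\<bar> + \<bar>v1 t\<bar>)" .
  qed (use t0 v10 in \<open>auto simp: l_def r_def\<close>)
  then show False using ne by simp
qed

text \<open>Needed to differentiate the energy before the orbit is known to be positive; the point x
  = 0 is where q > 1 enters.\<close>

lemma has_derivative_pos_part_powr:
  fixes q x :: real
  assumes q: "q > 1"
  shows "((\<lambda>x. max x 0 powr q) has_real_derivative q * max x 0 powr (q - 1)) (at x)"
proof -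
  consider "x > 0" | "x < 0" | "x = 0" by linarith
  then show ?thesis
  proof cases
    case 1
    have "((\<lambda>x. x powr q) has_real_derivative q * max x 0 powr (q - 1)) (at x)"
      using 1 by (auto intro!: derivative_eq_intros simp: max_absorb1)
    then show ?thesis
      by (rule has_field_derivative_transform_within_open[where S = "{0<..}"]) (use 1 in \<open>auto simp: max_absorb1\<close>)
  next
    case 2
    have "((\<lambda>x. 0) has_real_derivative q * max x 0 powr (q - 1)) (at x)"
      using 2 by (auto simp: max_absorb2)
    then show ?thesis
      by (rule has_field_derivative_transform_within_open[where S = "{..<0}"]) (use 2 in \<open>auto simp: max_absorb2\<close>)
  next
    case 3
    have "((\<lambda>y. max y 0 powr q / y) \<longlongrightarrow> 0) (at (0::real))"
    proof (rule Lim_null_comparison)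
      show "eventually (\<lambda>y. norm (max y 0 powr q / y) \<le> \<bar>y\<bar> powr (q - 1)) (at (0::real))"
      proof (rule always_eventually, rule allI)
        fix y :: real
        show "norm (max y 0 powr q / y) \<le> \<bar>y\<bar> powr (q - 1)"
          by (cases "y > 0") (auto simp: max_absorb1 max_absorb2 powr_diff intro: divide_nonneg_nonpos)
      qed
      have "((\<lambda>y::real. \<bar>y\<bar> powr (q - 1)) \<longlongrightarrow> \<bar>0\<bar> powr (q - 1)) (at 0)"
        by (rule tendsto_powr'[OF tendsto_rabs[OF tendsto_ident_at] tendsto_const]) (use q in auto)
      then show "((\<lambda>y::real. \<bar>y\<bar> powr (q - 1)) \<longlongrightarrow> 0) (at 0)" by simp
    qed
    then show ?thesis using 3 by (simp add: has_field_derivative_iff)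
  qed
qed

text \<open>The exponent \<theta> makes the equation autonomous because \<theta> * p = \<theta> + 2.
  It reads v'' + a * v' - b * v + v^p = 0 with a = m - 2 * \<theta> and b = \<theta> * (m -
  \<theta>). Supercriticality is a > 0, that is, genuine damping, and \<open>JL\<close> is a^2 / 4 <
  (p - 1) * b because \<theta> * (p - 1) = 2.\<close>

lemma regular_solution_oscillates:
  fixes m :: nat and p \<theta> A \<sigma> X :: real
  assumes m: "m > 0" and p: "p > 1" and th: "\<theta> = 2 / (p - 1)" "2 * \<theta> < real m"
    and JL: "(real m - 2 * \<theta>)\<^sup>2 < 8 * (real m - \<theta>)"
    and A: "A = (\<theta> * (real m - \<theta>)) powr (1 / (p - 1))" and \<sigma>: "\<sigma> = 1 \<or> \<sigma> = -1"
  shows "\<exists>x>X. x > 0 \<and> \<sigma> * (usol m 0 p 0 1 x * x powr \<theta> - A) < 0"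
proof -
  interpret emden m 0 p by unfold_locales (use m p in auto)
  define U where "U = usol m 0 p 0 1"
  define D where "D = dsol m 0 p 0 1"
  define a where "a = real m - 2 * \<theta>"
  define b where "b = \<theta> * (real m - \<theta>)"
  have th0: "\<theta> > 0" using p th by simp
  have a: "a > 0" using th by (simp add: a_def)
  have b: "b > 0" using th th0 by (simp add: b_def)
  have thp: "\<theta> * (p - 1) = 2" using p unfolding th(1) by (subst nonzero_eq_divide_eq[symmetric]) auto
  then have thp': "\<theta> * p = \<theta> + 2" by (simp add: algebra_simps)
  have ab: "a\<^sup>2 / 4 < (p - 1) * b"
  proof -
    have "(p - 1) * b = (\<theta> * (p - 1)) * (real m - \<theta>)" by (simp add: b_def)
    also have "\<dots> = 2 * (real m - \<theta>)" using thp by simp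
    finally show ?thesis using JL by (simp add: a_def)
  qed
  have dU: "(U has_real_derivative D x) (at x)" if "x > 0" for x
    unfolding U_def D_def by (rule usol_has_derivative) (use that in auto)
  have dD: "(D has_real_derivative - (real m + 1) / x * D x - max (U x) 0 powr p) (at x)" if "x > 0" for x
    using dsol_has_derivative[of 0 1 x] that unfolding U_def D_def by (simp add: nonlin_def)
  have U1: "U x \<le> 1" if "x \<ge> 0" for x using usol_le[of 0 1 x] that by (simp add: U_def)
  define v where "v t = exp (\<theta> * t) * U (exp t)" for t
  define v1 where "v1 t = \<theta> * v t + exp ((\<theta> + 1) * t) * D (exp t)" for t
  have dv: "(v has_real_derivative v1 t) (at t)" for t
    unfolding v_def v1_def
    by (rule derivative_eq_intros DERIV_chain2[OF dU] refl | simp)+ (simp add: algebra_simps exp_add)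
  have vp: "max (v t) 0 powr p = exp ((\<theta> + 2) * t) * max (U (exp t)) 0 powr p" for t
  proof -
    have "max (v t) 0 = exp (\<theta> * t) * max (U (exp t)) 0" by (simp add: v_def max_mult_distrib_left)
    then have "max (v t) 0 powr p = exp (\<theta> * t) powr p * max (U (exp t)) 0 powr p" by (simp add: powr_mult)
    also have "exp (\<theta> * t) powr p = exp (\<theta> * p * t)" by (simp add: powr_def mult_ac)
    finally show ?thesis unfolding thp' .
  qed
  have dv1: "(v1 has_real_derivative - a * v1 t + b * v t - max (v t) 0 powr p) (at t)" for t
  proof -
    let ?x = "exp t"
    have "((\<lambda>t. exp ((\<theta> + 1) * t) * D (exp t)) has_real_derivative
       exp ((\<theta> + 1) * t) * (\<theta> + 1) * D ?x + exp ((\<theta> + 1) * t) * ((- (real m + 1) / ?x * D ?x - max (U ?x) 0 powr p) * ?x)) (at t)"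
      by (rule derivative_eq_intros DERIV_chain2[OF dD] refl | simp)+
    then have "(v1 has_real_derivative \<theta> * v1 t +
       (exp ((\<theta> + 1) * t) * (\<theta> + 1) * D ?x + exp ((\<theta> + 1) * t) * ((- (real m + 1) / ?x * D ?x - max (U ?x) 0 powr p) * ?x))) (at t)"
      unfolding v1_def[abs_def] using dv[of t] by (auto intro!: DERIV_add DERIV_cmult simp: v1_def[abs_def])
    moreover have "exp ((\<theta> + 1) * t) * ((- (real m + 1) / ?x * D ?x - max (U ?x) 0 powr p) * ?x) =
        - (real m + 1) * (exp ((\<theta> + 1) * t) * D ?x) - max (v t) 0 powr p"
    proof -
      have 1: "(- (real m + 1) / ?x * D ?x - max (U ?x) 0 powr p) * ?x = - (real m + 1) * D ?x - max (U ?x) 0 powr p * ?x"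
        by (simp add: field_simps)
      have 2: "exp ((\<theta> + 1) * t) * ?x = exp ((\<theta> + 2) * t)" by (simp add: algebra_simps flip: exp_add)
      have "exp ((\<theta> + 1) * t) * (- (real m + 1) * D ?x - max (U ?x) 0 powr p * ?x) =
          - (real m + 1) * (exp ((\<theta> + 1) * t) * D ?x) - exp ((\<theta> + 1) * t) * ?x * max (U ?x) 0 powr p"
        by (simp add: algebra_simps)
      then show ?thesis unfolding vp 1 2 .
    qed
    moreover have "\<theta> * v1 t + (exp ((\<theta> + 1) * t) * (\<theta> + 1) * D ?x + (- (real m + 1) * (exp ((\<theta> + 1) * t) * D ?x) - max (v t) 0 powr p))
       = - a * v1 t + b * v t - max (v t) 0 powr p"
      unfolding v1_def a_def b_def by (simp add: algebra_simps)
    ultimately show ?thesis by (simp only:)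
  qed
  define E where "E t = (v1 t)\<^sup>2 / 2 - b * (v t)\<^sup>2 / 2 + max (v t) 0 powr (p + 1) / (p + 1)" for t
  have dE: "(E has_real_derivative - a * (v1 t)\<^sup>2) (at t)" for t
  proof -
    have "((\<lambda>t. max (v t) 0 powr (p + 1)) has_real_derivative ((p + 1) * max (v t) 0 powr (p + 1 - 1)) * v1 t) (at t)"
      by (rule DERIV_chain2[OF has_derivative_pos_part_powr dv]) (use p in simp)
    from DERIV_cdivide[OF this, of "p + 1"]
    have "((\<lambda>t. max (v t) 0 powr (p + 1) / (p + 1)) has_real_derivative max (v t) 0 powr p * v1 t) (at t)"
      using p by simp
    moreover have "((\<lambda>t. (v1 t)\<^sup>2 / 2 - b * (v t)\<^sup>2 / 2) has_real_derivative
        v1 t * (- a * v1 t + b * v t - max (v t) 0 powr p) - b * v t * v1 t) (at t)"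
    proof -
      define w2 where "w2 = - a * v1 t + b * v t - max (v t) 0 powr p"
      have "(v1 has_real_derivative w2) (at t)" using dv1[of t] by (simp add: w2_def)
      then have "((\<lambda>t. (v1 t)\<^sup>2 / 2 - b * (v t)\<^sup>2 / 2) has_real_derivative v1 t * w2 - b * v t * v1 t) (at t)"
        using dv[of t] by (auto intro!: derivative_eq_intros)
      then show ?thesis unfolding w2_def .
    qed
    ultimately have "(E has_real_derivative v1 t * (- a * v1 t + b * v t - max (v t) 0 powr p) - b * v t * v1 t
        + max (v t) 0 powr p * v1 t) (at t)"
      unfolding E_def by (rule DERIV_add[rotated])
    moreover have "v1 t * (- a * v1 t + b * v t - max (v t) 0 powr p) - b * v t * v1 t + max (v t) 0 powr p * v1 t = - a * (v1 t)\<^sup>2"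
      by (simp add: algebra_simps power2_eq_square)
    ultimately show ?thesis by (simp only:)
  qed
  have Emono: "E t \<le> E s" if "s \<le> t" for s t
    by (rule DERIV_nonpos_imp_nonincreasing[OF that]) (use dE a in \<open>auto intro!: exI mult_nonneg_nonneg\<close>)
  \<comment> \<open>The energy itself tends to 0 as t tends to -infinity, so its sign there is
    invisible. Once the factor exp (2 * \<theta> * t) is taken out, the remainder e has a nonzero
    limit at x = 0.\<close>
  define e where "e x = (\<theta> * U x + x * D x)\<^sup>2 / 2 - b * (U x)\<^sup>2 / 2 + x\<^sup>2 * max (U x) 0 powr (p + 1) / (p + 1)" for x
  have Ee: "E t = exp (2 * \<theta> * t) * e (exp t)" for t
  proof -
    have "max (v t) 0 = exp (\<theta> * t) * max (U (exp t)) 0" by (simp add: v_def max_mult_distrib_left)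
    then have "max (v t) 0 powr (p + 1) = exp (\<theta> * t) powr (p + 1) * max (U (exp t)) 0 powr (p + 1)"
      by (simp add: powr_mult)
    also have "exp (\<theta> * t) powr (p + 1) = exp ((\<theta> * p + \<theta>) * t)"
      by (simp add: powr_def algebra_simps)
    also have "\<dots> = exp (2 * \<theta> * t) * (exp t)\<^sup>2"
      unfolding thp' power2_eq_square exp_add[symmetric] by (simp add: algebra_simps)
    finally have 1: "max (v t) 0 powr (p + 1) = exp (2 * \<theta> * t) * ((exp t)\<^sup>2 * max (U (exp t)) 0 powr (p + 1))" by simp
    have 2: "v1 t = exp (\<theta> * t) * (\<theta> * U (exp t) + exp t * D (exp t))"
      unfolding v1_def v_def by (simp add: algebra_simps exp_add)
    have 3: "(exp (\<theta> * t))\<^sup>2 = exp (2 * \<theta> * t)" by (simp add: power2_eq_square flip: exp_add)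
    have "E t = exp (2 * \<theta> * t) * (\<theta> * U (exp t) + exp t * D (exp t))\<^sup>2 / 2 - b * (exp (2 * \<theta> * t) * (U (exp t))\<^sup>2) / 2
        + exp (2 * \<theta> * t) * ((exp t)\<^sup>2 * max (U (exp t)) 0 powr (p + 1)) / (p + 1)"
      unfolding E_def 1 2 power_mult_distrib 3 by (simp add: v_def power_mult_distrib 3)
    then show ?thesis unfolding e_def by (simp add: distrib_left right_diff_distrib mult_ac)
  qed
  have Ulim: "(U \<longlongrightarrow> 1) (at_right 0)"
  proof -
    have "continuous_on {0..} U" unfolding U_def by (rule continuous_on_usol) auto
    then have "(U \<longlongrightarrow> U 0) (at 0 within {0..})" by (auto simp: continuous_on_def)
    moreover have "U 0 = 1" using usol_eq[of 0 1 0] m by (simp add: U_def)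
    ultimately show ?thesis by (auto intro: tendsto_within_subset)
  qed
  have Dlim: "((\<lambda>x. x * D x) \<longlongrightarrow> 0) (at_right 0)"
  proof (rule Lim_null_comparison)
    show "eventually (\<lambda>x. norm (x * D x) \<le> x\<^sup>2) (at_right 0)"
      unfolding eventually_at_filter
    proof (rule always_eventually, intro allI impI)
      fix x :: real assume "x \<in> {0<..}"
      then have x: "x > 0" by simp
      have "norm (integral {0..x} (\<lambda>t. t ^ (m + 1) * nonlin 0 p (U t))) \<le> integral {0..x} (\<lambda>t. x ^ (m + 1))"
      proof (rule integral_norm_bound_integral)
        show "(\<lambda>t. t ^ (m + 1) * nonlin 0 p (U t)) integrable_on {0..x}"
          unfolding U_def by (intro continuous_integrable_atMost continuous_intros continuous_on_nonlin_usol) auto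
        fix t assume t: "t \<in> {0..x}"
        have "nonlin 0 p (U t) \<le> 1"
          using U1[of t] t p by (auto simp: nonlin_def intro: powr_le1)
        then have "t ^ (m + 1) * nonlin 0 p (U t) \<le> x ^ (m + 1) * 1"
          using t by (intro mult_mono power_mono) (auto simp: nonlin_nonneg)
        then show "norm (t ^ (m + 1) * nonlin 0 p (U t)) \<le> x ^ (m + 1)"
          using t by (simp add: abs_mult nonlin_nonneg)
      qed (simp add: integrable_const_ivl)
      then have "\<bar>mass m 0 p 0 1 x\<bar> \<le> x * x ^ (m + 1)" using x by (simp add: mass_def U_def)
      then have "\<bar>D x\<bar> \<le> x" using x m by (simp add: D_def dsol_def abs_mult divide_le_eq zero_power)
      then have "x * \<bar>D x\<bar> \<le> x * x" using x by (intro mult_left_mono) auto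
      then show "norm (x * D x) \<le> x\<^sup>2" using x by (simp add: abs_mult power2_eq_square)
    qed
    show "((\<lambda>x::real. x\<^sup>2) \<longlongrightarrow> 0) (at_right 0)" by (auto intro!: tendsto_eq_intros)
  qed
  have "((\<lambda>x. max (U x) 0 powr (p + 1)) \<longlongrightarrow> max 1 0 powr (p + 1)) (at_right 0)"
    by (intro tendsto_intros Ulim) auto
  then have "(e \<longlongrightarrow> (\<theta> * 1 + 0)\<^sup>2 / 2 - b * 1\<^sup>2 / 2 + 0\<^sup>2 * max 1 0 powr (p + 1) / (p + 1)) (at_right 0)"
    unfolding e_def[abs_def] by (intro tendsto_intros Ulim Dlim) (use p in auto)
  \<comment> \<open>This is twice the limit of e at 0. It is negative exactly by the damping a > 0,
    so the energy is negative at early times and, being nonincreasing, always.\<close>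
  moreover have "\<theta>\<^sup>2 - b = - \<theta> * a" by (simp add: a_def b_def power2_eq_square algebra_simps)
  then have "\<theta>\<^sup>2 - b < 0" using th0 a by simp
  ultimately have "eventually (\<lambda>x. e x < 0) (at_right 0)"
    by (intro order_tendstoD) auto
  then obtain x0 where x0: "x0 > 0" "\<And>x. 0 < x \<Longrightarrow> x < x0 \<Longrightarrow> e x < 0"
    unfolding eventually_at_right_field by auto
  have Eneg: "E t < 0" for t
  proof -
    define s where "s = min t (ln (x0 / 2))"
    have "exp s \<le> x0 / 2" using x0 unfolding s_def by (metis exp_le_cancel_iff exp_ln half_gt_zero min.cobounded2)
    then have "e (exp s) < 0" using x0 by (intro x0(2)) auto
    then have "E s < 0" unfolding Ee by (simp add: mult_pos_neg)
    moreover have "E t \<le> E s" by (rule Emono) (simp add: s_def)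
    ultimately show ?thesis by simp
  qed
  have vnz: "v t \<noteq> 0" for t
  proof
    assume "v t = 0"
    then have "E t \<ge> 0" using p by (simp add: E_def)
    then show False using Eneg[of t] by simp
  qed
  have cv: "continuous_on S v" for S using dv by (meson DERIV_isCont continuous_at_imp_continuous_on)
  have vpos: "v t > 0" for t
  proof (rule ccontr)
    assume "\<not> v t > 0"
    then have neg: "v t < 0" using vnz[of t] by simp
    have "eventually (\<lambda>x. U x > 0) (at_right 0)" by (rule order_tendstoD[OF Ulim]) simp
    then obtain y where y: "y > 0" "\<And>x. 0 < x \<Longrightarrow> x < y \<Longrightarrow> U x > 0"
      unfolding eventually_at_right_field by auto
    have "U (y / 2) > 0" using y by simp
    then have pos: "v (ln (y / 2)) > 0" using y by (simp add: v_def)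
    have "0 \<in> v ` UNIV"
      by (rule connected_contains_Icc[THEN subsetD, of _ "v t" "v (ln (y / 2))"])
         (use neg pos in \<open>auto intro!: connected_continuous_image cv\<close>)
    then show False using vnz by auto
  qed
  \<comment> \<open>From -b * v^2 / 2 \<le> E(t) and the monotonicity of E: a negative energy keeps
    v away from 0. The \<open>max X 1\<close> makes the logarithm meaningful for every X.\<close>
  define c where "c = sqrt (- 2 * E (ln (max X 1)) / b)"
  have c: "c > 0" using Eneg[of "ln (max X 1)"] b by (simp add: c_def divide_neg_pos)
  have vc: "v t \<ge> c" if "t \<ge> ln (max X 1)" for t
  proof -
    have "- b * (v t)\<^sup>2 / 2 \<le> E t" using p by (simp add: E_def)
    also have "\<dots> \<le> E (ln (max X 1))" by (rule Emono[OF that])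
    finally have "- 2 * E (ln (max X 1)) / b \<le> (v t)\<^sup>2" using b by (simp add: field_simps)
    then show ?thesis unfolding c_def using vpos[of t] by (simp add: real_le_lsqrt less_imp_le)
  qed
  have Apos: "A > 0" using th th0 by (simp add: A)
  \<comment> \<open>At this time exp (\<theta> * t) = A / 2, and U \<le> 1; it certifies that the
    orbit is not the equilibrium.\<close>
  have "v (ln (A / 2) / \<theta>) \<le> A / 2"
  proof -
    have "v (ln (A / 2) / \<theta>) \<le> exp (\<theta> * (ln (A / 2) / \<theta>)) * 1"
      unfolding v_def by (intro mult_left_mono U1) auto
    also have "\<dots> = A / 2" using th0 Apos by simp
    finally show ?thesis .
  qed
  then have "v (ln (A / 2) / \<theta>) \<noteq> A" using Apos by auto
  moreover have "(v1 has_real_derivative - a * v1 t + b * v t - v t powr p) (at t)" for t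
    using dv1[of t] vpos[of t] by (simp add: max_absorb1)
  ultimately have "\<exists>t>ln (max X 1). \<sigma> * (v t - A) < 0"
    using A b_def by (intro equilibrium_oscillation[OF a b p ab _ \<sigma> dv _ vpos c vc]) auto
  then obtain t where t: "t > ln (max X 1)" "\<sigma> * (v t - A) < 0" by blast
  have "exp t > max X 1" using t by (metis exp_less_cancel_iff exp_ln less_max_iff_disj zero_less_one)
  moreover have "v t = U (exp t) * exp t powr \<theta>" by (simp add: v_def powr_def)
  ultimately show ?thesis using t unfolding U_def by (intro exI[of _ "exp t"]) auto
qed

section \<open>Rotation of the difference to the singular solution\<close>

lemma no_crossing:
  fixes h :: "real \<Rightarrow> real"
  assumes "continuous_on {x..y} h" "\<And>t. t \<in> {x..y} \<Longrightarrow> h t \<noteq> L" "x \<le> y"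
  shows "h x < L \<longleftrightarrow> h y < L"
proof -
  have "connected (h ` {x..y})" using assms(1) by (intro connected_continuous_image) auto
  then have "L \<in> h ` {x..y}" if "h s \<le> L" "L \<le> h t" "s \<in> {x..y}" "t \<in> {x..y}" for s t
    using connected_contains_Icc[of "h ` {x..y}" "h s" "h t"] that by auto
  from this[of x y] this[of y x] show ?thesis
    using assms(2,3) by (metis (no_types, lifting) atLeastAtMost_iff image_iff less_imp_le linorder_not_less order_refl)
qed

definition level :: "int \<Rightarrow> real" where
  "level j = pi / 2 + real_of_int j * pi"

lemma cos_level [simp]: "cos (level j) = 0"
  by (simp add: level_def cos_add sin_npi_int mult.commute)

lemma sin_level_mult_cos: "sin (level j) * cos y = sin (level j - y)"
  by (simp add: sin_diff)

text \<open>The planar curve \<open>(w, w')\<close> crosses the vertical axis only clockwise, so its angle can never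
  get back above a level \<open>\<pi> / 2 + j * \<pi>\<close>.\<close>

context
  fixes w w1 \<theta> R :: "real \<Rightarrow> real" and c d :: real
  assumes dw: "\<And>t. t \<in> {c..d} \<Longrightarrow> (w has_real_derivative w1 t) (at t)"
    and c\<theta>: "continuous_on {c..d} \<theta>"
    and R: "\<And>t. t \<in> {c..d} \<Longrightarrow> R t > 0"
    and w: "\<And>t. t \<in> {c..d} \<Longrightarrow> w t = R t * cos (\<theta> t)"
    and w1: "\<And>t. t \<in> {c..d} \<Longrightarrow> w1 t = R t * sin (\<theta> t)"
begin

lemma sin_level_mult_w: "t \<in> {c..d} \<Longrightarrow> sin (level j) * w t = R t * sin (level j - \<theta> t)"
  unfolding sin_level_mult_cos[symmetric] by (simp add: w)

text \<open>At such a time w = 0 and \<open>sin (level j) * w\<close> has derivative R * sin^2 = R >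
  0, so it increases through 0. It equals R * sin (level j - \<theta>), and within distance \<pi> of
  the level its sign tells on which side \<theta> lies.\<close>

lemma crossing_is_clockwise:
  assumes r: "r \<in> {c..d}" "\<theta> r = level j"
  shows "\<exists>e>0. (\<forall>t\<in>{c..d}. r < t \<and> t < r + e \<longrightarrow> \<theta> t < level j) \<and> (\<forall>t\<in>{c..d}. r - e < t \<and> t < r \<longrightarrow> \<theta> t > level j)"
proof -
  define h where "h t = sin (level j) * w t" for t
  have dh: "(h has_real_derivative sin (level j) * w1 r) (at r)"
    unfolding h_def by (intro DERIV_cmult dw r)
  have "(sin (level j))\<^sup>2 = 1" using sin_cos_squared_add[of "level j"] by simp
  then have pos: "sin (level j) * w1 r > 0" using r R[of r] by (simp add: w1 power2_eq_square mult.left_commute)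
  have h0: "h r = 0" using r by (simp add: h_def w)
  obtain e1 where e1: "e1 > 0" "\<And>x. 0 < x \<Longrightarrow> x < e1 \<Longrightarrow> h (r + x) > 0"
    using DERIV_pos_inc_right[OF dh pos] h0 by auto
  obtain e2 where e2: "e2 > 0" "\<And>x. 0 < x \<Longrightarrow> x < e2 \<Longrightarrow> h (r - x) < 0"
    using DERIV_pos_inc_left[OF dh pos] h0 by auto
  obtain e3 where e3: "e3 > 0" "\<And>t. t \<in> {c..d} \<Longrightarrow> \<bar>t - r\<bar> < e3 \<Longrightarrow> \<bar>\<theta> t - level j\<bar> < pi"
    using c\<theta> r pi_gt_zero unfolding continuous_on_iff dist_real_def by metis
  define e where "e = min (min e1 e2) e3"
  have e: "e > 0" "e \<le> e1" "e \<le> e2" "e \<le> e3" using e1(1) e2(1) e3(1) by (auto simp: e_def)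
  have hs: "h t = R t * sin (level j - \<theta> t)" if "t \<in> {c..d}" for t
    unfolding h_def by (rule sin_level_mult_w[OF that])
  have "\<theta> t < level j" if t: "t \<in> {c..d}" "r < t" "t < r + e" for t
  proof (rule ccontr)
    assume "\<not> ?thesis"
    moreover have "\<bar>\<theta> t - level j\<bar> < pi" using e3(2)[of t] t e by auto
    ultimately have "sin (\<theta> t - level j) \<ge> 0" by (intro sin_ge_zero) auto
    then have "sin (level j - \<theta> t) \<le> 0" using sin_minus[of "\<theta> t - level j"] by simp
    then have "h t \<le> 0" using hs[OF t(1)] R[OF t(1)] by (simp add: mult_nonneg_nonpos)
    then show False using e1(2)[of "t - r"] t e by auto
  qed
  moreover have "\<theta> t > level j" if t: "t \<in> {c..d}" "t < r" "r - e < t" for t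
  proof (rule ccontr)
    assume "\<not> ?thesis"
    moreover have "\<bar>\<theta> t - level j\<bar> < pi" using e3(2)[of t] t e by auto
    ultimately have "sin (level j - \<theta> t) \<ge> 0" by (intro sin_ge_zero) auto
    then have "h t \<ge> 0" using hs[OF t(1)] R[OF t(1)] by simp
    then show False using e2(2)[of "r - t"] t e by auto
  qed
  ultimately show ?thesis using e(1) by (intro exI[of _ e]) auto
qed

text \<open>At a first return to the level the angle would have to come from above, by the direction
  of crossing. Having been below before, it would then have met the level even earlier.\<close>

lemma angle_barrier:
  assumes r: "c \<le> r1" "r1 < r2" "r2 \<le> d" and le: "\<theta> r1 \<le> level j"
  shows "\<theta> r2 < level j"
proof (rule ccontr)
  assume "\<not> ?thesis"
  then have ge: "\<theta> r2 \<ge> level j" by simp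
  obtain s where s: "r1 \<le> s" "s < r2" "\<theta> s < level j"
  proof (cases "\<theta> r1 < level j")
    case False
    then obtain e where e: "e > 0" "\<forall>t\<in>{c..d}. r1 < t \<and> t < r1 + e \<longrightarrow> \<theta> t < level j"
      using crossing_is_clockwise[of r1 j] r le by force
    show ?thesis
      by (rule that[of "r1 + min e (r2 - r1) / 2"]) (use e r in \<open>auto simp: min_def field_simps\<close>)
  qed (use r that in auto)
  define K where "K = {t \<in> {s..r2}. \<theta> t = level j}"
  have cs: "continuous_on {s..t} \<theta>" if "t \<le> r2" for t
    by (rule continuous_on_subset[OF c\<theta>]) (use s r that in auto)
  have hit: "\<exists>x\<in>{s..t}. \<theta> x = level j" if "s \<le> t" "t \<le> r2" "\<theta> t \<ge> level j" for t
  proof (rule ccontr)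
    assume a: "\<not> ?thesis"
    have "\<theta> s < level j \<longleftrightarrow> \<theta> t < level j"
      by (rule no_crossing[OF cs[OF that(2)] _ that(1)]) (use a in blast)
    then show False using that s by simp
  qed
  have "K = {s..r2} \<inter> \<theta> -` {level j}" by (auto simp: K_def)
  then have "closed K" using continuous_closed_preimage[OF cs[of r2], of "{level j}"] by simp
  moreover have "K \<noteq> {}" using hit[of r2] s ge by (auto simp: K_def)
  moreover have bb: "bdd_below K" by (auto simp: K_def)
  ultimately have "Inf K \<in> K" by (intro closed_contains_Inf)
  then have t0: "s \<le> Inf K" "Inf K \<le> r2" "\<theta> (Inf K) = level j" by (auto simp: K_def)
  then have "s < Inf K" using s by (cases "s = Inf K") auto
  obtain e where e: "e > 0" "\<forall>t\<in>{c..d}. Inf K - e < t \<and> t < Inf K \<longrightarrow> \<theta> t > level j"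
    using crossing_is_clockwise[of "Inf K" j] t0 s r by force
  define t where "t = max s (Inf K - e / 2)"
  have t: "s \<le> t" "t < Inf K" "Inf K - e < t" using \<open>s < Inf K\<close> e by (auto simp: t_def)
  then have "\<theta> t > level j" using e t0 s r by auto
  then obtain x where "x \<in> {s..t}" "\<theta> x = level j" using hit[of t] t t0 by auto
  then have "x \<in> K" "x < Inf K" using t t0 by (auto simp: K_def)
  then show False using cInf_lower[OF _ bb] by force
qed

text \<open>Each sign change of w costs a half turn: two angles strictly between the same
  consecutive levels give w the same sign, and the barrier forbids moving up. Opposite signs at
  sample points suffice; the zeros between them need not be located.\<close>

lemma angle_decreases:
  fixes x :: "nat \<Rightarrow> real" and n :: nat
  assumes "c \<le> x 0" "x n \<le> d" "\<And>i. i < n \<Longrightarrow> x i < x (Suc i)"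
    and opp: "\<And>i. i < n \<Longrightarrow> w (x i) * w (x (Suc i)) < 0"
    and start: "\<theta> c \<le> level j"
  shows "\<theta> d \<le> level (j - int n)"
proof -
  have up: "x i \<le> x k" if "i \<le> k" "k \<le> n" for i k
    using that
  proof (induction k)
    case (Suc k)
    then show ?case using assms(3)[of k] by (cases "i = Suc k") auto
  qed simp
  have xin: "x i \<in> {c..d}" if "i \<le> n" for i using up[of 0 i] up[of i n] that assms by auto
  have "i \<le> n \<Longrightarrow> \<theta> (x i) \<le> level (j - int i)" for i
  proof (induction i)
    case 0
    show ?case using start angle_barrier[of c "x 0" j] xin[of 0] by (cases "x 0 = c") auto
  next
    case (Suc i)
    have le: "\<theta> (x i) \<le> level (j - int i)" using Suc by simp
    have x: "x i < x (Suc i)" "x i \<in> {c..d}" "x (Suc i) \<in> {c..d}"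
      using assms(3)[of i] xin[of i] xin[of "Suc i"] Suc by auto
    have lev: "level (j - int (Suc i)) = level (j - int i) - pi" by (simp add: level_def algebra_simps)
    show ?case
    proof (rule ccontr)
      assume "\<not> ?case"
      then have gt: "\<theta> (x (Suc i)) > level (j - int i) - pi" using lev by simp
      have lt: "\<theta> (x (Suc i)) < level (j - int i)" using angle_barrier[OF _ x(1) _ le] x by auto
      have gt': "\<theta> (x i) > level (j - int i) - pi"
        using angle_barrier[OF _ x(1), of "j - int (Suc i)"] x gt lev by fastforce
      have "\<theta> (x i) \<noteq> level (j - int i)"
        using opp[of i] Suc w[OF x(2)] by auto
      then have lt': "\<theta> (x i) < level (j - int i)" using le by simp
      have "sin (level (j - int i)) * w (x i) > 0" "sin (level (j - int i)) * w (x (Suc i)) > 0"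
        using sin_level_mult_w[OF x(2)] sin_level_mult_w[OF x(3)] R[OF x(2)] R[OF x(3)] gt lt gt' lt'
        by (auto intro!: mult_pos_pos sin_gt_zero)
      then have "(sin (level (j - int i)) * w (x i)) * (sin (level (j - int i)) * w (x (Suc i))) > 0" by (rule mult_pos_pos)
      then have "(sin (level (j - int i)))\<^sup>2 * (w (x i) * w (x (Suc i))) > 0" by (simp add: power2_eq_square mult_ac)
      moreover have "(sin (level (j - int i)))\<^sup>2 * (w (x i) * w (x (Suc i))) \<le> 0"
        using opp[of i] Suc by (intro mult_nonneg_nonpos[OF zero_le_power2]) auto
      ultimately show False by linarith
    qed
  qed
  then have "\<theta> (x n) \<le> level (j - int n)" by simp
  then show ?thesis using angle_barrier[of "x n" d "j - int n"] xin[of n] by (cases "x n = d") auto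
qed

end

text \<open>The values (2 * q - i) * \<pi> have cosine (-1) ^ i, and q is taken so that the first
  lies below \<phi> 1. Each is attained by the intermediate value theorem, in order of increasing
  argument.\<close>

lemma alternating_cos:
  fixes \<phi> :: "real \<Rightarrow> real"
  assumes c: "continuous_on {0<..} \<phi>" and unb: "\<And>Y. \<exists>\<alpha>\<ge>1. \<phi> \<alpha> \<le> Y"
  shows "\<exists>s::nat \<Rightarrow> real. \<forall>i. s i > 0 \<and> s i < s (Suc i) \<and> (-1) ^ i * cos (\<phi> (s i)) > 0"
proof -
  define q where "q = \<lfloor>\<phi> 1 / (2 * pi)\<rfloor>"
  define tg where "tg i = real_of_int (2 * q - int i) * pi" for i
  have q: "tg 0 \<le> \<phi> 1"
    using mult_right_mono[OF of_int_floor_le[of "\<phi> 1 / (2 * pi)"], of "2 * pi"] by (simp add: tg_def q_def mult_ac)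
  have step: "\<exists>\<beta>\<ge>\<alpha>. \<phi> \<beta> = T" if h: "\<alpha> \<ge> 1" "T \<le> \<phi> \<alpha>" for \<alpha> T
  proof -
    have c1: "continuous_on {x..y} \<phi>" if "x \<ge> 1" for x y
      by (rule continuous_on_subset[OF c]) (use that in auto)
    have "compact (\<phi> ` {1..\<alpha>})" by (intro compact_continuous_image c1) auto
    then obtain B where B: "\<And>t. t \<in> {1..\<alpha>} \<Longrightarrow> \<bar>\<phi> t\<bar> \<le> B"
      by (metis (no_types, lifting) bounded_iff compact_imp_bounded imageI real_norm_def)
    \<comment> \<open>Unboundedness below does not say where low values occur. A value below -B - 1,
      with B a bound for |\<phi>| on [1, \<alpha>], can only be taken beyond \<alpha>.\<close>
    obtain \<beta> where \<beta>: "\<beta> \<ge> 1" "\<phi> \<beta> \<le> min T (- B - 1)" using unb by blast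
    then have "\<beta> > \<alpha>" using B[of \<beta>] by (cases "\<beta> \<le> \<alpha>") auto
    then obtain x where "\<alpha> \<le> x" "x \<le> \<beta>" "\<phi> x = T"
      using IVT2'[of \<phi> \<beta> T \<alpha>] \<beta> h c1[of \<alpha> \<beta>] by auto
    then show ?thesis by blast
  qed
  have "\<exists>s. \<forall>i. (s i \<ge> 1 \<and> \<phi> (s i) = tg i) \<and> s i \<le> s (Suc i)"
  proof (rule dependent_nat_choice)
    show "\<exists>x\<ge>1. \<phi> x = tg 0" using step[of 1 "tg 0"] q by auto
    fix x i assume "x \<ge> 1 \<and> \<phi> x = tg i"
    moreover have "tg (Suc i) \<le> tg i" by (simp add: tg_def algebra_simps)
    ultimately obtain y where "y \<ge> x" "\<phi> y = tg (Suc i)" using step[of x "tg (Suc i)"] by auto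
    then show "\<exists>y. (1 \<le> y \<and> \<phi> y = tg (Suc i)) \<and> x \<le> y" using \<open>x \<ge> 1 \<and> \<phi> x = tg i\<close> by (intro exI[of _ y]) auto
  qed
  then obtain s where s: "\<And>i. s i \<ge> 1" "\<And>i. \<phi> (s i) = tg i" "\<And>i. s i \<le> s (Suc i)" by blast
  have "s i \<noteq> s (Suc i)" for i using s(2)[of i] s(2)[of "Suc i"] by (auto simp: tg_def)
  moreover have "cos (tg i) = (-1) ^ i" for i
  proof -
    have "cos (tg i) = cos (2 * pi * real_of_int q - pi * real i)" by (simp add: tg_def algebra_simps)
    also have "\<dots> = cos (pi * real i)" unfolding cos_diff by (simp add: cos_int_2pin sin_int_2pin)
    finally show ?thesis by (simp add: cos_npi2)
  qed
  moreover have "s i > 0" for i using s(1)[of i] by simp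
  ultimately show ?thesis using s
    by (intro exI[of _ s]) (simp add: order.strict_iff_order[of "s i" "s (Suc i)" for i] flip: power_mult_distrib)
qed

text \<open>Continuity in r for each \<alpha> becomes joint continuity because the modulus in
  \<alpha> is locally uniform in r. The lift of the angle over pairs (r, \<alpha>) requires
  it.\<close>

lemma continuous_on_prod_lipschitz:
  fixes F :: "real \<Rightarrow> real \<Rightarrow> real"
  assumes c: "\<And>\<alpha>. \<alpha> > 0 \<Longrightarrow> continuous_on {0<..} (F \<alpha>)"
    and lip: "\<And>M R. M > 0 \<Longrightarrow> R > 0 \<Longrightarrow> \<exists>C. \<forall>\<alpha> \<beta> r. 0 < \<alpha> \<and> \<alpha> \<le> M \<and> 0 < \<beta> \<and> \<beta> \<le> M \<and> 0 < r \<and> r \<le> R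
      \<longrightarrow> \<bar>F \<alpha> r - F \<beta> r\<bar> \<le> C * \<bar>\<alpha> - \<beta>\<bar>"
  shows "continuous_on ({0<..} \<times> {0<..}) (\<lambda>z. F (snd z) (fst z))"
proof (rule continuous_at_imp_continuous_on, rule ballI)
  fix z0 :: "real \<times> real" assume z0: "z0 \<in> {0<..} \<times> {0<..}"
  obtain r0 \<alpha>0 where z: "z0 = (r0, \<alpha>0)" "r0 > 0" "\<alpha>0 > 0" using z0 by (cases z0) auto
  have "\<exists>C. \<forall>\<alpha> \<beta> r. 0 < \<alpha> \<and> \<alpha> \<le> \<alpha>0 + 1 \<and> 0 < \<beta> \<and> \<beta> \<le> \<alpha>0 + 1 \<and> 0 < r \<and> r \<le> r0 + 1
      \<longrightarrow> \<bar>F \<alpha> r - F \<beta> r\<bar> \<le> C * \<bar>\<alpha> - \<beta>\<bar>"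
    by (rule lip) (use z in auto)
  then obtain C where C: "\<And>\<alpha> \<beta> r. 0 < \<alpha> \<and> \<alpha> \<le> \<alpha>0 + 1 \<and> 0 < \<beta> \<and> \<beta> \<le> \<alpha>0 + 1 \<and> 0 < r \<and> r \<le> r0 + 1
      \<Longrightarrow> \<bar>F \<alpha> r - F \<beta> r\<bar> \<le> C * \<bar>\<alpha> - \<beta>\<bar>"
    by meson
  have ts: "(snd \<longlongrightarrow> \<alpha>0) (at z0)" "(fst \<longlongrightarrow> r0) (at z0)"
    using tendsto_snd[OF tendsto_ident_at, of z0] tendsto_fst[OF tendsto_ident_at, of z0] z by auto
  have "isCont (F \<alpha>0) r0" using c[OF z(3)] z(2) by (simp add: continuous_on_eq_continuous_at)
  then have F0: "((\<lambda>z. F \<alpha>0 (fst z)) \<longlongrightarrow> F \<alpha>0 r0) (at z0)" using ts(2) by (rule isCont_tendsto_compose)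
  have "((\<lambda>z. F (snd z) (fst z) - F \<alpha>0 r0) \<longlongrightarrow> 0) (at z0)"
  proof (rule Lim_null_comparison)
    have "eventually (\<lambda>z. snd z < \<alpha>0 + 1) (at z0)" "eventually (\<lambda>z. snd z > 0) (at z0)"
      "eventually (\<lambda>z. fst z < r0 + 1) (at z0)" "eventually (\<lambda>z. fst z > 0) (at z0)"
      using ts z by (auto intro: order_tendstoD)
    then show "eventually (\<lambda>z. norm (F (snd z) (fst z) - F \<alpha>0 r0) \<le> C * \<bar>snd z - \<alpha>0\<bar> + \<bar>F \<alpha>0 (fst z) - F \<alpha>0 r0\<bar>) (at z0)"
    proof eventually_elim
      case (elim y)
      have "\<bar>F (snd y) (fst y) - F \<alpha>0 (fst y)\<bar> \<le> C * \<bar>snd y - \<alpha>0\<bar>" by (rule C) (use elim z in auto)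
      then show ?case by simp
    qed
    have "((\<lambda>z. C * \<bar>snd z - \<alpha>0\<bar> + \<bar>F \<alpha>0 (fst z) - F \<alpha>0 r0\<bar>) \<longlongrightarrow> C * \<bar>\<alpha>0 - \<alpha>0\<bar> + \<bar>F \<alpha>0 r0 - F \<alpha>0 r0\<bar>) (at z0)"
      by (intro tendsto_intros ts F0)
    then show "((\<lambda>z. C * \<bar>snd z - \<alpha>0\<bar> + \<bar>F \<alpha>0 (fst z) - F \<alpha>0 r0\<bar>) \<longlongrightarrow> 0) (at z0)" by simp
  qed
  then show "isCont (\<lambda>z. F (snd z) (fst z)) z0"
    unfolding isCont_def z(1) by (simp add: LIM_zero_iff)
qed

section \<open>The angle as a function of radius and shooting parameter\<close>

context emden
begin

lemma continuous_on_usol_prod: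
  "continuous_on ({0<..} \<times> {0<..}) (\<lambda>z. usol m lam p 0 (snd z) (fst z))"
proof -
  \<comment> \<open>The Lipschitz estimate in \<alpha> is available for r * u, not for u; the factor
    r is divided out afterwards, away from r = 0.\<close>
  have "continuous_on ({0<..} \<times> {0<..}) (\<lambda>z. (\<lambda>\<alpha> r. r * usol m lam p 0 \<alpha> r) (snd z) (fst z))"
  proof (rule continuous_on_prod_lipschitz)
    show "continuous_on {0<..} (\<lambda>r. r * usol m lam p 0 \<alpha> r)" if "\<alpha> > 0" for \<alpha>
      by (intro continuous_intros continuous_on_subset[OF continuous_on_usol]) (use that in auto)
    fix M R :: real assume "M > 0" "R > 0"
    then show "\<exists>C. \<forall>\<alpha> \<beta> r. 0 < \<alpha> \<and> \<alpha> \<le> M \<and> 0 < \<beta> \<and> \<beta> \<le> M \<and> 0 < r \<and> r \<le> R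
      \<longrightarrow> \<bar>r * usol m lam p 0 \<alpha> r - r * usol m lam p 0 \<beta> r\<bar> \<le> C * \<bar>\<alpha> - \<beta>\<bar>"
      using usol_lipschitz[of 0 _ M _ _ R]
      by (intro exI[of _ "R * exp ((lam + p * M powr (p - 1)) * R * R)"])
         (auto simp: abs_mult mult_ac simp flip: right_diff_distrib)
  qed
  then have "continuous_on ({0<..} \<times> {0<..}) (\<lambda>z. fst z * usol m lam p 0 (snd z) (fst z) / fst z)"
    by (rule continuous_on_divide) (auto intro!: continuous_intros)
  then show ?thesis by (rule continuous_on_eq) auto
qed

lemma mass_lipschitz:
  assumes h: "0 < \<alpha>" "\<alpha> \<le> M" "0 < \<beta>" "\<beta> \<le> M" "0 < r" "r \<le> R"
  defines "L \<equiv> lam + p * M powr (p - 1)"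
  shows "\<bar>mass m lam p 0 \<alpha> r - mass m lam p 0 \<beta> r\<bar> \<le> R * (R ^ m * (L * (R * \<bar>\<alpha> - \<beta>\<bar> * exp (L * R * R))))"
proof -
  define B where "B = R ^ m * (L * (R * \<bar>\<alpha> - \<beta>\<bar> * exp (L * R * R)))"
  have L: "L \<ge> 0" using lam p by (simp add: L_def)
  have B: "B \<ge> 0" using L h by (simp add: B_def)
  define F where "F \<gamma> t = t ^ (m + 1) * nonlin lam p (usol m lam p 0 \<gamma> t)" for \<gamma> t
  have i: "F \<gamma> integrable_on {0..r}" if "\<gamma> > 0" for \<gamma>
    unfolding F_def using that
    by (intro continuous_integrable_atMost continuous_intros continuous_on_nonlin_usol) auto
  have le: "\<bar>F \<alpha> t - F \<beta> t\<bar> \<le> B" if t: "t \<in> {0..r}" for t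
  proof -
    define D where "D = \<bar>usol m lam p 0 \<alpha> t - usol m lam p 0 \<beta> t\<bar>"
    have "\<bar>nonlin lam p (usol m lam p 0 \<alpha> t) - nonlin lam p (usol m lam p 0 \<beta> t)\<bar> \<le> L * D"
      unfolding L_def D_def
    proof (rule nonlin_lipschitz[OF p lam])
      show "usol m lam p 0 \<alpha> t \<le> M" using usol_le[of 0 \<alpha> t] h t by simp
      show "usol m lam p 0 \<beta> t \<le> M" using usol_le[of 0 \<beta> t] h t by simp
    qed
    then have "t ^ (m + 1) * \<bar>nonlin lam p (usol m lam p 0 \<alpha> t) - nonlin lam p (usol m lam p 0 \<beta> t)\<bar> \<le> t ^ (m + 1) * (L * D)"
      by (rule mult_left_mono) (use t in simp)
    then have "\<bar>F \<alpha> t - F \<beta> t\<bar> \<le> t ^ (m + 1) * (L * D)"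
      unfolding F_def right_diff_distrib[symmetric] abs_mult using t by simp
    also have "\<dots> = t ^ m * (L * (t * D))" by simp
    also have "\<dots> \<le> B"
      unfolding B_def
    proof (intro mult_mono[OF power_mono mult_left_mono[OF _ L]])
      show "t * D \<le> R * \<bar>\<alpha> - \<beta>\<bar> * exp (L * R * R)"
        unfolding L_def D_def by (rule usol_lipschitz) (use t h in auto)
      show "0 \<le> L * (t * D)" using L t by (simp add: D_def)
    qed (use t h in auto)
    finally show ?thesis .
  qed
  have "norm (integral {0..r} (\<lambda>t. F \<alpha> t - F \<beta> t)) \<le> integral {0..r} (\<lambda>t. B)"
    by (rule integral_norm_bound_integral[OF integrable_diff[OF i i]]) (use le h in \<open>auto simp: integrable_const_ivl\<close>)
  then have "\<bar>mass m lam p 0 \<alpha> r - mass m lam p 0 \<beta> r\<bar> \<le> r * B"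
    using integral_diff[OF i i] h unfolding mass_def F_def by simp
  also have "\<dots> \<le> R * B" using h B by (intro mult_right_mono) auto
  finally show ?thesis unfolding B_def .
qed

lemma continuous_on_dsol_prod:
  "continuous_on ({0<..} \<times> {0<..}) (\<lambda>z. dsol m lam p 0 (snd z) (fst z))"
proof -
  have "continuous_on ({0<..} \<times> {0<..}) (\<lambda>z. mass m lam p 0 (snd z) (fst z))"
  proof (rule continuous_on_prod_lipschitz)
    show "continuous_on {0<..} (mass m lam p 0 \<alpha>)" if "\<alpha> > 0" for \<alpha>
      using mass_has_derivative[of 0 \<alpha>] that DERIV_isCont by (intro continuous_at_imp_continuous_on) auto
    fix M R :: real
    define L where "L = lam + p * M powr (p - 1)"
    have "R * (R ^ m * (L * (R * x * exp (L * R * R)))) = R * (R ^ m * (L * (R * exp (L * R * R)))) * x" for x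
      by (simp only: mult_ac)
    then show "\<exists>C. \<forall>\<alpha> \<beta> r. 0 < \<alpha> \<and> \<alpha> \<le> M \<and> 0 < \<beta> \<and> \<beta> \<le> M \<and> 0 < r \<and> r \<le> R
      \<longrightarrow> \<bar>mass m lam p 0 \<alpha> r - mass m lam p 0 \<beta> r\<bar> \<le> C * \<bar>\<alpha> - \<beta>\<bar>"
      using mass_lipschitz[of _ M _ _ R] unfolding L_def by metis
  qed
  then show ?thesis unfolding dsol_def by (intro continuous_intros) auto
qed

text \<open>The angle at \<open>rs\<close> inherits one half turn for each sign change supplied by
  \<open>osc\<close>, counted from a starting level that is the same for all \<alpha> \<ge> 1. It is
  thus unbounded below in \<alpha>, and its cosine carries the sign of the difference at
  \<open>rs\<close>.\<close>

lemma alternating_values: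
  fixes u du ddu :: "real \<Rightarrow> real" and rs :: real
  assumes rs: "rs > 0"
    and du: "\<And>r. 0 < r \<Longrightarrow> r \<le> rs \<Longrightarrow> (u has_real_derivative du r) (at r)"
    and ddu: "\<And>r. 0 < r \<Longrightarrow> r \<le> rs \<Longrightarrow> (du has_real_derivative - (real m + 1) / r * du r - nonlin lam p (u r)) (at r)"
    and blow: "filterlim u at_top (at_right 0)"
    and osc: "\<And>n. \<exists>\<alpha>\<ge>1. \<exists>x::nat \<Rightarrow> real. (\<forall>i\<le>n. 0 < x i \<and> x i \<le> rs) \<and> (\<forall>i<n. x i < x (Suc i)) \<and>
       (\<forall>i<n. (usol m lam p 0 \<alpha> (x i) - u (x i)) * (usol m lam p 0 \<alpha> (x (Suc i)) - u (x (Suc i))) < 0)"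
  shows "\<exists>s::nat \<Rightarrow> real. \<forall>i. s i > 0 \<and> s i < s (Suc i) \<and> (-1) ^ i * (usol m lam p 0 (s i) rs - u rs) > 0"
proof -
  define W where "W z = usol m lam p 0 (snd z) (fst z) - u (fst z)" for z
  define W1 where "W1 z = dsol m lam p 0 (snd z) (fst z) - du (fst z)" for z
  define S where "S = {0<..rs} \<times> {0::real<..}"
  note S = S_def
  have below: "\<exists>\<delta>>0. \<delta> \<le> rs \<and> (\<forall>r. 0 < r \<and> r \<le> \<delta> \<longrightarrow> u r > \<alpha>)" for \<alpha>
  proof -
    have "eventually (\<lambda>r. u r > \<alpha>) (at_right 0)" using blow by (simp add: filterlim_at_top_dense)
    then obtain b where b: "b > 0" "\<And>r. 0 < r \<Longrightarrow> r < b \<Longrightarrow> u r > \<alpha>"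
      unfolding eventually_at_right_field by auto
    then show ?thesis using rs by (intro exI[of _ "min rs (b / 2)"]) auto
  qed
  have dW: "((\<lambda>r. W (r, \<alpha>)) has_real_derivative W1 (r, \<alpha>)) (at r)" if "0 < r" "r \<le> rs" "\<alpha> > 0" for r \<alpha>
    unfolding W_def W1_def using usol_has_derivative[of 0 \<alpha> r] du[of r] that by (auto intro!: DERIV_diff)
  have dW1: "((\<lambda>r. W1 (r, \<alpha>)) has_real_derivative
      - (real m + 1) / r * W1 (r, \<alpha>) - (nonlin lam p (usol m lam p 0 \<alpha> r) - nonlin lam p (u r))) (at r)"
    if "0 < r" "r \<le> rs" "\<alpha> > 0" for r \<alpha>
  proof -
    have "((\<lambda>r. W1 (r, \<alpha>)) has_real_derivative (- (real m + 1) / r * dsol m lam p 0 \<alpha> r - nonlin lam p (usol m lam p 0 \<alpha> r))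
        - (- (real m + 1) / r * du r - nonlin lam p (u r))) (at r)"
      unfolding W1_def fst_conv snd_conv
      by (intro DERIV_diff dsol_has_derivative ddu) (use that in auto)
    also have "(- (real m + 1) / r * dsol m lam p 0 \<alpha> r - nonlin lam p (usol m lam p 0 \<alpha> r))
        - (- (real m + 1) / r * du r - nonlin lam p (u r)) =
       - (real m + 1) / r * W1 (r, \<alpha>) - (nonlin lam p (usol m lam p 0 \<alpha> r) - nonlin lam p (u r))"
      by (simp add: W1_def right_diff_distrib)
    finally show ?thesis .
  qed
  have neg: "W (r, \<alpha>) < 0" if "0 < r" "\<alpha> > 0" "u r > \<alpha>" for r \<alpha>
    using usol_le[of 0 \<alpha> r] that by (auto simp: W_def)
  have cu: "continuous_on {x..y} u" if "x > 0" "y \<le> rs" for x y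
    by (intro continuous_at_imp_continuous_on ballI DERIV_isCont[OF du]) (use that in auto)
  \<comment> \<open>A common zero would propagate by uniqueness down to small radii, where u exceeds
    \<alpha> while the regular solution does not.\<close>
  have nz: "\<not> (W (r, \<alpha>) = 0 \<and> W1 (r, \<alpha>) = 0)" if r: "0 < r" "r \<le> rs" "\<alpha> > 0" for r \<alpha>
  proof
    assume 0: "W (r, \<alpha>) = 0 \<and> W1 (r, \<alpha>) = 0"
    obtain \<delta> where \<delta>: "\<delta> > 0" "\<And>r. 0 < r \<Longrightarrow> r \<le> \<delta> \<Longrightarrow> u r > \<alpha>" using below by blast
    define c where "c = min \<delta> r"
    have c: "0 < c" "c \<le> r" "c \<le> \<delta>" using r \<delta> by (auto simp: c_def)
    have "compact (u ` {c..r})" by (intro compact_continuous_image cu) (use c r in auto)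
    then obtain B where B: "\<And>t. t \<in> {c..r} \<Longrightarrow> \<bar>u t\<bar> \<le> B"
      by (metis (no_types, lifting) bounded_iff compact_imp_bounded imageI real_norm_def)
    define M where "M = max \<alpha> B"
    define L where "L = lam + p * M powr (p - 1)"
    have L: "L \<ge> 0" using p lam by (simp add: L_def)
    have "W (c, \<alpha>) = 0"
    proof (rule second_order_unique[where w = "\<lambda>r. W (r, \<alpha>)" and ?w1.0 = "\<lambda>r. W1 (r, \<alpha>)" and c = c and d = r and ?t0.0 = r
          and ?w2.0 = "\<lambda>r. - (real m + 1) / r * W1 (r, \<alpha>) - (nonlin lam p (usol m lam p 0 \<alpha> r) - nonlin lam p (u r))"
          and K = "(real m + 1) / c + L"])
      fix t assume t: "t \<in> {c..r}"
      have "\<bar>nonlin lam p (usol m lam p 0 \<alpha> t) - nonlin lam p (u t)\<bar> \<le> L * \<bar>W (t, \<alpha>)\<bar>"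
        unfolding L_def W_def fst_conv snd_conv
        using usol_le[of 0 \<alpha> t] B[OF t] t c r p lam by (intro nonlin_lipschitz) (auto simp: M_def)
      moreover have "\<bar>- (real m + 1) / t * W1 (t, \<alpha>)\<bar> \<le> (real m + 1) / c * \<bar>W1 (t, \<alpha>)\<bar>"
      proof -
        have "\<bar>- (real m + 1) / t * W1 (t, \<alpha>)\<bar> = (real m + 1) / t * \<bar>W1 (t, \<alpha>)\<bar>"
          using t c by (simp add: abs_mult)
        also have "\<dots> \<le> (real m + 1) / c * \<bar>W1 (t, \<alpha>)\<bar>"
          using t c by (intro mult_right_mono divide_left_mono) auto
        finally show ?thesis .
      qed
      moreover have "(real m + 1) / c * \<bar>W (t, \<alpha>)\<bar> \<ge> 0" "L * \<bar>W1 (t, \<alpha>)\<bar> \<ge> 0" using c L by auto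
      ultimately show "\<bar>- (real m + 1) / t * W1 (t, \<alpha>) - (nonlin lam p (usol m lam p 0 \<alpha> t) - nonlin lam p (u t))\<bar>
          \<le> ((real m + 1) / c + L) * (\<bar>W (t, \<alpha>)\<bar> + \<bar>W1 (t, \<alpha>)\<bar>)"
        unfolding distrib_left distrib_right by linarith
    qed (use 0 c r L dW dW1 in auto)
    moreover have "W (c, \<alpha>) < 0" using neg[of c \<alpha>] \<delta>(2)[of c] c r by simp
    ultimately show False by simp
  qed
  define f where "f z = Complex (W z) (W1 z)" for z
  have cfst: "continuous_on S (\<lambda>z. g (fst z))" if "\<And>r. 0 < r \<Longrightarrow> r \<le> rs \<Longrightarrow> isCont g r" for g :: "real \<Rightarrow> real"
    by (rule continuous_on_compose2[where t = "{0<..rs}" and g = g])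
       (use that in \<open>auto simp: S intro!: continuous_at_imp_continuous_on continuous_intros\<close>)
  have cW: "continuous_on S W" "continuous_on S W1"
    unfolding W_def W1_def
    by (intro continuous_intros continuous_on_subset[OF continuous_on_usol_prod] continuous_on_subset[OF continuous_on_dsol_prod] cfst;
        use du ddu DERIV_isCont in \<open>force simp: S\<close>)+
  have cf: "continuous_on S f" unfolding f_def by (intro continuous_intros cW)
  \<comment> \<open>A nonvanishing continuous complex function on a contractible set has a
    continuous logarithm. Lifting on the product, not for each \<alpha> separately, is what makes
    the angle at \<open>rs\<close> continuous in \<alpha>.\<close>
  have "contractible S" unfolding S by (intro convex_imp_contractible convex_Times) auto
  moreover have "f z \<noteq> 0" if "z \<in> S" for z
    using nz[of "fst z" "snd z"] that by (auto simp: f_def complex_eq_iff S)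
  ultimately obtain g where g: "continuous_on S g" "\<And>z. z \<in> S \<Longrightarrow> f z = exp (g z)"
    using continuous_logarithm_on_contractible[OF cf] by metis
  define \<theta> where "\<theta> z = Im (g z)" for z
  have c\<theta>: "continuous_on S \<theta>" unfolding \<theta>_def by (intro continuous_intros g)
  have Wc: "W z = exp (Re (g z)) * cos (\<theta> z)" "W1 z = exp (Re (g z)) * sin (\<theta> z)" if "z \<in> S" for z
  proof -
    have "W z = Re (exp (g z))" "W1 z = Im (exp (g z))" using g(2)[OF that] unfolding f_def by (metis complex.sel(1), metis complex.sel(2))
    then show "W z = exp (Re (g z)) * cos (\<theta> z)" "W1 z = exp (Re (g z)) * sin (\<theta> z)"
      by (simp_all add: Re_exp Im_exp \<theta>_def)
  qed
  have cr: "continuous_on {x..y} (\<lambda>r. \<theta> (r, \<alpha>))" if "x > 0" "y \<le> rs" "\<alpha> > 0" for x y \<alpha>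
    by (rule continuous_on_compose2[OF c\<theta>]) (use that in \<open>auto simp: S intro!: continuous_intros\<close>)
  have ca: "continuous_on T (\<lambda>\<alpha>. \<theta> (r, \<alpha>))" if "r > 0" "r \<le> rs" "T \<subseteq> {0<..}" for T r
    by (rule continuous_on_compose2[OF c\<theta>]) (use that in \<open>auto simp: S intro!: continuous_intros\<close>)
  have notlevel: "\<theta> (r, \<alpha>) \<noteq> level j" if "0 < r" "r \<le> rs" "\<alpha> > 0" "u r > \<alpha>" for r \<alpha> j
  proof
    assume "\<theta> (r, \<alpha>) = level j"
    then have "W (r, \<alpha>) = 0" using Wc(1)[of "(r, \<alpha>)"] that by (simp add: S)
    then show False using neg[of r \<alpha>] that by simp
  qed
  obtain \<delta>0 where \<delta>0: "\<delta>0 > 0" "\<delta>0 \<le> rs" "\<And>r. 0 < r \<Longrightarrow> r \<le> \<delta>0 \<Longrightarrow> u r > 1" using below by blast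
  \<comment> \<open>Fixed once, from the point (\<delta>0, 1). Moving to (r, 1) and then to (r,
    \<alpha>) stays where u exceeds the parameter, hence W < 0 and no level is met; so the same j
    bounds the initial angle for every \<alpha> \<ge> 1.\<close>
  define j where "j = \<lceil>\<theta> (\<delta>0, 1) / pi\<rceil>"
  have "\<theta> (\<delta>0, 1) \<le> level j"
    using le_of_int_ceiling[of "\<theta> (\<delta>0, 1) / pi"] pi_gt_zero unfolding level_def j_def
    by (smt (verit) divide_le_eq half_gt_zero)
  then have start0: "\<theta> (\<delta>0, 1) < level j" using notlevel[of \<delta>0 1 j] \<delta>0 by auto
  have start: "\<exists>\<delta>>0. \<forall>r. 0 < r \<and> r \<le> \<delta> \<longrightarrow> \<theta> (r, \<alpha>) \<le> level j" if \<alpha>: "\<alpha> \<ge> 1" for \<alpha>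
  proof -
    obtain \<delta> where \<delta>: "\<delta> > 0" "\<And>r. 0 < r \<Longrightarrow> r \<le> \<delta> \<Longrightarrow> u r > \<alpha>" using below by blast
    have "\<theta> (r, \<alpha>) \<le> level j" if r: "0 < r" "r \<le> min \<delta> \<delta>0" for r
    proof -
      have "\<theta> (r, 1) < level j \<longleftrightarrow> \<theta> (\<delta>0, 1) < level j"
      proof (rule no_crossing[OF cr])
        fix t assume "t \<in> {r..\<delta>0}"
        then show "\<theta> (t, 1) \<noteq> level j" using \<delta>0 r by (intro notlevel) auto
      qed (use r \<delta>0 in auto)
      moreover have "\<theta> (r, 1) < level j \<longleftrightarrow> \<theta> (r, \<alpha>) < level j"
      proof (rule no_crossing[OF ca])
        fix t assume t: "t \<in> {1..\<alpha>}"
        then show "\<theta> (r, t) \<noteq> level j" using \<delta>(2)[of r] r \<delta>0 by (intro notlevel) auto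
      qed (use r \<delta>0 \<alpha> in auto)
      ultimately show ?thesis using start0 by simp
    qed
    then show ?thesis using \<delta> \<delta>0 by (intro exI[of _ "min \<delta> \<delta>0"]) auto
  qed
  have "\<exists>s::nat \<Rightarrow> real. \<forall>i. s i > 0 \<and> s i < s (Suc i) \<and> (-1) ^ i * cos (\<theta> (rs, s i)) > 0"
  proof (rule alternating_cos)
    show "continuous_on {0<..} (\<lambda>\<alpha>. \<theta> (rs, \<alpha>))" by (rule ca) (use rs in auto)
    fix Y :: real
    define n where "n = nat \<lceil>(level j - Y) / pi\<rceil>"
    have "real n \<ge> (level j - Y) / pi" unfolding n_def by linarith
    then have nY: "level (j - int n) \<le> Y" by (simp add: level_def field_simps)
    obtain \<alpha> x where x: "\<alpha> \<ge> 1" "\<And>i. i \<le> n \<Longrightarrow> 0 < x i" "\<And>i. i \<le> n \<Longrightarrow> x i \<le> rs" "\<And>i. i < n \<Longrightarrow> x i < x (Suc i)"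
      "\<And>i. i < n \<Longrightarrow> W (x i, \<alpha>) * W (x (Suc i), \<alpha>) < 0"
      using osc[of n] unfolding W_def by auto
    obtain \<delta> where \<delta>: "\<delta> > 0" "\<And>r. 0 < r \<Longrightarrow> r \<le> \<delta> \<Longrightarrow> \<theta> (r, \<alpha>) \<le> level j" using start[OF x(1)] by blast
    define c where "c = min \<delta> (x 0)"
    have c: "c > 0" "c \<le> x 0" "c \<le> \<delta>" using x(2)[of 0] \<delta> by (auto simp: c_def)
    have "\<theta> (rs, \<alpha>) \<le> level (j - int n)"
    proof (rule angle_decreases[where w = "\<lambda>r. W (r, \<alpha>)" and ?w1.0 = "\<lambda>r. W1 (r, \<alpha>)" and \<theta> = "\<lambda>r. \<theta> (r, \<alpha>)"
          and R = "\<lambda>r. exp (Re (g (r, \<alpha>)))" and c = c and d = rs and x = x and n = n and j = j])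
      fix t assume t: "t \<in> {c..rs}"
      then show "((\<lambda>r. W (r, \<alpha>)) has_real_derivative W1 (t, \<alpha>)) (at t)" using c x(1) by (intro dW) auto
      show "W (t, \<alpha>) = exp (Re (g (t, \<alpha>))) * cos (\<theta> (t, \<alpha>))" "W1 (t, \<alpha>) = exp (Re (g (t, \<alpha>))) * sin (\<theta> (t, \<alpha>))"
        using Wc[of "(t, \<alpha>)"] t c x(1) by (auto simp: S)
    qed (use c x \<delta> in \<open>auto intro!: cr\<close>)
    then show "\<exists>\<alpha>\<ge>1. \<theta> (rs, \<alpha>) \<le> Y" using nY x(1) by (intro exI[of _ \<alpha>]) auto
  qed
  then obtain s :: "nat \<Rightarrow> real" where s: "\<And>i. s i > 0" "\<And>i. s i < s (Suc i)" "\<And>i. (-1) ^ i * cos (\<theta> (rs, s i)) > 0"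
    by blast
  have "(-1) ^ i * (usol m lam p 0 (s i) rs - u rs) > 0" for i
  proof -
    have *: "(-1) ^ i * (usol m lam p 0 (s i) rs - u rs) = exp (Re (g (rs, s i))) * ((-1) ^ i * cos (\<theta> (rs, s i)))"
      using Wc(1)[of "(rs, s i)"] rs s(1)[of i] by (simp add: W_def S mult_ac)
    show ?thesis unfolding * by (intro mult_pos_pos s) simp
  qed
  then show ?thesis using s by blast
qed

end

section \<open>Scaling\<close>

lemma integral_scale:
  fixes g :: "real \<Rightarrow> real"
  assumes "c > 0" "continuous_on {0..} g"
  shows "integral {0..c * x} g = c * integral {0..x} (\<lambda>s. g (c * s))"
proof -
  have "(g has_integral integral {0..c * x} g) {0..c * x}"
    by (rule integrable_integral[OF continuous_integrable_atMost[OF assms(2)]])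
  from has_integral_stretch_real[OF this, of c]
  have "((\<lambda>s. g (c * s)) has_integral integral {0..c * x} g / c) {0..x}" using assms(1) by simp
  then show ?thesis using assms(1) by (simp add: integral_unique)
qed

text \<open>The operator inverts a second order operator that is homogeneous under dilations, hence
  the factor \<open>c\<^sup>2\<close>.\<close>

lemma vol_scale:
  assumes "c > 0" "continuous_on {0..} \<phi>"
  shows "vol m \<phi> (c * x) = c\<^sup>2 * vol m (\<lambda>t. \<phi> (c * t)) x"
proof -
  have 1: "integral {0..c * x} (\<lambda>t. t * \<phi> t) = c\<^sup>2 * integral {0..x} (\<lambda>t. t * \<phi> (c * t))"
    using integral_scale[OF assms(1), of "\<lambda>t. t * \<phi> t" x] assms(2)
    by (simp add: continuous_on_mult continuous_on_id mult.assoc power2_eq_square)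
  have "integral {0..c * x} (\<lambda>t. t ^ (m + 1) * \<phi> t) = c * integral {0..x} (\<lambda>t. (c * t) ^ (m + 1) * \<phi> (c * t))"
    by (rule integral_scale[OF assms(1)]) (intro continuous_intros assms)
  also have "\<dots> = c ^ (m + 2) * integral {0..x} (\<lambda>t. t ^ (m + 1) * \<phi> (c * t))"
    unfolding power_mult_distrib mult.assoc integral_mult_right by simp
  finally have 2: "integral {0..c * x} (\<lambda>t. t ^ (m + 1) * \<phi> t) / (c * x) ^ m =
      c\<^sup>2 * (integral {0..x} (\<lambda>t. t ^ (m + 1) * \<phi> (c * t)) / x ^ m)"
    using assms(1) by (simp add: power_mult_distrib power_add power2_eq_square)
  show ?thesis unfolding vol_def 1 2 by (simp add: right_diff_distrib diff_divide_distrib)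
qed

context emden
begin

text \<open>Rescaling \<open>r = \<mu> x\<close> with \<open>\<mu> = \<alpha> powr (- (p - 1) / 2)\<close> normalises the central value to \<open>1\<close> and
  turns \<open>\<lambda>\<close> into \<open>\<lambda> * \<mu>\<^sup>2\<close>.\<close>

lemma scaled_solution_bound:
  assumes al: "\<alpha> > 0" and x: "x > 0"
  defines "\<mu> \<equiv> \<alpha> powr (- (p - 1) / 2)"
  shows "x * \<bar>usol m lam p 0 \<alpha> (\<mu> * x) / \<alpha> - usol m 0 p 0 1 x\<bar> \<le> x * (lam * \<mu>\<^sup>2 * x\<^sup>2) * exp (p * x * x)"
proof -
  interpret E0: emden m 0 p by unfold_locales (use m p in auto)
  have mu: "\<mu> > 0" using al by (simp add: \<mu>_def)
  \<comment> \<open>The power of \<alpha> in \<mu> is determined by this identity: it leaves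
    coefficient 1 in front of the rescaled power term.\<close>
  have mu2: "\<mu>\<^sup>2 * \<alpha> powr p = \<alpha>"
  proof -
    have "\<mu>\<^sup>2 = \<alpha> powr (- (p - 1))" unfolding \<mu>_def power2_eq_square powr_add[symmetric] by simp
    then show ?thesis using al by (simp flip: powr_add)
  qed
  define u where "u = usol m lam p 0 \<alpha>"
  define y where "y t = u (\<mu> * t) / \<alpha>" for t
  have cu: "continuous_on {0..} u" unfolding u_def by (rule continuous_on_usol) (use al in auto)
  have cy: "continuous_on {0..} y"
    unfolding y_def by (intro continuous_intros continuous_on_compose2[OF cu]) (use mu al in auto)
  have cn: "continuous_on {0..} (\<lambda>t. nonlin lam p (u t))" by (intro continuous_intros p cu)
  have y1: "y t \<le> 1" if "t \<ge> 0" for t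
    using usol_le[of 0 \<alpha> "\<mu> * t"] that mu al by (simp add: y_def u_def)
  have nl: "\<mu>\<^sup>2 / \<alpha> * nonlin lam p (u (\<mu> * t)) = lam * \<mu>\<^sup>2 * max (y t) 0 + nonlin 0 p (y t)" for t
  proof -
    have 1: "max (u (\<mu> * t)) 0 = \<alpha> * max (y t) 0"
      using al by (simp add: y_def max_mult_distrib_left)
    have "\<mu>\<^sup>2 / \<alpha> * nonlin lam p (u (\<mu> * t)) = lam * \<mu>\<^sup>2 * max (y t) 0 + (\<mu>\<^sup>2 * \<alpha> powr p) / \<alpha> * max (y t) 0 powr p"
      unfolding nonlin_def 1 using al by (simp add: powr_mult distrib_left mult_ac)
    then show ?thesis unfolding mu2 nonlin_def using al by simp
  qed
  have ey: "y t = 1 - vol m (\<lambda>s. lam * \<mu>\<^sup>2 * max (y s) 0 + nonlin 0 p (y s)) t" if "t \<ge> 0" for t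
  proof -
    have "u (\<mu> * t) = \<alpha> - vol m (\<lambda>s. nonlin lam p (u s)) (\<mu> * t)"
      using usol_eq[of 0 \<alpha> "\<mu> * t"] that mu al m by (simp add: u_def)
    also have "vol m (\<lambda>s. nonlin lam p (u s)) (\<mu> * t) = \<mu>\<^sup>2 * vol m (\<lambda>s. nonlin lam p (u (\<mu> * s))) t"
      by (rule vol_scale[OF mu cn])
    finally have "y t = 1 - \<mu>\<^sup>2 / \<alpha> * vol m (\<lambda>s. nonlin lam p (u (\<mu> * s))) t"
      using al by (simp add: y_def diff_divide_distrib)
    also have "\<mu>\<^sup>2 / \<alpha> * vol m (\<lambda>s. nonlin lam p (u (\<mu> * s))) t = vol m (\<lambda>s. \<mu>\<^sup>2 / \<alpha> * nonlin lam p (u (\<mu> * s))) t"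
      unfolding vol_def by (simp add: mult.left_commute[of _ "\<mu>\<^sup>2 / \<alpha>"] right_diff_distrib del: times_divide_eq_left)
    finally show ?thesis unfolding nl .
  qed
  \<comment> \<open>The linear term is moved into the inhomogeneity. What remains is the equation
    for \<lambda> = 0 perturbed by at most lam * \<mu>^2 * x^2; values are at most 1, so the power
    has Lipschitz constant p.\<close>
  define k where "k t = 1 - vol m (\<lambda>s. lam * \<mu>\<^sup>2 * max (y s) 0) t" for t
  have c1: "continuous_on {0..} (\<lambda>s. lam * \<mu>\<^sup>2 * max (y s) 0)" by (intro continuous_intros cy)
  have c2: "continuous_on {0..} (\<lambda>s. nonlin 0 p (y s))" by (intro continuous_intros cy p)
  have c3: "continuous_on {0..} (\<lambda>s. lam * \<mu>\<^sup>2 * max (y s) 0 + nonlin 0 p (y s))" by (intro continuous_intros c1 c2)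
  have "x * \<bar>y x - usol m 0 p 0 1 x\<bar> \<le> (x * (lam * \<mu>\<^sup>2 * x\<^sup>2)) * exp (p * x * x)"
  proof (rule volterra_stability[OF m, where h = k and k = "\<lambda>_. 1" and \<phi> = "\<lambda>s. nonlin 0 p (y s)" and \<psi> = "\<lambda>s. nonlin 0 p (usol m 0 p 0 1 s)"])
    show "continuous_on {0..} (usol m 0 p 0 1)" "continuous_on {0..} (\<lambda>s. nonlin 0 p (usol m 0 p 0 1 s))"
      by (auto intro!: E0.continuous_on_usol E0.continuous_on_nonlin_usol)
    fix t :: real assume t: "t \<ge> 0"
    show "y t = k t - vol m (\<lambda>s. nonlin 0 p (y s)) t"
      using ey[OF t] vol_diff[OF c3 c2, of m t] by (simp add: k_def)
    show "usol m 0 p 0 1 t = 1 - vol m (\<lambda>s. nonlin 0 p (usol m 0 p 0 1 s)) t"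
      using E0.usol_eq[of 0 1 t] t m by simp
    show "\<bar>nonlin 0 p (y t) - nonlin 0 p (usol m 0 p 0 1 t)\<bar> \<le> p * \<bar>y t - usol m 0 p 0 1 t\<bar>"
      using nonlin_lipschitz[of p 0 "y t" 1 "usol m 0 p 0 1 t"] y1[OF t] E0.usol_le[of 0 1 t] t p by simp
    assume tx: "t \<le> x"
    have "\<bar>vol m (\<lambda>s. lam * \<mu>\<^sup>2 * max (y s) 0) t\<bar> \<le> (lam * \<mu>\<^sup>2) * t\<^sup>2"
    proof (rule abs_vol_le_const[OF c1 m t])
      fix s assume "0 \<le> s" "s \<le> t"
      then have "\<bar>max (y s) 0\<bar> \<le> 1" using y1[of s] by simp
      then show "\<bar>lam * \<mu>\<^sup>2 * max (y s) 0\<bar> \<le> lam * \<mu>\<^sup>2"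
        using lam mult_left_mono[of "\<bar>max (y s) 0\<bar>" 1 "lam * \<mu>\<^sup>2"] by (simp add: abs_mult)
    qed
    also have "\<dots> \<le> (lam * \<mu>\<^sup>2) * x\<^sup>2" using t tx lam by (intro mult_left_mono power_mono) auto
    finally show "t * \<bar>k t - 1\<bar> \<le> x * (lam * \<mu>\<^sup>2 * x\<^sup>2)"
      unfolding k_def using t tx by (intro mult_mono) auto
  qed (use p x cy c2 in auto)
  then show ?thesis by (simp add: y_def u_def)
qed

lemma scaled_solution_tendsto:
  assumes x: "x > 0"
  shows "((\<lambda>\<alpha>. usol m lam p 0 \<alpha> (\<alpha> powr (- (p - 1) / 2) * x) / \<alpha>) \<longlongrightarrow> usol m 0 p 0 1 x) at_top"
proof -
  have mu: "((\<lambda>\<alpha>::real. \<alpha> powr (- (p - 1) / 2)) \<longlongrightarrow> 0) at_top"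
    by (rule tendsto_neg_powr) (use p in \<open>auto intro: filterlim_ident\<close>)
  have "((\<lambda>\<alpha>. usol m lam p 0 \<alpha> (\<alpha> powr (- (p - 1) / 2) * x) / \<alpha> - usol m 0 p 0 1 x) \<longlongrightarrow> 0) at_top"
  proof (rule Lim_null_comparison)
    show "eventually (\<lambda>\<alpha>. norm (usol m lam p 0 \<alpha> (\<alpha> powr (- (p - 1) / 2) * x) / \<alpha> - usol m 0 p 0 1 x)
       \<le> lam * (\<alpha> powr (- (p - 1) / 2))\<^sup>2 * x\<^sup>2 * exp (p * x * x)) at_top"
      using eventually_gt_at_top[of 0]
    proof eventually_elim
      case (elim \<alpha>)
      from scaled_solution_bound[OF elim x] show ?case
        unfolding mult.assoc[of x] using x by (simp only: mult_le_cancel_left_pos real_norm_def)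
    qed
    have "((\<lambda>\<alpha>::real. lam * (\<alpha> powr (- (p - 1) / 2))\<^sup>2 * x\<^sup>2 * exp (p * x * x)) \<longlongrightarrow> lam * 0\<^sup>2 * x\<^sup>2 * exp (p * x * x)) at_top"
      by (intro tendsto_intros mu)
    then show "((\<lambda>\<alpha>::real. lam * (\<alpha> powr (- (p - 1) / 2))\<^sup>2 * x\<^sup>2 * exp (p * x * x)) \<longlongrightarrow> 0) at_top" by simp
  qed
  then show ?thesis by (simp add: LIM_zero_iff)
qed

text \<open>At radius \<mu> * x both functions divided by \<alpha> converge: the regular one to
  U(x), the singular one to A * x powr (-\<theta>). The sample points are chosen for the limit,
  where the difference alternates strictly; finitely many strict signs survive for one large
  \<alpha>, and the radii shrink below \<open>rs\<close>.\<close>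

lemma singular_solution_intersections:
  fixes u :: "real \<Rightarrow> real" and \<theta> A rs :: real and n :: nat
  assumes th: "\<theta> = 2 / (p - 1)" "2 * \<theta> < real m" and JL: "(real m - 2 * \<theta>)\<^sup>2 < 8 * (real m - \<theta>)"
    and A: "A = (\<theta> * (real m - \<theta>)) powr (1 / (p - 1))"
    and u: "((\<lambda>r. u r / (A * r powr (- \<theta>))) \<longlongrightarrow> 1) (at_right 0)" and rs: "rs > 0"
  shows "\<exists>\<alpha>\<ge>1. \<exists>x::nat \<Rightarrow> real. (\<forall>i\<le>n. 0 < x i \<and> x i \<le> rs) \<and> (\<forall>i<n. x i < x (Suc i)) \<and>
       (\<forall>i<n. (usol m lam p 0 \<alpha> (x i) - u (x i)) * (usol m lam p 0 \<alpha> (x (Suc i)) - u (x (Suc i))) < 0)"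
proof -
  define U where "U = usol m 0 p 0 1"
  have th0: "\<theta> > 0" using th p by simp
  then have Apos: "A > 0" using th by (simp add: A)
  have osc: "\<exists>x>X. x > 0 \<and> (-1) ^ i * (U x * x powr \<theta> - A) < 0" for X and i :: nat
    unfolding U_def
    by (rule regular_solution_oscillates[OF m p th JL A]) (cases "even i", auto)
  have "\<exists>x::nat \<Rightarrow> real. \<forall>i. (x i > 0 \<and> (-1) ^ i * (U (x i) * x i powr \<theta> - A) < 0) \<and> x i < x (Suc i)"
  proof (rule dependent_nat_choice)
    show "\<exists>x>0. (-1) ^ 0 * (U x * x powr \<theta> - A) < 0" using osc[of 0 0] by blast
    show "\<exists>y. (y > 0 \<and> (-1) ^ Suc i * (U y * y powr \<theta> - A) < 0) \<and> x < y" for x i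
      using osc[of x "Suc i"] by blast
  qed
  then obtain x where x: "\<And>i::nat. x i > 0" "\<And>i. (-1) ^ i * (U (x i) * x i powr \<theta> - A) < 0" "\<And>i. x i < x (Suc i)"
    by blast
  define \<mu> where "\<mu> \<alpha> = \<alpha> powr (- (p - 1) / 2)" for \<alpha> :: real
  have mu0: "(\<mu> \<longlongrightarrow> 0) at_top"
    unfolding \<mu>_def by (rule tendsto_neg_powr) (use p in \<open>auto intro: filterlim_ident\<close>)
  have mupos: "\<mu> \<alpha> > 0" if "\<alpha> > 0" for \<alpha> using that by (simp add: \<mu>_def)
  have lim0: "((\<lambda>\<alpha>. \<mu> \<alpha> * x i) \<longlongrightarrow> 0) at_top" for i
    using tendsto_mult_right[OF mu0, of "x i"] by simp
  have ev: "eventually (\<lambda>\<alpha>. (-1) ^ i * (usol m lam p 0 \<alpha> (\<mu> \<alpha> * x i) - u (\<mu> \<alpha> * x i)) < 0) at_top" for i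
  proof -
    have "filterlim (\<lambda>\<alpha>. \<mu> \<alpha> * x i) (at_right 0) at_top"
    proof (rule tendsto_imp_filterlim_at_right[OF lim0])
      show "eventually (\<lambda>\<alpha>. \<mu> \<alpha> * x i > 0) at_top"
        using eventually_gt_at_top[of 0] by eventually_elim (use mupos x in simp)
    qed
    then have "((\<lambda>\<alpha>. u (\<mu> \<alpha> * x i) / (A * (\<mu> \<alpha> * x i) powr (- \<theta>))) \<longlongrightarrow> 1) at_top"
      by (rule filterlim_compose[OF u])
    then have "((\<lambda>\<alpha>. A * x i powr (- \<theta>) * (u (\<mu> \<alpha> * x i) / (A * (\<mu> \<alpha> * x i) powr (- \<theta>)))) \<longlongrightarrow> A * x i powr (- \<theta>) * 1) at_top"
      by (intro tendsto_intros)
    moreover have "eventually (\<lambda>\<alpha>. A * x i powr (- \<theta>) * (u (\<mu> \<alpha> * x i) / (A * (\<mu> \<alpha> * x i) powr (- \<theta>))) = u (\<mu> \<alpha> * x i) / \<alpha>) at_top"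
      using eventually_gt_at_top[of 0]
    proof eventually_elim
      case (elim \<alpha>)
      \<comment> \<open>Needed for \<mu> powr (-\<theta>) = \<alpha>: the singular profile has the
        scaling of the equation, which is why one dilation serves both functions.\<close>
      have "\<theta> * (p - 1) = 2" using p unfolding th(1) by (subst nonzero_eq_divide_eq[symmetric]) auto
      moreover have "- (p - 1) / 2 * - \<theta> = \<theta> * (p - 1) / 2" by (simp add: algebra_simps)
      ultimately have "- (p - 1) / 2 * - \<theta> = 1" by simp
      then have "\<mu> \<alpha> powr (- \<theta>) = \<alpha>" using elim by (simp only: \<mu>_def powr_powr powr_one)
      then have "(\<mu> \<alpha> * x i) powr (- \<theta>) = \<alpha> * x i powr (- \<theta>)" by (simp add: powr_mult)
      then show ?case using Apos x(1)[of i] elim by simp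
    qed
    ultimately have 1: "((\<lambda>\<alpha>. u (\<mu> \<alpha> * x i) / \<alpha>) \<longlongrightarrow> A * x i powr (- \<theta>)) at_top"
      by (simp add: tendsto_cong)
    have "((\<lambda>\<alpha>. (-1) ^ i * (usol m lam p 0 \<alpha> (\<mu> \<alpha> * x i) / \<alpha> - u (\<mu> \<alpha> * x i) / \<alpha>)) \<longlongrightarrow> (-1) ^ i * (U (x i) - A * x i powr (- \<theta>))) at_top"
      unfolding U_def \<mu>_def by (intro tendsto_intros scaled_solution_tendsto x 1[unfolded \<mu>_def])
    moreover have "(-1) ^ i * (U (x i) - A * x i powr (- \<theta>)) < 0"
    proof -
      have *: "(-1) ^ i * (U (x i) * x i powr \<theta> - A) = ((-1) ^ i * (U (x i) - A * x i powr (- \<theta>))) * x i powr \<theta>"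
        using x(1)[of i] by (simp add: powr_minus field_simps)
      show ?thesis
      proof (rule ccontr)
        assume "\<not> ?thesis"
        then have "(-1) ^ i * (U (x i) - A * x i powr (- \<theta>)) \<ge> 0" by (simp only: not_less)
        then have "(-1) ^ i * (U (x i) * x i powr \<theta> - A) \<ge> 0"
          unfolding * by (rule mult_nonneg_nonneg) (rule powr_ge_zero)
        then show False using x(2)[of i] by (meson not_less)
      qed
    qed
    ultimately have "eventually (\<lambda>\<alpha>. (-1) ^ i * (usol m lam p 0 \<alpha> (\<mu> \<alpha> * x i) / \<alpha> - u (\<mu> \<alpha> * x i) / \<alpha>) < 0) at_top"
      by (rule order_tendstoD)
    then show ?thesis
      using eventually_gt_at_top[of 0]
    proof eventually_elim
      case (elim \<alpha>)
      have "(-1) ^ i * (usol m lam p 0 \<alpha> (\<mu> \<alpha> * x i) / \<alpha> - u (\<mu> \<alpha> * x i) / \<alpha>) =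
          ((-1) ^ i * (usol m lam p 0 \<alpha> (\<mu> \<alpha> * x i) - u (\<mu> \<alpha> * x i))) / \<alpha>"
        by (simp only: diff_divide_distrib times_divide_eq_right right_diff_distrib)
      then show ?case using elim by (simp add: divide_less_0_iff)
    qed
  qed
  have "eventually (\<lambda>\<alpha>. \<forall>i\<in>{..n}. (-1) ^ i * (usol m lam p 0 \<alpha> (\<mu> \<alpha> * x i) - u (\<mu> \<alpha> * x i)) < 0) at_top"
    by (rule eventually_ball_finite) (use ev in auto)
  moreover have "eventually (\<lambda>\<alpha>. \<forall>i\<in>{..n}. \<mu> \<alpha> * x i < rs) at_top"
    by (rule eventually_ball_finite) (use rs in \<open>auto intro: order_tendstoD(2)[OF lim0]\<close>)
  moreover have "eventually (\<lambda>\<alpha>::real. \<alpha> \<ge> 1) at_top" by (rule eventually_ge_at_top)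
  ultimately have "eventually (\<lambda>\<alpha>. (\<forall>i\<in>{..n}. (-1) ^ i * (usol m lam p 0 \<alpha> (\<mu> \<alpha> * x i) - u (\<mu> \<alpha> * x i)) < 0)
      \<and> (\<forall>i\<in>{..n}. \<mu> \<alpha> * x i < rs) \<and> \<alpha> \<ge> 1) at_top"
    by eventually_elim auto
  then obtain \<alpha> where \<alpha>: "\<And>i. i \<le> n \<Longrightarrow> (-1) ^ i * (usol m lam p 0 \<alpha> (\<mu> \<alpha> * x i) - u (\<mu> \<alpha> * x i)) < 0"
     "\<And>i. i \<le> n \<Longrightarrow> \<mu> \<alpha> * x i < rs" "\<alpha> \<ge> 1"
    using eventually_happens'[OF trivial_limit_at_top_linorder] by (metis (no_types, lifting) atMost_iff)
  have "(usol m lam p 0 \<alpha> (\<mu> \<alpha> * x i) - u (\<mu> \<alpha> * x i)) * (usol m lam p 0 \<alpha> (\<mu> \<alpha> * x (Suc i)) - u (\<mu> \<alpha> * x (Suc i))) < 0"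
    if "i < n" for i
    using \<alpha>(1)[of i] \<alpha>(1)[of "Suc i"] that by (cases "even i") (auto simp: mult_less_0_iff)
  moreover have "\<mu> \<alpha> > 0" using \<alpha>(3) by (intro mupos) simp
  ultimately show ?thesis
    using \<alpha> x by (intro exI[of _ \<alpha>] conjI exI[of _ "\<lambda>i. \<mu> \<alpha> * x i"]) (auto intro: less_imp_le)
qed

end

text \<open>Completing the square with \<mu> = N - 2, the last inequality says |2 * \<theta> -
  (\<mu> - 2)| < 2 * sqrt (\<mu> + 1). Supercriticality puts 2 * \<theta> below the upper root. The
  lower root is 4 / (pJL - 1) for N \<ge> 11 and is not positive for N \<le> 10.\<close>

lemma joseph_lundgren_underdamped:
  fixes N :: nat and p \<theta> :: real
  assumes N: "N \<ge> 3" and p: "p > (real N + 2) / (real N - 2)" and JL: "ereal p < pJL N"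
    and th: "\<theta> = 2 / (p - 1)"
  shows "p > 1" "2 * \<theta> < real (N - 2)" "(real (N - 2) - 2 * \<theta>)\<^sup>2 < 8 * (real (N - 2) - \<theta>)"
proof -
  define \<mu> where "\<mu> = real (N - 2)"
  have mu: "\<mu> \<ge> 1" "real N = \<mu> + 2" using N by (auto simp: \<mu>_def)
  have p': "p > (\<mu> + 4) / \<mu>" using p mu by (simp add: add.commute)
  then have p1: "p - 1 > 4 / \<mu>" using mu by (simp add: field_simps)
  moreover have "4 / \<mu> > 0" using mu by simp
  ultimately have "p - 1 > 0" by linarith
  then show "p > 1" by simp
  have "4 < (p - 1) * \<mu>" using p1 mu by (simp add: field_simps)
  then show "2 * \<theta> < real (N - 2)" using \<open>p - 1 > 0\<close> by (simp add: th field_simps flip: \<mu>_def)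
  then have upper: "2 * \<theta> < \<mu>" by (simp add: \<mu>_def)
  define s where "s = sqrt (\<mu> + 1)"
  have s: "s\<^sup>2 = \<mu> + 1" "s > 1" using mu by (auto simp: s_def)
  have th0: "\<theta> > 0" using \<open>p - 1 > 0\<close> by (simp add: th)
  have lower: "2 * \<theta> > \<mu> - 2 - 2 * s"
  proof (cases "N \<ge> 11")
    case True
    then have "ereal p < ereal (1 + 4 / (\<mu> - 2 - 2 * s))" using JL mu by (simp add: pJL_def s_def add.commute)
    then have lt: "p - 1 < 4 / (\<mu> - 2 - 2 * s)" by simp
    \<comment> \<open>The sign of the denominator is read off from 0 < p - 1 < 4 / (\<mu> - 2 - 2 *
      s), without estimating the square root.\<close>
    then have "4 / (\<mu> - 2 - 2 * s) > 0" using \<open>p - 1 > 0\<close> by linarith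
    then have pos: "\<mu> - 2 - 2 * s > 0" by (simp add: zero_less_divide_iff)
    then have "(p - 1) * (\<mu> - 2 - 2 * s) < 4" using lt by (simp add: field_simps)
    then show ?thesis using \<open>p - 1 > 0\<close> by (simp add: th field_simps)
  next
    case False
    \<comment> \<open>Here (\<mu> - 2)^2 \<le> 4 * (\<mu> + 1) amounts to \<mu> \<le> 8, so the
      lower root is at most 0 and \<theta> > 0 suffices.\<close>
    then have "\<mu> \<le> 8" by (simp add: \<mu>_def)
    then have "\<mu>\<^sup>2 \<le> 8 * \<mu>" using mu by (simp add: power2_eq_square mult_right_mono)
    then have "(\<mu> - 2)\<^sup>2 \<le> (2 * s)\<^sup>2" using s by (simp add: power2_diff power_mult_distrib)
    then have "\<mu> - 2 \<le> 2 * s" using s by (intro power2_le_imp_le[of "\<mu> - 2" "2 * s"]) auto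
    then show ?thesis using th0 by linarith
  qed
  have "\<bar>2 * \<theta> - (\<mu> - 2)\<bar> < 2 * s" using upper lower s by linarith
  then have "(2 * \<theta> - (\<mu> - 2))\<^sup>2 < (2 * s)\<^sup>2" 
    using power_strict_mono[of "\<bar>2 * \<theta> - (\<mu> - 2)\<bar>" "2 * s" 2] by simp
  then show "(real (N - 2) - 2 * \<theta>)\<^sup>2 < 8 * (real (N - 2) - \<theta>)"
    using s unfolding \<mu>_def[symmetric] by (simp add: power2_eq_square algebra_simps)
qed

section \<open>From sign changes at \<open>r_star\<close> to solutions on annuli\<close>

theorem theorem1p7:
  fixes N :: nat and p lam r_star :: real and u_star :: "real \<Rightarrow> real"
  assumes "N \<ge> 3"
    and "(real N + 2) / (real N - 2) < p" and "ereal p < pJL N"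
    and "lam > 0"
    and "singular_solution N p lam u_star"
    and "r_star > 0" and "u_star r_star = 0"
    and "\<forall>r\<in>{0<..<r_star}. u_star r \<noteq> 0"
  shows "\<forall>k::nat. \<exists>\<rho>>0. \<rho> < r_star \<and>
           (\<forall>b. \<bar>b - r_star\<bar> < \<rho> \<longrightarrow>
              (\<exists>a0>0. a0 < b \<and>
                 (\<forall>a. 0 < a \<and> a < a0 \<longrightarrow>
                    (\<exists>U :: nat \<Rightarrow> real \<Rightarrow> real.
                       (\<forall>i<k. positive_dirichlet_solution N p lam a b (U i)) \<and>
                       (\<forall>i<k. \<forall>j<k. i \<noteq> j \<longrightarrow> (\<exists>x\<in>{a..b}. U i x \<noteq> U j x))))))"
proof
  fix k :: nat
  define m where "m = N - 2"
  define \<theta> where "\<theta> = 2 / (p - 1)"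
  have Nm: "m > 0" "N = m + 2" using assms(1) by (auto simp: m_def)
  note JL = joseph_lundgren_underdamped[OF assms(1-3) \<theta>_def, folded m_def]
  interpret emden m lam p by unfold_locales (use Nm assms(4) JL in auto)
  have th0: "\<theta> > 0" using JL(1) by (simp add: \<theta>_def)
  have A: "sing_const N p = (\<theta> * (real m - \<theta>)) powr (1 / (p - 1))"
    unfolding sing_const_def \<theta>_def Nm(2) by simp
  have Apos: "sing_const N p > 0" unfolding A using th0 JL(2) by simp
  obtain du ddu where d: "\<And>r. r > 0 \<Longrightarrow> (u_star has_real_derivative du r) (at r)"
      "\<And>r. r > 0 \<Longrightarrow> (du has_real_derivative ddu r) (at r)"
      "\<And>r. r > 0 \<Longrightarrow> ddu r + (real N - 1) / r * du r + lam * u_star r + \<bar>u_star r\<bar> powr (p - 1) * u_star r = 0"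
    and lim: "((\<lambda>r. u_star r / (sing_const N p * r powr (- 2 / (p - 1)))) \<longlongrightarrow> 1) (at_right 0)"
    using assms(5) unfolding singular_solution_def by blast
  have lim': "((\<lambda>r. u_star r / (sing_const N p * r powr (- \<theta>))) \<longlongrightarrow> 1) (at_right 0)"
    using lim by (simp add: \<theta>_def)
  have blow: "filterlim u_star at_top (at_right 0)"
  proof -
    have "filterlim (\<lambda>r::real. r powr (- \<theta>)) at_top (at_right 0)"
    proof -
      have "((\<lambda>r. r powr \<theta>) \<longlongrightarrow> 0 powr \<theta>) (at_right 0)"
        by (rule tendsto_powr'[OF tendsto_ident_at tendsto_const])
           (use th0 eventually_at_right_less[of 0] in \<open>auto elim: eventually_mono\<close>)
      moreover have "eventually (\<lambda>r::real. r powr \<theta> > 0) (at_right 0)"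
        using eventually_at_right_less[of 0] by eventually_elim simp
      ultimately have "filterlim (\<lambda>r::real. inverse (r powr \<theta>)) at_top (at_right 0)"
        by (intro filterlim_inverse_at_top) simp_all
      then show ?thesis by (simp add: powr_minus)
    qed
    then have "filterlim (\<lambda>r::real. sing_const N p * r powr (- \<theta>)) at_top (at_right 0)"
      by (rule filterlim_tendsto_pos_mult_at_top[OF tendsto_const Apos])
    then have "filterlim (\<lambda>r. u_star r / (sing_const N p * r powr (- \<theta>)) * (sing_const N p * r powr (- \<theta>))) at_top (at_right 0)"
      by (rule filterlim_tendsto_pos_mult_at_top[OF lim' zero_less_one])
    moreover have "eventually (\<lambda>r. u_star r / (sing_const N p * r powr (- \<theta>)) * (sing_const N p * r powr (- \<theta>)) = u_star r) (at_right 0)"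
      using eventually_at_right_less[of 0] by eventually_elim (use Apos in simp)
    ultimately show ?thesis by (rule filterlim_cong[OF refl refl, THEN iffD1, rotated])
  qed
  \<comment> \<open>Up to its first zero the odd power coincides with the cut-off one, so
    \<open>u_star\<close> solves the same equation as the regular solutions on (0, r_star].\<close>
  have nonneg: "u_star r \<ge> 0" if r: "0 < r" "r \<le> r_star" for r
  proof (rule ccontr)
    assume neg: "\<not> ?thesis"
    have "eventually (\<lambda>x. u_star x > 0) (at_right 0)" using blow by (simp add: filterlim_at_top_dense)
    then obtain y where y: "y > 0" "\<And>x. 0 < x \<Longrightarrow> x < y \<Longrightarrow> u_star x > 0"
      unfolding eventually_at_right_field by auto
    define x where "x = min (y / 2) r"
    have x: "0 < x" "x < y" "x \<le> r" using y r by (auto simp: x_def)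
    have "continuous_on {x..r} u_star"
      by (intro continuous_at_imp_continuous_on ballI DERIV_isCont[OF d(1)]) (use x in auto)
    moreover have "r < r_star" using neg assms(7) r by (cases "r = r_star") auto
    then have "u_star t \<noteq> 0" if "t \<in> {x..r}" for t using assms(8) that x by auto
    ultimately have "u_star x < 0 \<longleftrightarrow> u_star r < 0" using no_crossing[of x r u_star 0] x by blast
    then show False using y(2)[OF x(1,2)] neg by simp
  qed
  have "\<exists>s::nat \<Rightarrow> real. \<forall>i. s i > 0 \<and> s i < s (Suc i) \<and> (-1) ^ i * (usol m lam p 0 (s i) r_star - u_star r_star) > 0"
  proof (rule alternating_values[OF assms(6) d(1) _ blow])
    fix r assume r: "0 < r" "r \<le> r_star"
    have "\<bar>u_star r\<bar> powr (p - 1) * u_star r = max (u_star r) 0 powr p"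
      using nonneg[OF r] by (cases "u_star r = 0") (auto simp: max_absorb1 powr_mult_base mult.commute)
    moreover have "lam * max (u_star r) 0 = lam * u_star r" using nonneg[OF r] by (simp add: max_absorb1)
    moreover have N1: "real N - 1 = real m + 1" using Nm(2) by simp
    ultimately have "ddu r = - (real m + 1) / r * du r - nonlin lam p (u_star r)"
      using d(3)[OF r(1)] unfolding nonlin_def N1 minus_divide_left[symmetric] mult_minus_left by linarith
    then show "(du has_real_derivative - (real m + 1) / r * du r - nonlin lam p (u_star r)) (at r)"
      using d(2)[OF r(1)] by simp
  qed (use singular_solution_intersections[OF \<theta>_def JL(2,3) A lim' assms(6)] in auto)
  then obtain s where s: "\<And>i. s i > 0" "\<And>i. s i < s (Suc i)" "\<And>i::nat. (-1) ^ i * usol m lam p 0 (s i) r_star > 0"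
    using assms(7) by auto
  have smono: "s i < s j" if "i < j" for i j using lift_Suc_mono_less[of s, OF s(2) that] .
  \<comment> \<open>The k + 1 parameters \<open>s 0\<close>, ..., \<open>s k\<close> enclose k sign
    changes. Being finitely many strict inequalities, the signs persist for b near
    \<open>r_star\<close>.\<close>
  have "eventually (\<lambda>b. \<forall>i\<in>{..k}. (-1) ^ i * usol m lam p 0 (s i) b > 0) (nhds r_star)"
  proof (intro eventually_ball_finite ballI)
    fix i
    have "isCont (usol m lam p 0 (s i)) r_star"
      using usol_has_derivative[of 0 "s i" r_star] s(1)[of i] assms(6) by (auto intro: DERIV_isCont)
    then have "(usol m lam p 0 (s i) \<longlongrightarrow> usol m lam p 0 (s i) r_star) (nhds r_star)"
      by (simp add: tendsto_at_iff_tendsto_nhds isCont_def)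
    then have "((\<lambda>b. (-1) ^ i * usol m lam p 0 (s i) b) \<longlongrightarrow> (-1) ^ i * usol m lam p 0 (s i) r_star) (nhds r_star)"
      by (rule tendsto_mult_left)
    then show "eventually (\<lambda>b. (-1) ^ i * usol m lam p 0 (s i) b > 0) (nhds r_star)"
      using s(3) by (rule order_tendstoD)
  qed simp
  then obtain \<rho>0 where \<rho>0: "\<rho>0 > 0" "\<And>b i. \<bar>b - r_star\<bar> < \<rho>0 \<Longrightarrow> i \<le> k \<Longrightarrow> (-1) ^ i * usol m lam p 0 (s i) b > 0"
    unfolding eventually_nhds_metric dist_real_def by auto
  \<comment> \<open>The bound \<open>r_star / 2\<close> keeps b positive.\<close>
  define \<rho> where "\<rho> = min \<rho>0 (r_star / 2)"
  show "\<exists>\<rho>>0. \<rho> < r_star \<and>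
           (\<forall>b. \<bar>b - r_star\<bar> < \<rho> \<longrightarrow>
              (\<exists>a0>0. a0 < b \<and>
                 (\<forall>a. 0 < a \<and> a < a0 \<longrightarrow>
                    (\<exists>U :: nat \<Rightarrow> real \<Rightarrow> real.
                       (\<forall>i<k. positive_dirichlet_solution N p lam a b (U i)) \<and>
                       (\<forall>i<k. \<forall>j<k. i \<noteq> j \<longrightarrow> (\<exists>x\<in>{a..b}. U i x \<noteq> U j x))))))"
  proof (rule exI[of _ \<rho>], intro conjI allI impI)
    show "\<rho> > 0" "\<rho> < r_star" using \<rho>0(1) assms(6) by (auto simp: \<rho>_def)
    fix b assume b: "\<bar>b - r_star\<bar> < \<rho>"
    then have bpos: "b > 0" unfolding \<rho>_def by (auto simp: abs_if split: if_splits)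
    \<comment> \<open>With b fixed, the weighted estimate may be divided by b, and the regular
      solutions are approached as a tends to 0; the threshold for a depends on b.\<close>
    have "eventually (\<lambda>a. \<forall>i\<in>{..k}. (-1) ^ i * usol m lam p a (s i) b > 0) (at_right 0)"
    proof (intro eventually_ball_finite ballI)
      fix i assume i: "i \<in> {..k}"
      have "((\<lambda>a. usol m lam p a (s i) b - usol m lam p 0 (s i) b) \<longlongrightarrow> 0) (at_right 0)"
      proof (rule Lim_null_comparison)
        let ?C = "exp ((lam + p * s i powr (p - 1)) * b * b)"
        show "eventually (\<lambda>a. norm (usol m lam p a (s i) b - usol m lam p 0 (s i) b) \<le> s i * a * ?C / b) (at_right 0)"
          using eventually_at_right_less[of 0]
        proof eventually_elim
          case (elim a)
          then show ?case
            using usol_annulus_limit[of a "s i" b b] s(1)[of i] bpos by (simp add: field_simps)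
        qed
        have "((\<lambda>a. s i * a * ?C / b) \<longlongrightarrow> s i * 0 * ?C / b) (at_right 0)"
          using bpos by (intro tendsto_intros) auto
        then show "((\<lambda>a. s i * a * ?C / b) \<longlongrightarrow> 0) (at_right 0)" by simp
      qed
      then have "((\<lambda>a. (-1) ^ i * usol m lam p a (s i) b) \<longlongrightarrow> (-1) ^ i * usol m lam p 0 (s i) b) (at_right 0)"
        by (intro tendsto_mult_left) (simp add: LIM_zero_iff)
      moreover have "(-1) ^ i * usol m lam p 0 (s i) b > 0" using \<rho>0(2)[of b i] b i by (simp add: \<rho>_def)
      ultimately show "eventually (\<lambda>a. (-1) ^ i * usol m lam p a (s i) b > 0) (at_right 0)"
        by (rule order_tendstoD)
    qed simp
    then obtain a1 where a1: "a1 > 0" "\<And>a i. 0 < a \<Longrightarrow> a < a1 \<Longrightarrow> i \<le> k \<Longrightarrow> (-1) ^ i * usol m lam p a (s i) b > 0"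
      unfolding eventually_at_right_field by auto
    show "\<exists>a0>0. a0 < b \<and> (\<forall>a. 0 < a \<and> a < a0 \<longrightarrow>
                    (\<exists>U :: nat \<Rightarrow> real \<Rightarrow> real.
                       (\<forall>i<k. positive_dirichlet_solution N p lam a b (U i)) \<and>
                       (\<forall>i<k. \<forall>j<k. i \<noteq> j \<longrightarrow> (\<exists>x\<in>{a..b}. U i x \<noteq> U j x))))"
    proof (intro exI[of _ "min a1 (b / 2)"] conjI allI impI)
      show "min a1 (b / 2) > 0" "min a1 (b / 2) < b" using a1(1) bpos by auto
      fix a assume "0 < a \<and> a < min a1 (b / 2)"
      then have a: "0 < a" "a < a1" "a < b" using bpos by auto
      \<comment> \<open>Strict signs at both ends put each root in the open interval, so roots from
        different intervals are distinct.\<close>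
      have "\<exists>\<beta>. s i < \<beta> \<and> \<beta> < s (Suc i) \<and> usol m lam p a \<beta> b = 0" if i: "i < k" for i
      proof -
        have c: "continuous_on {s i..s (Suc i)} (\<lambda>\<beta>. usol m lam p a \<beta> b)"
          by (rule continuous_on_subset[OF usol_continuous_param]) (use a s(1)[of i] bpos in auto)
        have sg: "(-1) ^ i * usol m lam p a (s i) b > 0" "(-1) ^ Suc i * usol m lam p a (s (Suc i)) b > 0"
          by (rule a1(2); use a i in simp)+
        have "\<exists>\<beta>\<ge>s i. \<beta> \<le> s (Suc i) \<and> usol m lam p a \<beta> b = 0"
          using IVT'[of "\<lambda>\<beta>. usol m lam p a \<beta> b" "s i" 0 "s (Suc i)"] IVT2'[of "\<lambda>\<beta>. usol m lam p a \<beta> b" "s (Suc i)" 0 "s i"] sg c s(2)[of i]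
          by (cases "even i") auto
        then obtain \<beta> where \<beta>: "s i \<le> \<beta>" "\<beta> \<le> s (Suc i)" "usol m lam p a \<beta> b = 0" by blast
        then have "\<beta> \<noteq> s i" "\<beta> \<noteq> s (Suc i)" using sg by auto
        then show ?thesis using \<beta> by (intro exI[of _ \<beta>]) auto
      qed
      then obtain \<beta> where \<beta>: "\<And>i. i < k \<Longrightarrow> s i < \<beta> i" "\<And>i. i < k \<Longrightarrow> \<beta> i < s (Suc i)" "\<And>i. i < k \<Longrightarrow> usol m lam p a (\<beta> i) b = 0"
        by metis
      have \<beta>pos: "\<beta> i > 0" if "i < k" for i using \<beta>(1)[OF that] s(1)[of i] by linarith
      have \<beta>mono: "\<beta> i < \<beta> j" if "i < j" "j < k" for i j
      proof -
        have "s (Suc i) \<le> s j" using smono[of "Suc i" j] that by (cases "Suc i = j") auto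
        then show ?thesis using \<beta>(2)[of i] \<beta>(1)[of j] that by linarith
      qed
      show "\<exists>U :: nat \<Rightarrow> real \<Rightarrow> real.
                       (\<forall>i<k. positive_dirichlet_solution N p lam a b (U i)) \<and>
                       (\<forall>i<k. \<forall>j<k. i \<noteq> j \<longrightarrow> (\<exists>x\<in>{a..b}. U i x \<noteq> U j x))"
      proof (intro exI[of _ "\<lambda>i. usol m lam p a (\<beta> i)"] conjI allI impI)
        fix i :: nat assume i: "i < k"
        show "positive_dirichlet_solution N p lam a b (usol m lam p a (\<beta> i))"
          unfolding Nm(2) by (rule usol_dirichlet) (use a \<beta>pos \<beta>(3) i in auto)
      next
        fix i j :: nat assume i: "i < k" and j: "j < k" "i \<noteq> j"
        then have "\<beta> i \<noteq> \<beta> j" using \<beta>mono[of i j] \<beta>mono[of j i] i by (cases "i < j") auto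
        then show "\<exists>x\<in>{a..b}. usol m lam p a (\<beta> i) x \<noteq> usol m lam p a (\<beta> j) x"
          using usol_inj[of a "\<beta> i" "\<beta> j" b] a \<beta>pos i j by blast
      qed
    qed
  qed
qed

end
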